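(* Let $K$ be a field. Each of the following classes of unital associative $K$-algebras consists of PLM-algebras (i.e. $K$-algebras that are PLM-rings): 1. Algebras $A$ such that the endomorphism algebra $\mathrm{End}_A(M)$ of each simple $A$-module $M$ is an algebraic algebra. 2. Algebras that admit an ascending $\mathbb{N}$-filtration such that the associated graded algebra is a finitely generated commutative algebra. 3. The universal enveloping algebra $U(\mathcal{G})$ of a finite dimensional Lie algebra $\mathcal{G}$ over $K$.
   Context: Modules are left modules. $Z(R)$ denotes the centre of a ring $R$ and $\mathrm{Max}(Z(R))$ the set of maximal ideals of $Z(R)$. A ring $R$ is called a PLM-ring if for every simple left $R$-module $M$, $\mathrm{ann}_R(M)\cap Z(R)\in \mathrm{Max}(Z(R))$. An algebra over a field $K$ is called an algebraic algebra if each of its elements is algebraic over $K$, i.e. is a root of a monic polynomial with coefficients in $K$. An ascending $\mathbb{N}$-filtration on $A$ is a family of subspaces $A_0\subseteq A_1\subseteq\cdots$ with $1\in A_0$, $A=\bigcup_{i\ge 0} A_i$ and $A_iA_j\subseteq A_{i+j}$; its associated graded algebra is $\bigoplus_{i\geq 0}A_i/A_{i-1}$ (with $A_{-1}=0$). *)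

theory Defs
  imports "HOL-Algebra.Module" "HOL-Algebra.QuotRing" "HOL-Algebra.Subrings" "HOL-Algebra.UnivPoly"
begin

section \<open>Left modules over noncommutative rings\<close>

text \<open>The library locale \<^locale>\<open>module\<close> requires a commutative ring of scalars.  As there, the
  fields \<^const>\<open>mult\<close> and \<^const>\<open>one\<close> of a record used as a module play no role.\<close>

locale left_module = R?: ring R + M?: abelian_group M
  for R :: "('a, 'r) ring_scheme" (structure) and M :: "('a, 'm, 's) module_scheme" (structure) +
  assumes smult_closed:
      "\<lbrakk>a \<in> carrier R; x \<in> carrier M\<rbrakk> \<Longrightarrow> a \<odot>\<^bsub>M\<^esub> x \<in> carrier M"
    and smult_l_distr:
      "\<lbrakk>a \<in> carrier R; b \<in> carrier R; x \<in> carrier M\<rbrakk> \<Longrightarrow>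
        (a \<oplus> b) \<odot>\<^bsub>M\<^esub> x = a \<odot>\<^bsub>M\<^esub> x \<oplus>\<^bsub>M\<^esub> b \<odot>\<^bsub>M\<^esub> x"
    and smult_r_distr:
      "\<lbrakk>a \<in> carrier R; x \<in> carrier M; y \<in> carrier M\<rbrakk> \<Longrightarrow>
        a \<odot>\<^bsub>M\<^esub> (x \<oplus>\<^bsub>M\<^esub> y) = a \<odot>\<^bsub>M\<^esub> x \<oplus>\<^bsub>M\<^esub> a \<odot>\<^bsub>M\<^esub> y"
    and smult_assoc:
      "\<lbrakk>a \<in> carrier R; b \<in> carrier R; x \<in> carrier M\<rbrakk> \<Longrightarrow>
        (a \<otimes> b) \<odot>\<^bsub>M\<^esub> x = a \<odot>\<^bsub>M\<^esub> (b \<odot>\<^bsub>M\<^esub> x)"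
    and smult_one: "x \<in> carrier M \<Longrightarrow> \<one> \<odot>\<^bsub>M\<^esub> x = x"

definition simple_module :: "('a, 'r) ring_scheme \<Rightarrow> ('a, 'm, 's) module_scheme \<Rightarrow> bool"
  where "simple_module R M \<longleftrightarrow>
    left_module R M \<and> carrier M \<noteq> {\<zero>\<^bsub>M\<^esub>} \<and>
    (\<forall>N. submodule N R M \<longrightarrow> N = {\<zero>\<^bsub>M\<^esub>} \<or> N = carrier M)"

definition annihilator :: "('a, 'r) ring_scheme \<Rightarrow> ('a, 'm, 's) module_scheme \<Rightarrow> 'a set"
  where "annihilator R M = {r \<in> carrier R. \<forall>x \<in> carrier M. r \<odot>\<^bsub>M\<^esub> x = \<zero>\<^bsub>M\<^esub>}"

definition centre :: "('a, 'r) ring_scheme \<Rightarrow> 'a set"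
  where "centre R = {z \<in> carrier R. \<forall>x \<in> carrier R. z \<otimes>\<^bsub>R\<^esub> x = x \<otimes>\<^bsub>R\<^esub> z}"

definition Max_centre :: "('a, 'r) ring_scheme \<Rightarrow> 'a set set"
  where "Max_centre R = {I. maximalideal I (R\<lparr>carrier := centre R\<rparr>)}"

text \<open>HOL cannot quantify over all modules at once, only over those whose elements live in a given
  type, so the type of module elements is a parameter.  A theorem with conclusion
  \<open>PLM_ring TYPE('m) R\<close>, for a type variable \<open>'m\<close> independent of \<open>R\<close>, covers all simple
  modules.\<close>

definition PLM_ring :: "'m itself \<Rightarrow> ('a, 'r) ring_scheme \<Rightarrow> bool"
  where "PLM_ring (_ :: 'm itself) R \<longleftrightarrow>
    ring R \<and>
    (\<forall>M :: ('a, 'm) module. simple_module R M \<longrightarrow> annihilator R M \<inter> centre R \<in> Max_centre R)"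

section \<open>Algebras\<close>

text \<open>The library locale \<^locale>\<open>algebra\<close> is restricted to commutative algebras.\<close>

locale K_algebra = module K A + ring A
  for K :: "('k, 'x) ring_scheme" (structure) and A :: "('k, 'a, 's) module_scheme" (structure) +
  assumes smult_mult_left:
      "\<lbrakk>k \<in> carrier K; x \<in> carrier A; y \<in> carrier A\<rbrakk> \<Longrightarrow>
        (k \<odot>\<^bsub>A\<^esub> x) \<otimes>\<^bsub>A\<^esub> y = k \<odot>\<^bsub>A\<^esub> (x \<otimes>\<^bsub>A\<^esub> y)"
    and smult_mult_right:
      "\<lbrakk>k \<in> carrier K; x \<in> carrier A; y \<in> carrier A\<rbrakk> \<Longrightarrow>
        x \<otimes>\<^bsub>A\<^esub> (k \<odot>\<^bsub>A\<^esub> y) = k \<odot>\<^bsub>A\<^esub> (x \<otimes>\<^bsub>A\<^esub> y)"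

definition PLM_algebra ::
    "'m itself \<Rightarrow> ('k, 'x) ring_scheme \<Rightarrow> ('k, 'a, 's) module_scheme \<Rightarrow> bool"
  where "PLM_algebra T K A \<longleftrightarrow> K_algebra K A \<and> PLM_ring T A"

definition algebraic_algebra :: "('k, 'x) ring_scheme \<Rightarrow> ('k, 'a, 's) module_scheme \<Rightarrow> bool"
  where "algebraic_algebra K A \<longleftrightarrow>
    (\<forall>x \<in> carrier A. \<exists>p \<in> carrier (UP K).
       coeff (UP K) p (deg K p) = \<one>\<^bsub>K\<^esub> \<and>
       eval K A (\<lambda>c. c \<odot>\<^bsub>A\<^esub> \<one>\<^bsub>A\<^esub>) x p = \<zero>\<^bsub>A\<^esub>)"

definition commutative_algebra :: "('k, 'a, 's) module_scheme \<Rightarrow> bool"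
  where "commutative_algebra A \<longleftrightarrow>
    (\<forall>x \<in> carrier A. \<forall>y \<in> carrier A. x \<otimes>\<^bsub>A\<^esub> y = y \<otimes>\<^bsub>A\<^esub> x)"

definition finitely_generated_algebra ::
    "('k, 'x) ring_scheme \<Rightarrow> ('k, 'a, 's) module_scheme \<Rightarrow> bool"
  where "finitely_generated_algebra K A \<longleftrightarrow>
    (\<exists>S. finite S \<and> S \<subseteq> carrier A \<and>
      (\<forall>B. subring B A \<and> submodule B K A \<and> S \<subseteq> B \<longrightarrow> B = carrier A))"

definition finite_dimensional :: "('k, 'x) ring_scheme \<Rightarrow> ('k, 'a, 's) module_scheme \<Rightarrow> bool"
  where "finite_dimensional K V \<longleftrightarrow>
    (\<exists>S. finite S \<and> S \<subseteq> carrier V \<and>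
      (\<forall>W. submodule W K V \<and> S \<subseteq> W \<longrightarrow> W = carrier V))"

text \<open>Endomorphisms are maps on \<^term>\<open>carrier M\<close>, normalised to be \<^const>\<open>undefined\<close> elsewhere; the
  scalar \<open>k\<close> acts on \<open>M\<close> through its image \<open>k \<odot> \<one>\<close> in \<open>A\<close>.\<close>

definition End_algebra ::
    "('k, 'a, 's) module_scheme \<Rightarrow> ('a, 'm, 't) module_scheme \<Rightarrow> ('k, 'm \<Rightarrow> 'm) module"
  where "End_algebra A M =
    \<lparr>carrier = {f \<in> carrier M \<rightarrow>\<^sub>E carrier M.
        (\<forall>x \<in> carrier M. \<forall>y \<in> carrier M. f (x \<oplus>\<^bsub>M\<^esub> y) = f x \<oplus>\<^bsub>M\<^esub> f y) \<and>
        (\<forall>a \<in> carrier A. \<forall>x \<in> carrier M. f (a \<odot>\<^bsub>M\<^esub> x) = a \<odot>\<^bsub>M\<^esub> f x)},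
     mult = (\<lambda>f g. compose (carrier M) f g),
     one = (\<lambda>x \<in> carrier M. x),
     zero = (\<lambda>x \<in> carrier M. \<zero>\<^bsub>M\<^esub>),
     add = (\<lambda>f g. \<lambda>x \<in> carrier M. f x \<oplus>\<^bsub>M\<^esub> g x),
     smult = (\<lambda>k f. \<lambda>x \<in> carrier M. (k \<odot>\<^bsub>A\<^esub> \<one>\<^bsub>A\<^esub>) \<odot>\<^bsub>M\<^esub> f x)\<rparr>"

section \<open>Filtrations and associated graded algebras\<close>

definition filtration ::
    "('k, 'x) ring_scheme \<Rightarrow> ('k, 'a, 's) module_scheme \<Rightarrow> (nat \<Rightarrow> 'a set) \<Rightarrow> bool"
  where "filtration K A F \<longleftrightarrow>
    (\<forall>i. submodule (F i) K A) \<and>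
    (\<forall>i. F i \<subseteq> F (Suc i)) \<and>
    \<one>\<^bsub>A\<^esub> \<in> F 0 \<and>
    carrier A = (\<Union>i. F i) \<and>
    (\<forall>i j. \<forall>x \<in> F i. \<forall>y \<in> F j. x \<otimes>\<^bsub>A\<^esub> y \<in> F (i + j))"

text \<open>\<open>filt_pred A F i\<close> is \<open>F (i - 1)\<close>, with \<open>F (-1) = 0\<close>.\<close>

definition filt_pred :: "('k, 'a, 's) module_scheme \<Rightarrow> (nat \<Rightarrow> 'a set) \<Rightarrow> nat \<Rightarrow> 'a set"
  where "filt_pred A F i = (case i of 0 \<Rightarrow> {\<zero>\<^bsub>A\<^esub>} | Suc j \<Rightarrow> F j)"

text \<open>The additive group \<open>F i / F (i - 1)\<close>, written as a multiplicative group record as is usual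
  for \<^const>\<open>A_FactGroup\<close>.\<close>

definition gr_component ::
    "('k, 'a, 's) module_scheme \<Rightarrow> (nat \<Rightarrow> 'a set) \<Rightarrow> nat \<Rightarrow> 'a set monoid"
  where "gr_component A F i = (A\<lparr>carrier := F i\<rparr>) A_Mod (filt_pred A F i)"

text \<open>An element of the direct sum is the finitely supported family of its homogeneous components,
  which are cosets.  The product of the classes of \<open>x \<in> F i\<close> and \<open>y \<in> F j\<close> is the class of
  \<open>x \<otimes> y\<close> modulo \<open>F (i + j - 1)\<close>; the \<^const>\<open>finprod\<close> below is the sum in the additive group
  \<open>F n / F (n - 1)\<close>.\<close>

definition associated_graded ::
    "('k, 'a, 's) module_scheme \<Rightarrow> (nat \<Rightarrow> 'a set) \<Rightarrow> ('k, nat \<Rightarrow> 'a set) module"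
  where "associated_graded A F =
    \<lparr>carrier = {g. (\<forall>n. g n \<in> carrier (gr_component A F n)) \<and>
                   finite {n. g n \<noteq> filt_pred A F n}},
     mult = (\<lambda>g h n. finprod (gr_component A F n)
                       (\<lambda>i. [mod filt_pred A F n:] (g i) \<Otimes>\<^bsub>A\<^esub> (h (n - i))) {..n}),
     one = (\<lambda>n. if n = 0 then filt_pred A F 0 +>\<^bsub>A\<^esub> \<one>\<^bsub>A\<^esub> else filt_pred A F n),
     zero = filt_pred A F,
     add = (\<lambda>g h n. g n <+>\<^bsub>A\<^esub> h n),
     smult = (\<lambda>k g n. \<Union>x \<in> g n. filt_pred A F n +>\<^bsub>A\<^esub> (k \<odot>\<^bsub>A\<^esub> x))\<rparr>"

section \<open>Lie algebras and universal enveloping algebras\<close>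

locale lie_algebra = module K L
  for K :: "('k, 'x) ring_scheme" (structure) and L :: "('k, 'g, 's) module_scheme" (structure) +
  fixes br :: "'g \<Rightarrow> 'g \<Rightarrow> 'g"
  assumes br_closed: "\<lbrakk>x \<in> carrier L; y \<in> carrier L\<rbrakk> \<Longrightarrow> br x y \<in> carrier L"
    and br_add_left:
      "\<lbrakk>x \<in> carrier L; y \<in> carrier L; z \<in> carrier L\<rbrakk> \<Longrightarrow>
        br (x \<oplus>\<^bsub>L\<^esub> y) z = br x z \<oplus>\<^bsub>L\<^esub> br y z"
    and br_add_right:
      "\<lbrakk>x \<in> carrier L; y \<in> carrier L; z \<in> carrier L\<rbrakk> \<Longrightarrow>
        br x (y \<oplus>\<^bsub>L\<^esub> z) = br x y \<oplus>\<^bsub>L\<^esub> br x z"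
    and br_smult_left:
      "\<lbrakk>k \<in> carrier K; x \<in> carrier L; y \<in> carrier L\<rbrakk> \<Longrightarrow> br (k \<odot>\<^bsub>L\<^esub> x) y = k \<odot>\<^bsub>L\<^esub> br x y"
    and br_smult_right:
      "\<lbrakk>k \<in> carrier K; x \<in> carrier L; y \<in> carrier L\<rbrakk> \<Longrightarrow> br x (k \<odot>\<^bsub>L\<^esub> y) = k \<odot>\<^bsub>L\<^esub> br x y"
    and br_alternating: "x \<in> carrier L \<Longrightarrow> br x x = \<zero>\<^bsub>L\<^esub>"
    and jacobi:
      "\<lbrakk>x \<in> carrier L; y \<in> carrier L; z \<in> carrier L\<rbrakk> \<Longrightarrow>
        br x (br y z) \<oplus>\<^bsub>L\<^esub> br y (br z x) \<oplus>\<^bsub>L\<^esub> br z (br x y) = \<zero>\<^bsub>L\<^esub>"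

text \<open>The free associative unital algebra on a set \<open>X\<close>: finitely supported functions on the words
  over \<open>X\<close>, multiplied by convolution with respect to concatenation.\<close>

definition free_algebra :: "('k, 'x) ring_scheme \<Rightarrow> 'g set \<Rightarrow> ('k, 'g list \<Rightarrow> 'k) module"
  where "free_algebra K X =
    \<lparr>carrier = {p. (\<forall>w. p w \<in> carrier K) \<and> finite {w. p w \<noteq> \<zero>\<^bsub>K\<^esub>} \<and>
                   {w. p w \<noteq> \<zero>\<^bsub>K\<^esub>} \<subseteq> lists X},
     mult = (\<lambda>p q w. \<Oplus>\<^bsub>K\<^esub>i \<in> {..length w}. p (take i w) \<otimes>\<^bsub>K\<^esub> q (drop i w)),
     one = (\<lambda>w. if w = [] then \<one>\<^bsub>K\<^esub> else \<zero>\<^bsub>K\<^esub>),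
     zero = (\<lambda>w. \<zero>\<^bsub>K\<^esub>),
     add = (\<lambda>p q w. p w \<oplus>\<^bsub>K\<^esub> q w),
     smult = (\<lambda>k p w. k \<otimes>\<^bsub>K\<^esub> p w)\<rparr>"

definition free_gen :: "('k, 'x) ring_scheme \<Rightarrow> 'g \<Rightarrow> 'g list \<Rightarrow> 'k"
  where "free_gen K x = (\<lambda>w. if w = [x] then \<one>\<^bsub>K\<^esub> else \<zero>\<^bsub>K\<^esub>)"

text \<open>\<^const>\<open>FactRing\<close> together with the induced scalar multiplication.\<close>

definition quotient_algebra ::
    "('k, 'a, 's) module_scheme \<Rightarrow> 'a set \<Rightarrow> ('k, 'a set) module"
  where "quotient_algebra A I =
    \<lparr>carrier = carrier (A Quot I), mult = mult (A Quot I), one = one (A Quot I),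
     zero = zero (A Quot I), add = add (A Quot I),
     smult = (\<lambda>k X. \<Union>x \<in> X. I +>\<^bsub>A\<^esub> (k \<odot>\<^bsub>A\<^esub> x))\<rparr>"

text \<open>The free algebra on the set \<^term>\<open>carrier L\<close> modulo the relations in the first two lines is the
  tensor algebra of the vector space \<open>L\<close>; the last line adds the relations
  \<open>x \<otimes> y - y \<otimes> x = [x, y]\<close>.\<close>

definition enveloping_relations ::
    "('k, 'x) ring_scheme \<Rightarrow> ('k, 'g, 's) module_scheme \<Rightarrow> ('g \<Rightarrow> 'g \<Rightarrow> 'g) \<Rightarrow> ('g list \<Rightarrow> 'k) set"
  where "enveloping_relations K L br =
    (let T = free_algebra K (carrier L); \<iota> = free_gen K in
      {\<iota> (x \<oplus>\<^bsub>L\<^esub> y) \<ominus>\<^bsub>T\<^esub> (\<iota> x \<oplus>\<^bsub>T\<^esub> \<iota> y) | x y. x \<in> carrier L \<and> y \<in> carrier L} \<union>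
      {\<iota> (k \<odot>\<^bsub>L\<^esub> x) \<ominus>\<^bsub>T\<^esub> k \<odot>\<^bsub>T\<^esub> \<iota> x | k x. k \<in> carrier K \<and> x \<in> carrier L} \<union>
      {((\<iota> x \<otimes>\<^bsub>T\<^esub> \<iota> y) \<ominus>\<^bsub>T\<^esub> (\<iota> y \<otimes>\<^bsub>T\<^esub> \<iota> x)) \<ominus>\<^bsub>T\<^esub> \<iota> (br x y) | x y.
         x \<in> carrier L \<and> y \<in> carrier L})"

definition universal_enveloping_algebra ::
    "('k, 'x) ring_scheme \<Rightarrow> ('k, 'g, 's) module_scheme \<Rightarrow> ('g \<Rightarrow> 'g \<Rightarrow> 'g) \<Rightarrow>
      ('k, ('g list \<Rightarrow> 'k) set) module"
  where "universal_enveloping_algebra K L br =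
    (let T = free_algebra K (carrier L)
     in quotient_algebra T (genideal T (enveloping_relations K L br)))"

end

(* If a central element z of A acts on a simple module M as an element algebraic over K, its inverse
in End(M) is a polynomial in z, so the image of the centre is a field.  For the classes 2 and 3
algebraicity is Quillen's lemma, proved here by an elementary form of generic freeness.  The ordered
monomials in lifts of the generators of the graded algebra, applied to a vector m, span M over
B = K[z] and are well-ordered by weighted degree and then lexicographically.  The exponents whose
vector is B-torsion modulo the smaller ones form an up-set, because the generators commute modulo
terms of lower degree; by Dickson's lemma one nonzero f in B annihilates all these torsions.  As
nonzero elements of B act invertibly on M, comparing coefficients at m shows that every nonzero
g in B divides a power of f modulo the annihilator.  For g = 1 + z f this is impossible if z is
transcendental.  The enveloping algebra is filtered by word length; its generators then satisfy the
same commutation hypothesis, and the Poincare-Birkhoff-Witt theorem is not needed. *)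

theory Submission
  imports Defs
begin

section \<open>Simple modules and the centre\<close>

text \<open>Modulo the annihilator, \<open>B\<close> is a domain, and by Schur's lemma
  \<open>M\<close> is a vector space over its fraction field. Generic freeness, on the other hand,
  makes \<open>M\<close> a nonzero free module over the domain obtained by inverting
  \<open>f\<close>. A nonzero free module on which all nonzero scalars are invertible forces that
  domain to be a field, so the image of \<open>B\<close> is a Goldman domain: inverting one element
  inverts all. A polynomial ring over a field is not of this kind, by Euclid's argument that
  \<open>1 + X p\<close> is prime to \<open>p\<close>. If \<open>1 + z f\<close> itself acts as
  zero, then \<open>-f\<close> is already an inverse of \<open>z\<close>. The localisation is never
  formed; powers of \<open>f\<close> keep track of the denominators. Weighted degree has to come
  first in the order because a commutator is only known to drop in the filtration, wherever its
  monomials stand lexicographically; the lexicographic part makes the order total.\<close>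

context left_module
begin

lemma smult_zero_left: "x \<in> carrier M \<Longrightarrow> \<zero> \<odot>\<^bsub>M\<^esub> x = \<zero>\<^bsub>M\<^esub>"
  using smult_l_distr[of \<zero> \<zero> x] smult_closed[of \<zero> x] by (metis M.add.r_cancel_one' R.r_zero R.zero_closed)

lemma smult_zero_right: "a \<in> carrier R \<Longrightarrow> a \<odot>\<^bsub>M\<^esub> \<zero>\<^bsub>M\<^esub> = \<zero>\<^bsub>M\<^esub>"
  using smult_r_distr[of a "\<zero>\<^bsub>M\<^esub>" "\<zero>\<^bsub>M\<^esub>"] smult_closed[of a "\<zero>\<^bsub>M\<^esub>"]
  by (metis M.add.r_cancel_one' M.r_zero M.zero_closed)

lemma smult_minus_left:
  assumes "a \<in> carrier R" "x \<in> carrier M"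
  shows "(\<ominus> a) \<odot>\<^bsub>M\<^esub> x = \<ominus>\<^bsub>M\<^esub> (a \<odot>\<^bsub>M\<^esub> x)"
proof -
  have "(\<ominus> a) \<odot>\<^bsub>M\<^esub> x \<oplus>\<^bsub>M\<^esub> a \<odot>\<^bsub>M\<^esub> x = \<zero>\<^bsub>M\<^esub>"
    using assms by (metis R.l_neg R.add.inv_closed smult_l_distr smult_zero_left)
  thus ?thesis using assms smult_closed by (metis M.minus_equality R.add.inv_closed)
qed

lemma submodule_intro:
  assumes "H \<subseteq> carrier M" "\<zero>\<^bsub>M\<^esub> \<in> H"
    and "\<And>x y. x \<in> H \<Longrightarrow> y \<in> H \<Longrightarrow> x \<oplus>\<^bsub>M\<^esub> y \<in> H"
    and "\<And>a x. a \<in> carrier R \<Longrightarrow> x \<in> H \<Longrightarrow> a \<odot>\<^bsub>M\<^esub> x \<in> H"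
  shows "submodule H R M"
proof -
  have "\<ominus>\<^bsub>M\<^esub> x \<in> H" if "x \<in> H" for x
  proof -
    have "(\<ominus> \<one>) \<odot>\<^bsub>M\<^esub> x = \<ominus>\<^bsub>M\<^esub> x" using smult_minus_left[of \<one> x] smult_one that assms(1) by auto
    thus ?thesis using assms(4)[of "\<ominus> \<one>" x] that by simp
  qed
  hence "subgroup H (add_monoid M)"
    using M.add.subgroupI[of H] assms by (auto simp: a_inv_def)
  thus ?thesis using assms(4) by (simp add: submodule_def submodule_axioms_def)
qed

lemma centreD: "z \<in> centre R \<Longrightarrow> z \<in> carrier R" "z \<in> centre R \<Longrightarrow> x \<in> carrier R \<Longrightarrow> z \<otimes> x = x \<otimes> z"
  by (auto simp: centre_def)

lemma centre_commutes_smult: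
  "z \<in> centre R \<Longrightarrow> a \<in> carrier R \<Longrightarrow> x \<in> carrier M \<Longrightarrow> z \<odot>\<^bsub>M\<^esub> (a \<odot>\<^bsub>M\<^esub> x) = a \<odot>\<^bsub>M\<^esub> (z \<odot>\<^bsub>M\<^esub> x)"
  by (metis centreD smult_assoc)

lemma annihilatorD: "r \<in> annihilator R M \<Longrightarrow> r \<in> carrier R"
  "r \<in> annihilator R M \<Longrightarrow> x \<in> carrier M \<Longrightarrow> r \<odot>\<^bsub>M\<^esub> x = \<zero>\<^bsub>M\<^esub>"
  by (auto simp: annihilator_def)

text \<open>Congruences modulo the annihilator stand for equalities of endomorphisms of
  \<open>M\<close> throughout, so that no quotient ring has to be formed.\<close>

lemma annihilator_minus_iff:
  assumes "a \<in> carrier R" "b \<in> carrier R"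
  shows "a \<ominus> b \<in> annihilator R M \<longleftrightarrow> (\<forall>x \<in> carrier M. a \<odot>\<^bsub>M\<^esub> x = b \<odot>\<^bsub>M\<^esub> x)"
proof -
  have "(a \<ominus> b) \<odot>\<^bsub>M\<^esub> x = \<zero>\<^bsub>M\<^esub> \<longleftrightarrow> a \<odot>\<^bsub>M\<^esub> x = b \<odot>\<^bsub>M\<^esub> x" if x: "x \<in> carrier M" for x
  proof -
    have "(a \<ominus> b) \<odot>\<^bsub>M\<^esub> x = a \<odot>\<^bsub>M\<^esub> x \<ominus>\<^bsub>M\<^esub> b \<odot>\<^bsub>M\<^esub> x"
      using assms x by (simp add: a_minus_def smult_l_distr smult_minus_left)
    thus ?thesis using assms x smult_closed by (metis M.minus_equality M.minus_minus M.r_neg M.add.inv_closed a_minus_def)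
  qed
  thus ?thesis using assms by (auto simp: annihilator_def)
qed

end

section \<open>The centre as a commutative ring\<close>

lemma (in ring) centre_subcring: "subcring (centre R) R"
proof (rule subcringI[OF subringI])
  fix h assume h: "h \<in> centre R"
  have "\<ominus> h \<otimes> x = x \<otimes> \<ominus> h" if "x \<in> carrier R" for x
    using that h by (simp add: centre_def l_minus r_minus)
  thus "\<ominus> h \<in> centre R" using h by (simp add: centre_def)
next
  fix g h assume gh: "g \<in> centre R" "h \<in> centre R"
  have c: "g \<in> carrier R" "h \<in> carrier R" using gh by (auto simp: centre_def)
  have gx: "g \<otimes> x = x \<otimes> g" and hx: "h \<otimes> x = x \<otimes> h" if "x \<in> carrier R" for x
    using gh that by (auto simp: centre_def)
  have "g \<otimes> h \<otimes> x = x \<otimes> (g \<otimes> h)" if "x \<in> carrier R" for x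
    using that c by (metis gx hx m_assoc)
  thus "g \<otimes> h \<in> centre R" using c by (simp add: centre_def)
  have "(g \<oplus> h) \<otimes> x = x \<otimes> (g \<oplus> h)" if "x \<in> carrier R" for x
    using that c gx[OF that] hx[OF that] by (simp only: l_distr r_distr)
  thus "g \<oplus> h \<in> centre R" using c by (simp add: centre_def)
  show "g \<otimes> h = h \<otimes> g" using gx c by blast
qed (auto simp: centre_def)

text \<open>This ring carries the ideals in \<open>Max_centre\<close>, and it is the commutative
  target that evaluation of polynomials from \<open>UP\<close> requires.\<close>

lemma (in ring) centre_cring: "cring (R\<lparr>carrier := centre R\<rparr>)"
proof -
  have "ring (R\<lparr>carrier := centre R\<rparr>)"
    using subring_is_ring[OF subcring.axioms(1)[OF centre_subcring]] .
  then interpret Z: ring "R\<lparr>carrier := centre R\<rparr>" .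
  show ?thesis
    using Z.monoid_comm_monoidI subcringE(8)[OF centre_subcring] Z.ring_axioms
    by (intro cring.intro) (simp_all add: comm_monoid_def)
qed

section \<open>Schur's lemma for central elements\<close>

locale simple_left_module = left_module +
  assumes nontrivial: "carrier M \<noteq> {\<zero>\<^bsub>M\<^esub>}"
    and simple: "submodule N R M \<Longrightarrow> N = {\<zero>\<^bsub>M\<^esub>} \<or> N = carrier M"

lemma simple_module_iff: "simple_module R M \<longleftrightarrow> simple_left_module R M"
  by (auto simp: simple_module_def simple_left_module_def simple_left_module_axioms_def)

context simple_left_module
begin

lemma obtain_nonzero: obtains m where "m \<in> carrier M" "m \<noteq> \<zero>\<^bsub>M\<^esub>"
  using nontrivial M.zero_closed by blast

text \<open>The multiples of \<open>m\<close> form a submodule containing \<open>m\<close>, which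
  simplicity makes the whole module.\<close>

lemma cyclic:
  assumes "m \<in> carrier M" "m \<noteq> \<zero>\<^bsub>M\<^esub>" "x \<in> carrier M"
  obtains a where "a \<in> carrier R" "x = a \<odot>\<^bsub>M\<^esub> m"
proof -
  let ?N = "(\<lambda>a. a \<odot>\<^bsub>M\<^esub> m) ` carrier R"
  have "submodule ?N R M"
  proof (rule submodule_intro)
    show "?N \<subseteq> carrier M" using assms smult_closed by auto
    show "\<zero>\<^bsub>M\<^esub> \<in> ?N" using smult_zero_left assms by (metis R.zero_closed image_eqI)
    show "x \<oplus>\<^bsub>M\<^esub> y \<in> ?N" if "x \<in> ?N" "y \<in> ?N" for x y
      using that assms by (auto simp: smult_l_distr[symmetric])
    show "a \<odot>\<^bsub>M\<^esub> x \<in> ?N" if "a \<in> carrier R" "x \<in> ?N" for a x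
      using that assms by (auto simp: smult_assoc[symmetric])
  qed
  moreover have "m \<in> ?N" using smult_one assms by (metis R.one_closed image_eqI)
  ultimately have "?N = carrier M" using simple assms by blast
  thus ?thesis using that assms by blast
qed

text \<open>A central element that kills a nonzero \<open>x\<close> kills all multiples of
  \<open>x\<close>, and these fill \<open>M\<close>.\<close>

lemma centre_inj:
  assumes "z \<in> centre R" "z \<notin> annihilator R M" "x \<in> carrier M" "z \<odot>\<^bsub>M\<^esub> x = \<zero>\<^bsub>M\<^esub>"
  shows "x = \<zero>\<^bsub>M\<^esub>"
proof (rule ccontr)
  assume x: "x \<noteq> \<zero>\<^bsub>M\<^esub>"
  have "z \<odot>\<^bsub>M\<^esub> y = \<zero>\<^bsub>M\<^esub>" if "y \<in> carrier M" for y
    using cyclic[OF assms(3) x that] assms by (metis centre_commutes_smult smult_zero_right)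
  thus False using assms by (auto simp: annihilator_def centre_def)
qed

text \<open>The image of a central element is a submodule, and it is nonzero unless the element
  annihilates \<open>M\<close>.\<close>

lemma centre_surj:
  assumes "z \<in> centre R" "z \<notin> annihilator R M" "x \<in> carrier M"
  obtains y where "y \<in> carrier M" "z \<odot>\<^bsub>M\<^esub> y = x"
proof -
  let ?N = "(\<lambda>y. z \<odot>\<^bsub>M\<^esub> y) ` carrier M"
  have z: "z \<in> carrier R" using assms centreD by auto
  have "submodule ?N R M"
  proof (rule submodule_intro)
    show "?N \<subseteq> carrier M" using z smult_closed by auto
    show "\<zero>\<^bsub>M\<^esub> \<in> ?N" using smult_zero_right z by (metis M.zero_closed image_eqI)
    show "x \<oplus>\<^bsub>M\<^esub> y \<in> ?N" if "x \<in> ?N" "y \<in> ?N" for x y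
      using that z by (auto simp: smult_r_distr[symmetric])
    show "a \<odot>\<^bsub>M\<^esub> x \<in> ?N" if ax: "a \<in> carrier R" "x \<in> ?N" for a x
    proof -
      obtain y where y: "y \<in> carrier M" "x = z \<odot>\<^bsub>M\<^esub> y" using ax by blast
      have "a \<odot>\<^bsub>M\<^esub> x = z \<odot>\<^bsub>M\<^esub> (a \<odot>\<^bsub>M\<^esub> y)"
        unfolding y(2) by (rule centre_commutes_smult[symmetric, OF assms(1) ax(1) y(1)])
      thus ?thesis using smult_closed[OF ax(1) y(1)] by blast
    qed
  qed
  moreover have "?N \<noteq> {\<zero>\<^bsub>M\<^esub>}" using assms z by (auto simp: annihilator_def)
  ultimately have "?N = carrier M" using simple by blast
  hence "x \<in> ?N" using assms(3) by simp
  thus ?thesis using that by blast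
qed

lemma one_notin_annihilator: "\<one> \<notin> annihilator R M"
  using obtain_nonzero annihilatorD(2) smult_one by metis

text \<open>Both factors act injectively, so on the centre the annihilator behaves as a prime
  ideal.\<close>

lemma centre_mult_notin_annihilator:
  assumes "a \<in> centre R" "a \<notin> annihilator R M" "b \<in> centre R" "b \<notin> annihilator R M"
  shows "a \<otimes> b \<notin> annihilator R M"
proof
  assume ab: "a \<otimes> b \<in> annihilator R M"
  have "x = \<zero>\<^bsub>M\<^esub>" if x: "x \<in> carrier M" for x
    using annihilatorD(2)[OF ab x] assms x by (metis centreD(1) centre_inj smult_assoc smult_closed)
  thus False using obtain_nonzero by metis
qed

text \<open>With the inverse \<open>w\<close> taken from the centre itself, the centre modulo the
  annihilator becomes a field. Concretely, an ideal above the annihilator that contains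
  \<open>z\<close> also contains \<open>z w\<close> and \<open>1 - z w\<close>, hence
  \<open>1\<close>.\<close>

lemma annihilator_maximal:
  assumes inv: "\<And>z. z \<in> centre R \<Longrightarrow> z \<notin> annihilator R M \<Longrightarrow>
      \<exists>w \<in> centre R. \<forall>x \<in> carrier M. z \<odot>\<^bsub>M\<^esub> (w \<odot>\<^bsub>M\<^esub> x) = x"
  shows "annihilator R M \<inter> centre R \<in> Max_centre R"
proof -
  let ?Z = "R\<lparr>carrier := centre R\<rparr>" and ?I = "annihilator R M \<inter> centre R"
  interpret Z: cring ?Z by (rule R.centre_cring)
  note sub = subcringE[OF R.centre_subcring]
  \<comment> \<open>Negation in the restricted record is a different term; uniqueness of additive
    inverses identifies it with negation in \<open>R\<close>.\<close>
  have Zinv: "\<ominus>\<^bsub>?Z\<^esub> a = \<ominus> a" if "a \<in> centre R" for a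
    using that sub by (intro Z.minus_equality) (auto simp: R.l_neg)
  have id: "ideal ?I ?Z"
  proof (rule idealI[OF Z.ring_axioms])
    show "subgroup ?I (add_monoid ?Z)"
    proof (rule Z.add.subgroupI)
      show "?I \<noteq> {}" using sub by (auto simp: annihilator_def smult_zero_left)
      fix a assume a: "a \<in> ?I"
      have "\<ominus> a \<in> ?I" using a sub(5) by (auto simp: annihilator_def smult_minus_left)
      thus "\<ominus>\<^bsub>?Z\<^esub> a \<in> ?I" using Zinv[of a] a by simp
    next
      fix a b assume "a \<in> ?I" "b \<in> ?I"
      thus "a \<oplus>\<^bsub>?Z\<^esub> b \<in> ?I" using sub(7)
        by (auto simp: annihilator_def smult_l_distr)
    qed auto
    fix a x assume a: "a \<in> ?I" and "x \<in> carrier ?Z"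
    hence x: "x \<in> centre R" by simp
    have "x \<otimes> a \<in> ?I" using a sub(6)[OF x, of a] centreD(1)[OF x]
      by (auto simp: annihilator_def smult_assoc smult_zero_right)
    moreover have "a \<otimes> x = x \<otimes> a" using x a centreD by auto
    ultimately show "x \<otimes>\<^bsub>?Z\<^esub> a \<in> ?I" "a \<otimes>\<^bsub>?Z\<^esub> x \<in> ?I" by auto
  qed
  have "maximalideal ?I ?Z"
  proof (rule maximalidealI[OF id])
    show "carrier ?Z \<noteq> ?I" using sub(3) one_notin_annihilator by auto
    fix J assume J: "ideal J ?Z" "?I \<subseteq> J" "J \<subseteq> carrier ?Z"
    interpret J: ideal J ?Z by fact
    show "J = ?I \<or> J = carrier ?Z"
    proof (cases "J \<subseteq> ?I")
      case False
      then obtain z where z: "z \<in> J" "z \<notin> annihilator R M" using J(3) by auto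
      hence zc: "z \<in> centre R" using J(3) by auto
      obtain w where w: "w \<in> centre R" "\<forall>x \<in> carrier M. z \<odot>\<^bsub>M\<^esub> (w \<odot>\<^bsub>M\<^esub> x) = x"
        using inv[OF zc z(2)] by auto
      have wz: "z \<otimes> w \<in> J" using J.I_r_closed[OF z(1), of w] w by simp
      have "z \<otimes> w \<in> centre R" using sub(6) zc w by auto
      hence "\<one> \<ominus> z \<otimes> w \<in> centre R" using sub(3,5,7) by (simp add: a_minus_def)
      moreover have "\<one> \<ominus> z \<otimes> w \<in> annihilator R M"
        using annihilator_minus_iff[of \<one> "z \<otimes> w"] w(2) centreD(1)[OF zc] centreD(1)[OF w(1)]
        by (simp add: smult_one smult_assoc)
      ultimately have "\<one> \<ominus> z \<otimes> w \<in> ?I" by simp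
      hence "\<one> \<ominus> z \<otimes> w \<in> J" using J(2) by auto
      hence "(\<one> \<ominus> z \<otimes> w) \<oplus>\<^bsub>?Z\<^esub> z \<otimes> w \<in> J" using J.a_closed wz by blast
      moreover have "(\<one> \<ominus> z \<otimes> w) \<oplus> z \<otimes> w = \<one>" using zc w centreD(1)
        by (simp add: a_minus_def R.add.m_assoc R.l_neg)
      ultimately have "\<one>\<^bsub>?Z\<^esub> \<in> J" by simp
      hence "J = carrier ?Z" by (rule J.one_imp_carrier)
      thus ?thesis by simp
    qed (use J in auto)
  qed
  thus ?thesis by (simp add: Max_centre_def)
qed

end

section \<open>Generic freeness of a well-ordered spanning family\<close>

text \<open>\<open>B\<close> acts on \<open>M\<close> through a commutative domain, every nonzero element of which is invertible
  in the endomorphism ring by Schur's lemma.\<close>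

locale spanned_module = simple_left_module R M
  for R :: "('a, 'r) ring_scheme" (structure) and M :: "('a, 'm, 's) module_scheme" (structure) +
  fixes B :: "'a set" and e :: "'i \<Rightarrow> 'm" and I :: "'i set" and ord :: "('i \<times> 'i) set"
  assumes B_subring: "subring B R" and B_central: "B \<subseteq> centre R"
    and e_closed: "a \<in> I \<Longrightarrow> e a \<in> carrier M"
    and ord_wf: "wf ord" and ord_trans: "trans ord" and ord_total: "total_on I ord"
begin

lemma B_closed: "b \<in> B \<Longrightarrow> b \<in> carrier R"
  using B_central by (auto simp: centre_def)

lemmas B_ops = subringE(2,3,5,6,7)[OF B_subring]

text \<open>The \<open>B\<close>-span is built one term at a time, with repeated indices allowed.
  Membership in \<open>I\<close> is imposed here so that \<open>J\<close> may be given by a mere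
  weight condition.\<close>

inductive_set lspan :: "'i set \<Rightarrow> 'm set" for J where
  lspan_zero: "\<zero>\<^bsub>M\<^esub> \<in> lspan J"
| lspan_step: "a \<in> J \<Longrightarrow> a \<in> I \<Longrightarrow> b \<in> B \<Longrightarrow> v \<in> lspan J \<Longrightarrow> b \<odot>\<^bsub>M\<^esub> e a \<oplus>\<^bsub>M\<^esub> v \<in> lspan J"

lemma lspan_closed: "v \<in> lspan J \<Longrightarrow> v \<in> carrier M"
  by (induction rule: lspan.induct) (simp_all add: smult_closed B_closed e_closed)

lemma lspan_mono: "v \<in> lspan J \<Longrightarrow> J \<subseteq> J' \<Longrightarrow> v \<in> lspan J'"
  by (induction rule: lspan.induct) (auto intro: lspan.intros)

lemma lspan_base: 
  assumes "a \<in> J" "a \<in> I" "b \<in> B"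
  shows "b \<odot>\<^bsub>M\<^esub> e a \<in> lspan J"
  using lspan_step[OF assms lspan_zero] assms by (simp add: smult_closed B_closed e_closed)

lemma lspan_add: "v \<in> lspan J \<Longrightarrow> w \<in> lspan J \<Longrightarrow> v \<oplus>\<^bsub>M\<^esub> w \<in> lspan J"
proof (induction rule: lspan.induct)
  case (lspan_step a b v)
  have "(b \<odot>\<^bsub>M\<^esub> e a \<oplus>\<^bsub>M\<^esub> v) \<oplus>\<^bsub>M\<^esub> w = b \<odot>\<^bsub>M\<^esub> e a \<oplus>\<^bsub>M\<^esub> (v \<oplus>\<^bsub>M\<^esub> w)"
    using lspan_step lspan_closed
    by (intro M.a_assoc) (auto simp: smult_closed B_closed e_closed)
  thus ?case using lspan_step lspan.lspan_step by metis
qed (simp add: lspan_closed)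

lemma lspan_smult: "v \<in> lspan J \<Longrightarrow> c \<in> B \<Longrightarrow> c \<odot>\<^bsub>M\<^esub> v \<in> lspan J"
proof (induction rule: lspan.induct)
  case lspan_zero
  thus ?case using lspan.lspan_zero by (simp add: smult_zero_right B_closed)
next
  case (lspan_step a b v)
  have "c \<odot>\<^bsub>M\<^esub> (b \<odot>\<^bsub>M\<^esub> e a \<oplus>\<^bsub>M\<^esub> v) = (c \<otimes> b) \<odot>\<^bsub>M\<^esub> e a \<oplus>\<^bsub>M\<^esub> c \<odot>\<^bsub>M\<^esub> v"
    using lspan_step lspan_closed[of v J]
    by (simp add: smult_r_distr smult_assoc smult_closed B_closed e_closed)
  thus ?case using lspan_step lspan.lspan_step[of a J "c \<otimes> b"] B_ops(4) by simp
qed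

lemma lspan_uminus: "v \<in> lspan J \<Longrightarrow> \<ominus>\<^bsub>M\<^esub> v \<in> lspan J"
  using lspan_smult[of v J "\<ominus> \<one>"] B_ops(2,3) lspan_closed[of v J]
  by (simp add: smult_minus_left smult_one)

lemma lspan_minus: "v \<in> lspan J \<Longrightarrow> w \<in> lspan J \<Longrightarrow> v \<ominus>\<^bsub>M\<^esub> w \<in> lspan J"
  by (simp add: a_minus_def lspan_add lspan_uminus)

definition below :: "'i \<Rightarrow> 'i set" where "below a = {b \<in> I. (b, a) \<in> ord}"

lemma below_mono: "(a, a') \<in> ord \<Longrightarrow> below a \<subseteq> below a'"
  using ord_trans by (auto simp: below_def dest: transD)

text \<open>A new term merges with the current top term, is absorbed below it, or becomes the top
  with the old sum below it. The coefficient \<open>b\<close> may be zero, so \<open>a\<close> only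
  bounds the true leading index.\<close>

lemma lspan_leading:
  "v \<in> lspan J \<Longrightarrow> v = \<zero>\<^bsub>M\<^esub> \<or>
     (\<exists>a \<in> J \<inter> I. \<exists>b \<in> B. \<exists>w \<in> lspan (below a). v = b \<odot>\<^bsub>M\<^esub> e a \<oplus>\<^bsub>M\<^esub> w)"
proof (induction rule: lspan.induct)
  case (lspan_step a b v)
  note cl = smult_closed B_closed e_closed lspan_closed
  show ?case
  proof (cases "v = \<zero>\<^bsub>M\<^esub>")
    case True
    thus ?thesis using lspan_step lspan_zero by blast
  next
    case False
    then obtain a' b' w where w: "a' \<in> J \<inter> I" "b' \<in> B" "w \<in> lspan (below a')"
      "v = b' \<odot>\<^bsub>M\<^esub> e a' \<oplus>\<^bsub>M\<^esub> w" using lspan_step by blast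
    have wc: "w \<in> carrier M" using w cl by blast
    consider "a = a'" | "(a, a') \<in> ord" | "(a', a) \<in> ord"
      using ord_total w(1) lspan_step(2) by (auto simp: total_on_def)
    thus ?thesis
    proof cases
      case 1
      have "b \<odot>\<^bsub>M\<^esub> e a \<oplus>\<^bsub>M\<^esub> v = (b \<oplus> b') \<odot>\<^bsub>M\<^esub> e a \<oplus>\<^bsub>M\<^esub> w"
        using w wc lspan_step 1 by (simp add: smult_l_distr cl M.a_assoc)
      thus ?thesis using w lspan_step 1 B_ops(5) by blast
    next
      case 2
      have "b \<odot>\<^bsub>M\<^esub> e a \<oplus>\<^bsub>M\<^esub> v = b' \<odot>\<^bsub>M\<^esub> e a' \<oplus>\<^bsub>M\<^esub> (b \<odot>\<^bsub>M\<^esub> e a \<oplus>\<^bsub>M\<^esub> w)"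
        using w wc lspan_step by (simp add: cl M.a_lcomm)
      moreover have "b \<odot>\<^bsub>M\<^esub> e a \<oplus>\<^bsub>M\<^esub> w \<in> lspan (below a')"
        using 2 lspan_step w by (intro lspan.lspan_step) (auto simp: below_def)
      ultimately show ?thesis using w by blast
    next
      case 3
      have "v \<in> lspan (below a)" unfolding w(4)
        using 3 w below_mono by (intro lspan.lspan_step lspan_mono[OF w(3)]) (auto simp: below_def)
      thus ?thesis using lspan_step by blast
    qed
  qed
qed simp

text \<open>An index is torsion if its vector satisfies a nontrivial relation over \<open>B\<close> modulo smaller ones;
  after inverting \<open>f\<close>, the other vectors form a basis of \<open>M\<close>.  If \<open>g\<close> is invertible on \<open>M\<close>, comparing
  coefficients of \<open>e a0\<close> shows that \<open>g\<close> divides a power of \<open>f\<close>.\<close>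

definition torsion :: "'i \<Rightarrow> bool" where
  "torsion a \<longleftrightarrow> (\<exists>b \<in> B - annihilator R M. b \<odot>\<^bsub>M\<^esub> e a \<in> lspan (below a))"

context
  fixes f a0
  assumes f: "f \<in> B" and f_torsion: "\<And>a. a \<in> I \<Longrightarrow> torsion a \<Longrightarrow> f \<odot>\<^bsub>M\<^esub> e a \<in> lspan (below a)"
    and a0: "a0 \<in> I" "below a0 = {}" "e a0 \<noteq> \<zero>\<^bsub>M\<^esub>"
begin

lemma below_a0: "v \<in> lspan (below a0) \<Longrightarrow> v = \<zero>\<^bsub>M\<^esub>"
  using lspan_leading[of v "below a0"] a0 by auto

text \<open>Well-founded induction on the top index of the vector that \<open>g\<close> maps to
  \<open>h\<close> times \<open>e a0\<close>. The factor \<open>h\<close> is general because a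
  torsion top index is removed by multiplying by \<open>f\<close>, which turns \<open>h\<close> into
  \<open>f h\<close>. At \<open>a = a0\<close> nothing lies below, and comparing coefficients of
  \<open>e a0\<close> gives \<open>h = g c\<close> modulo the annihilator.\<close>

lemma divides_power_aux:
  assumes g: "g \<in> B" "g \<notin> annihilator R M" and "a \<in> I"
    and "c \<in> B" "w \<in> lspan (below a)" "h \<in> B"
    and "h \<odot>\<^bsub>M\<^esub> e a0 = g \<odot>\<^bsub>M\<^esub> (c \<odot>\<^bsub>M\<^esub> e a \<oplus>\<^bsub>M\<^esub> w)"
  shows "\<exists>N. \<exists>d \<in> B. f [^] (N::nat) \<otimes> h \<ominus> g \<otimes> d \<in> annihilator R M"
  using assms(3-)
proof (induction a arbitrary: c w h rule: wf_induct_rule[OF ord_wf])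
  case (1 a)
  note cl = smult_closed B_closed e_closed lspan_closed
  note gc = B_closed[OF g(1)] and fc = B_closed[OF f]
  have wc: "w \<in> carrier M" using 1 cl by blast
  have ec: "e a \<in> carrier M" "e a0 \<in> carrier M" using 1 e_closed a0 by auto
  have cc: "c \<in> carrier R" "h \<in> carrier R" using 1 cl by auto
  \<comment> \<open>The recursive call: once the vector lies in the span below \<open>a\<close>, its
    leading index is smaller than \<open>a\<close>.\<close>
  have below: "\<exists>N. \<exists>d \<in> B. f [^] (N::nat) \<otimes> h' \<ominus> g \<otimes> d \<in> annihilator R M"
    if h': "h' \<in> B" and u: "u \<in> lspan (below a)" and eq: "h' \<odot>\<^bsub>M\<^esub> e a0 = g \<odot>\<^bsub>M\<^esub> u" for h' u
  proof (cases "u = \<zero>\<^bsub>M\<^esub>")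
    case True
    hence "h' \<odot>\<^bsub>M\<^esub> e a0 = \<zero>\<^bsub>M\<^esub>" using eq gc by (simp add: smult_zero_right)
    hence "h' \<in> annihilator R M" using centre_inj[of h' "e a0"] h' B_central ec a0 by blast
    \<comment> \<open>If the vector is zero, \<open>h'\<close> itself annihilates \<open>M\<close>,
      and \<open>N = 0\<close>, \<open>d = 0\<close> serve.\<close>
    moreover have "f [^] (0::nat) \<otimes> h' \<ominus> g \<otimes> \<zero> = h'"
      using gc B_closed[OF h'] by (simp add: a_minus_def)
    ultimately show ?thesis using B_ops(1) by metis
  next
    case False
    then obtain a' c' w' where "a' \<in> below a \<inter> I" "c' \<in> B" "w' \<in> lspan (below a')"
      "u = c' \<odot>\<^bsub>M\<^esub> e a' \<oplus>\<^bsub>M\<^esub> w'" using lspan_leading[OF u] by blast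
    thus ?thesis using 1(1)[of a' c' w' h'] h' eq by (auto simp: below_def)
  qed
  show ?case
  proof (cases "torsion a")
    case True
    \<comment> \<open>Multiplying by \<open>f\<close> pushes the torsion top term below
      \<open>a\<close>, at the cost of one more power of \<open>f\<close> in front of
      \<open>h\<close>.\<close>
    define u where "u = f \<odot>\<^bsub>M\<^esub> (c \<odot>\<^bsub>M\<^esub> e a \<oplus>\<^bsub>M\<^esub> w)"
    have "u = c \<odot>\<^bsub>M\<^esub> (f \<odot>\<^bsub>M\<^esub> e a) \<oplus>\<^bsub>M\<^esub> f \<odot>\<^bsub>M\<^esub> w"
      using centre_commutes_smult[of f c "e a"] f B_central cc fc wc ec
      by (auto simp: u_def smult_r_distr smult_closed)
    hence "u \<in> lspan (below a)" using f_torsion[OF 1(2) True] 1 f lspan_add lspan_smult by simp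
    moreover have "(f \<otimes> h) \<odot>\<^bsub>M\<^esub> e a0 = g \<odot>\<^bsub>M\<^esub> u"
      using centre_commutes_smult[of f g "c \<odot>\<^bsub>M\<^esub> e a \<oplus>\<^bsub>M\<^esub> w"] f B_central cc fc wc ec gc 1(6)
      by (auto simp: u_def smult_assoc smult_closed)
    moreover have "f \<otimes> h \<in> B" using B_ops(4) f 1 by blast
    ultimately obtain N d where "d \<in> B" "f [^] (N::nat) \<otimes> (f \<otimes> h) \<ominus> g \<otimes> d \<in> annihilator R M"
      using below by blast
    moreover have "f [^] N \<otimes> (f \<otimes> h) = f [^] Suc N \<otimes> h" using fc cc by (simp add: R.m_assoc)
    ultimately show ?thesis by metis
  next
    case nt: False
    show ?thesis
    proof (cases "a = a0")
      case True
      hence "w = \<zero>\<^bsub>M\<^esub>" using below_a0 1 by blast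
      hence eq: "h \<odot>\<^bsub>M\<^esub> e a0 = (g \<otimes> c) \<odot>\<^bsub>M\<^esub> e a0"
        using 1(6) True ec cc gc by (simp add: smult_closed smult_assoc)
      have k: "h \<ominus> g \<otimes> c \<in> centre R" using B_ops 1 g B_central by (simp add: a_minus_def subset_iff)
      have "(h \<ominus> g \<otimes> c) \<odot>\<^bsub>M\<^esub> e a0 = \<zero>\<^bsub>M\<^esub>"
        using eq ec cc gc by (simp add: a_minus_def smult_l_distr smult_minus_left smult_closed M.r_neg)
      hence "h \<ominus> g \<otimes> c \<in> annihilator R M" using centre_inj[OF k _ ec(2)] a0 by blast
      moreover have "f [^] (0::nat) \<otimes> h = h" using cc by simp
      ultimately show ?thesis using 1 by metis
    next
      case False
      \<comment> \<open>Nothing is below \<open>a0\<close>, so totality places it below every other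
        index.\<close>
      hence "(a0, a) \<in> ord" using ord_total a0 1(2) by (auto simp: total_on_def below_def)
      hence "h \<odot>\<^bsub>M\<^esub> e a0 \<in> lspan (below a)" using lspan_base[of a0 "below a" h] 1 a0 by (simp add: below_def)
      moreover have "g \<odot>\<^bsub>M\<^esub> w \<in> lspan (below a)" using 1 g lspan_smult by blast
      ultimately have "h \<odot>\<^bsub>M\<^esub> e a0 \<ominus>\<^bsub>M\<^esub> g \<odot>\<^bsub>M\<^esub> w \<in> lspan (below a)" by (rule lspan_minus)
      moreover have "h \<odot>\<^bsub>M\<^esub> e a0 = (g \<otimes> c) \<odot>\<^bsub>M\<^esub> e a \<oplus>\<^bsub>M\<^esub> g \<odot>\<^bsub>M\<^esub> w"
        unfolding 1(6) using ec cc gc wc by (simp add: smult_r_distr smult_assoc smult_closed)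
      ultimately have "(g \<otimes> c) \<odot>\<^bsub>M\<^esub> e a \<in> lspan (below a)"
        using ec cc gc wc by (simp add: a_minus_def M.a_assoc M.r_neg smult_closed)
      hence "g \<otimes> c \<in> annihilator R M" using nt B_ops(4)[of g c] g 1 by (auto simp: torsion_def)
      hence "c \<in> annihilator R M" using centre_mult_notin_annihilator[of g c] g 1 B_central by blast
      hence "c \<odot>\<^bsub>M\<^esub> e a \<oplus>\<^bsub>M\<^esub> w = w" using annihilatorD(2) ec wc by simp
      thus ?thesis using below[of h w] 1 by simp
    qed
  qed
qed

text \<open>By Schur's lemma \<open>g\<close> maps some vector \<open>v\<close> to
  \<open>e a0\<close>; the preceding induction is applied to \<open>v\<close> with
  \<open>h = 1\<close>.\<close>

lemma divides_power:
  assumes span: "carrier M \<subseteq> lspan I" and g: "g \<in> B" "g \<notin> annihilator R M"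
  shows "\<exists>N. \<exists>d \<in> B. f [^] (N::nat) \<ominus> g \<otimes> d \<in> annihilator R M"
proof -
  have e0: "e a0 \<in> carrier M" using a0 e_closed by blast
  obtain v where v: "v \<in> carrier M" "g \<odot>\<^bsub>M\<^esub> v = e a0"
    using centre_surj[of g "e a0"] g B_central e0 by blast
  hence "v \<noteq> \<zero>\<^bsub>M\<^esub>" using a0 smult_zero_right[OF B_closed[OF g(1)]] by auto
  then obtain a c w where *: "a \<in> I" "c \<in> B" "w \<in> lspan (below a)" "v = c \<odot>\<^bsub>M\<^esub> e a \<oplus>\<^bsub>M\<^esub> w"
    using lspan_leading[of v I] v(1) span by blast
  have "\<exists>N. \<exists>d \<in> B. f [^] (N::nat) \<otimes> \<one> \<ominus> g \<otimes> d \<in> annihilator R M"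
    by (rule divides_power_aux[OF g *(1,2,3) B_ops(2)]) (use * v e0 smult_one in simp)
  thus ?thesis using B_closed[OF f] by simp
qed

end

end

section \<open>Polynomials in a central element\<close>

text \<open>\<open>\<psi>\<close> abstracts evaluation at a central element, which is recovered as
  \<open>\<psi> X\<close>.\<close>

locale central_polynomials = simple_left_module R M
  for R :: "('a, 'r) ring_scheme" (structure) and M :: "('a, 'm, 's) module_scheme" (structure) +
  fixes K :: "('k, 'x) ring_scheme" and \<psi> :: "(nat \<Rightarrow> 'k) \<Rightarrow> 'a"
  assumes K_field: "field K" and \<psi>_hom: "\<psi> \<in> ring_hom (UP K) (R\<lparr>carrier := centre R\<rparr>)"
begin

abbreviation (input) P where "P \<equiv> UP K"

definition X where "X = monom (UP K) \<one>\<^bsub>K\<^esub> 1"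

sublocale K: field K by (rule K_field)
sublocale P: UP_domain K "UP K" by unfold_locales
lemma X_closed [simp]: "X \<in> carrier P" by (simp add: X_def)

lemma psi_centre: "p \<in> carrier P \<Longrightarrow> \<psi> p \<in> centre R"
  using ring_hom_closed[OF \<psi>_hom] by simp

lemma psi_carrier [simp]: "p \<in> carrier P \<Longrightarrow> \<psi> p \<in> carrier R"
  using psi_centre by (simp add: centreD)

lemma psi_add: "p \<in> carrier P \<Longrightarrow> q \<in> carrier P \<Longrightarrow> \<psi> (p \<oplus>\<^bsub>P\<^esub> q) = \<psi> p \<oplus> \<psi> q"
  using ring_hom_add[OF \<psi>_hom] by simp

lemma psi_mult: "p \<in> carrier P \<Longrightarrow> q \<in> carrier P \<Longrightarrow> \<psi> (p \<otimes>\<^bsub>P\<^esub> q) = \<psi> p \<otimes> \<psi> q"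
  using ring_hom_mult[OF \<psi>_hom] by simp

lemma psi_one: "\<psi> \<one>\<^bsub>P\<^esub> = \<one>"
  using ring_hom_one[OF \<psi>_hom] by simp

lemma psi_zero: "\<psi> \<zero>\<^bsub>P\<^esub> = \<zero>"
  using ring_hom_zero[OF \<psi>_hom P.P.ring_axioms cring.axioms(1)[OF R.centre_cring]] by simp

lemma psi_uminus:
  assumes "p \<in> carrier P" shows "\<psi> (\<ominus>\<^bsub>P\<^esub> p) = \<ominus> \<psi> p"
proof -
  have "\<psi> (\<ominus>\<^bsub>P\<^esub> p) \<oplus> \<psi> p = \<zero>"
    using psi_add[of "\<ominus>\<^bsub>P\<^esub> p" p] assms psi_zero by (simp add: P.P.l_neg)
  thus ?thesis using assms by (intro R.minus_equality[symmetric]) auto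
qed

lemma psi_pow: "p \<in> carrier P \<Longrightarrow> \<psi> (p [^]\<^bsub>P\<^esub> (n::nat)) = \<psi> p [^] n"
  by (induction n) (simp_all add: psi_one psi_mult)

lemma psi_zero_annihilator: "\<psi> \<zero>\<^bsub>P\<^esub> \<in> annihilator R M"
  by (simp add: psi_zero annihilator_def smult_zero_left)

text \<open>A Bezout identity between \<open>X\<close> and a polynomial acting as zero makes the
  cofactor \<open>q\<close> an inverse of \<open>X\<close> on \<open>M\<close>.\<close>

lemma invertibleI:
  assumes "q \<in> carrier P" "p \<in> carrier P" "X \<otimes>\<^bsub>P\<^esub> q = \<one>\<^bsub>P\<^esub> \<ominus>\<^bsub>P\<^esub> p" "\<psi> p \<in> annihilator R M"
  shows "\<exists>w \<in> centre R. \<forall>x \<in> carrier M. \<psi> X \<odot>\<^bsub>M\<^esub> (w \<odot>\<^bsub>M\<^esub> x) = x"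
proof (intro bexI ballI)
  fix x assume x: "x \<in> carrier M"
  have "\<psi> X \<odot>\<^bsub>M\<^esub> (\<psi> q \<odot>\<^bsub>M\<^esub> x) = \<psi> (X \<otimes>\<^bsub>P\<^esub> q) \<odot>\<^bsub>M\<^esub> x"
    using assms(1,2) x by (simp add: psi_mult smult_assoc)
  also have "\<dots> = (\<one> \<oplus> \<ominus> \<psi> p) \<odot>\<^bsub>M\<^esub> x"
    unfolding assms(3) a_minus_def
    using assms psi_uminus psi_add[of "\<one>\<^bsub>P\<^esub>" "\<ominus>\<^bsub>P\<^esub> p"] psi_one by simp
  also have "\<dots> = x"
    using assms x annihilatorD(2)[OF assms(4) x]
    by (simp add: smult_l_distr smult_one smult_minus_left)
  finally show "\<psi> X \<odot>\<^bsub>M\<^esub> (\<psi> q \<odot>\<^bsub>M\<^esub> x) = x" .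
qed (use assms psi_centre in auto)

lemma X_nonzero: "X \<noteq> \<zero>\<^bsub>P\<^esub>"
proof
  assume "X = \<zero>\<^bsub>P\<^esub>"
  hence "coeff P X 1 = coeff P \<zero>\<^bsub>P\<^esub> 1" by simp
  thus False by (simp add: X_def P.coeff_zero)
qed

lemma deg_X: "deg K X = 1"
  unfolding X_def by (rule P.deg_monom) auto

text \<open>Write \<open>p = X q + c\<close> with a constant \<open>c\<close>. If
  \<open>c = 0\<close>, primality of the annihilator lets \<open>q\<close> replace \<open>p\<close>
  in lower degree. If \<open>c\<close> is nonzero, scaling \<open>p\<close> to constant term
  \<open>1\<close> gives a Bezout identity with \<open>X\<close>.\<close>

lemma algebraic_invertible:
  assumes "p \<in> carrier P" "p \<noteq> \<zero>\<^bsub>P\<^esub>" "\<psi> p \<in> annihilator R M" "\<psi> X \<notin> annihilator R M"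
  shows "\<exists>w \<in> centre R. \<forall>x \<in> carrier M. \<psi> X \<odot>\<^bsub>M\<^esub> (w \<odot>\<^bsub>M\<^esub> x) = x"
  using assms
proof (induction "deg K p" arbitrary: p rule: less_induct)
  case less
  have "carrier K \<noteq> {\<zero>\<^bsub>K\<^esub>}" using K.one_not_zero by (metis K.one_closed singletonD)
  \<comment> \<open>Dividing by the linear polynomial with root zero is division by
    \<open>X\<close>.\<close>
  from P.remainder_theorem_exist[OF less(2) K.zero_closed this]
  obtain q r where qr: "q \<in> carrier P" "r \<in> carrier P" "deg K r = 0"
    and "p = (monom P \<one>\<^bsub>K\<^esub> 1 \<ominus>\<^bsub>P\<^esub> monom P \<zero>\<^bsub>K\<^esub> 0) \<otimes>\<^bsub>P\<^esub> q \<oplus>\<^bsub>P\<^esub> r"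
    by blast
  hence p: "p = X \<otimes>\<^bsub>P\<^esub> q \<oplus>\<^bsub>P\<^esub> r" unfolding X_def by (simp add: a_minus_def)
  define c where "c = coeff P r 0"
  have c: "c \<in> carrier K" using qr by (simp add: c_def)
  have r: "r = monom P c 0" using P.deg_zero_impl_monom[OF qr(2,3)] by (simp add: c_def)
  show ?case
  proof (cases "c = \<zero>\<^bsub>K\<^esub>")
    case True
    hence p: "p = X \<otimes>\<^bsub>P\<^esub> q" using p r qr by simp
    hence q0: "q \<noteq> \<zero>\<^bsub>P\<^esub>" using less(3) by auto
    have "deg K p = 1 + deg K q"
      unfolding p using P.deg_mult[OF X_nonzero q0] qr(1) deg_X by simp
    moreover have "\<psi> q \<in> annihilator R M"
      using centre_mult_notin_annihilator[of "\<psi> X" "\<psi> q"] less(4,5) qr(1) psi_centre p psi_mult by auto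
    ultimately show ?thesis using less(1)[of q] qr(1) q0 less(5) by simp
  next
    case False
    define d where "d = monom P (inv\<^bsub>K\<^esub> c) 0"
    have ic: "inv\<^bsub>K\<^esub> c \<in> carrier K" "inv\<^bsub>K\<^esub> c \<otimes>\<^bsub>K\<^esub> c = \<one>\<^bsub>K\<^esub>"
      using False c K.field_Units by auto
    have d: "d \<in> carrier P" using ic by (simp add: d_def)
    have dr: "d \<otimes>\<^bsub>P\<^esub> r = \<one>\<^bsub>P\<^esub>"
      unfolding d_def r using ic c P.monom_mult[of "inv\<^bsub>K\<^esub> c" c 0 0] by (simp add: P.monom_one)
    have "d \<otimes>\<^bsub>P\<^esub> p = X \<otimes>\<^bsub>P\<^esub> (d \<otimes>\<^bsub>P\<^esub> q) \<oplus>\<^bsub>P\<^esub> \<one>\<^bsub>P\<^esub>"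
      unfolding p using d dr qr by (simp add: P.P.r_distr P.P.m_lcomm)
    \<comment> \<open>The scaled polynomial is \<open>X (d q) + 1\<close>, so \<open>-(d q)\<close>
      is the cofactor wanted by \<open>invertibleI\<close>.\<close>
    hence "\<one>\<^bsub>P\<^esub> \<ominus>\<^bsub>P\<^esub> d \<otimes>\<^bsub>P\<^esub> p = \<ominus>\<^bsub>P\<^esub> (X \<otimes>\<^bsub>P\<^esub> (d \<otimes>\<^bsub>P\<^esub> q))"
      using d qr by (simp add: a_minus_def P.P.minus_add P.P.r_neg
          P.P.a_lcomm[of "\<one>\<^bsub>P\<^esub>" "\<ominus>\<^bsub>P\<^esub> (X \<otimes>\<^bsub>P\<^esub> (d \<otimes>\<^bsub>P\<^esub> q))"])
    also have "\<dots> = X \<otimes>\<^bsub>P\<^esub> (\<ominus>\<^bsub>P\<^esub> (d \<otimes>\<^bsub>P\<^esub> q))" using d qr by (simp add: P.P.r_minus)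
    finally have "X \<otimes>\<^bsub>P\<^esub> (\<ominus>\<^bsub>P\<^esub> (d \<otimes>\<^bsub>P\<^esub> q)) = \<one>\<^bsub>P\<^esub> \<ominus>\<^bsub>P\<^esub> d \<otimes>\<^bsub>P\<^esub> p" by simp
    moreover have "\<psi> (d \<otimes>\<^bsub>P\<^esub> p) \<in> annihilator R M"
      using less(4) d less(2) by (auto simp: psi_mult annihilator_def smult_assoc smult_zero_right)
    ultimately show ?thesis using d qr less(2) by (intro invertibleI) auto
  qed
qed

text \<open>\<open>1 + X p\<close> is coprime to \<open>p\<close>.\<close>

lemma coprime_power:
  assumes "p \<in> carrier P" "d \<in> carrier P" "p [^]\<^bsub>P\<^esub> (n::nat) = (\<one>\<^bsub>P\<^esub> \<oplus>\<^bsub>P\<^esub> X \<otimes>\<^bsub>P\<^esub> p) \<otimes>\<^bsub>P\<^esub> d"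
  shows "\<exists>u \<in> carrier P. \<one>\<^bsub>P\<^esub> = (\<one>\<^bsub>P\<^esub> \<oplus>\<^bsub>P\<^esub> X \<otimes>\<^bsub>P\<^esub> p) \<otimes>\<^bsub>P\<^esub> u"
  using assms
proof (induction n arbitrary: d)
  case (Suc n)
  define q where "q = p [^]\<^bsub>P\<^esub> n"
  have q: "q \<in> carrier P" using Suc by (simp add: q_def)
  let ?g = "\<one>\<^bsub>P\<^esub> \<oplus>\<^bsub>P\<^esub> X \<otimes>\<^bsub>P\<^esub> p"
  have g: "?g \<in> carrier P" using Suc by simp
  \<comment> \<open>With \<open>q = p^n\<close>, the assumption \<open>q p = g d\<close> turns
    \<open>g q = q + X q p\<close> into \<open>q = g (q - X d)\<close>. So \<open>g\<close> already
    divides \<open>p^n\<close>, and the exponent descends to zero.\<close>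
  have "?g \<otimes>\<^bsub>P\<^esub> q = q \<oplus>\<^bsub>P\<^esub> X \<otimes>\<^bsub>P\<^esub> (q \<otimes>\<^bsub>P\<^esub> p)"
    using Suc q by (simp add: P.P.l_distr P.P.r_distr P.P.m_ac)
  also have "q \<otimes>\<^bsub>P\<^esub> p = ?g \<otimes>\<^bsub>P\<^esub> d" using Suc(4) by (simp add: q_def)
  finally have 1: "?g \<otimes>\<^bsub>P\<^esub> q = q \<oplus>\<^bsub>P\<^esub> X \<otimes>\<^bsub>P\<^esub> (?g \<otimes>\<^bsub>P\<^esub> d)" .
  have "?g \<otimes>\<^bsub>P\<^esub> (q \<ominus>\<^bsub>P\<^esub> X \<otimes>\<^bsub>P\<^esub> d) = ?g \<otimes>\<^bsub>P\<^esub> q \<ominus>\<^bsub>P\<^esub> X \<otimes>\<^bsub>P\<^esub> (?g \<otimes>\<^bsub>P\<^esub> d)"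
    using g q Suc(3) by (simp add: a_minus_def P.P.r_distr P.P.r_minus P.P.m_lcomm)
  also have "\<dots> = q"
    unfolding 1 using g q Suc(3) by (simp add: a_minus_def P.P.a_assoc P.P.r_neg)
  finally have "p [^]\<^bsub>P\<^esub> n = ?g \<otimes>\<^bsub>P\<^esub> (q \<ominus>\<^bsub>P\<^esub> X \<otimes>\<^bsub>P\<^esub> d)" by (simp only: q_def)
  moreover have "q \<ominus>\<^bsub>P\<^esub> X \<otimes>\<^bsub>P\<^esub> d \<in> carrier P" using q Suc(3) by simp
  ultimately show ?case using Suc(1) Suc(2) by blast
qed auto

text \<open>The hypothesis \<open>div\<close> says that the image of \<open>\<psi>\<close> modulo
  the annihilator is a Goldman domain. Tested on \<open>1 + X p\<close> with
  \<open>f = \<psi> p\<close>, it yields a nonzero polynomial that acts as zero, so the algebraic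
  case applies.\<close>

lemma goldman_invertible:
  assumes f: "f \<in> \<psi> ` carrier P" "f \<notin> annihilator R M"
    and div: "\<And>g. g \<in> \<psi> ` carrier P \<Longrightarrow> g \<notin> annihilator R M \<Longrightarrow>
       \<exists>N. \<exists>d \<in> \<psi> ` carrier P. f [^] (N::nat) \<ominus> g \<otimes> d \<in> annihilator R M"
    and X: "\<psi> X \<notin> annihilator R M"
  shows "\<exists>w \<in> centre R. \<forall>x \<in> carrier M. \<psi> X \<odot>\<^bsub>M\<^esub> (w \<odot>\<^bsub>M\<^esub> x) = x"
proof -
  obtain p where p: "p \<in> carrier P" "f = \<psi> p" using f by auto
  have p0: "p \<noteq> \<zero>\<^bsub>P\<^esub>" using psi_zero_annihilator p f by auto
  define g where "g = \<one>\<^bsub>P\<^esub> \<oplus>\<^bsub>P\<^esub> X \<otimes>\<^bsub>P\<^esub> p"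
  have g: "g \<in> carrier P" using p by (simp add: g_def)
  have Xp: "X \<otimes>\<^bsub>P\<^esub> p = g \<oplus>\<^bsub>P\<^esub> \<ominus>\<^bsub>P\<^esub> \<one>\<^bsub>P\<^esub>"
    using p by (simp add: g_def P.P.a_comm[of "\<one>\<^bsub>P\<^esub>"] P.P.a_assoc P.P.r_neg)
  show ?thesis
  proof (cases "\<psi> g \<in> annihilator R M")
    case True
    \<comment> \<open>If \<open>g = 1 + X p\<close> acts as zero, then \<open>-p\<close> is an
      inverse of \<open>X\<close> on \<open>M\<close> at once.\<close>
    have "X \<otimes>\<^bsub>P\<^esub> (\<ominus>\<^bsub>P\<^esub> p) = \<one>\<^bsub>P\<^esub> \<ominus>\<^bsub>P\<^esub> g"
      using p g Xp by (simp add: P.P.r_minus P.P.minus_add a_minus_def P.P.a_comm)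
    thus ?thesis using True p g by (intro invertibleI) auto
  next
    case False
    obtain N d where d: "d \<in> carrier P" "f [^] (N::nat) \<ominus> \<psi> g \<otimes> \<psi> d \<in> annihilator R M"
      using div[of "\<psi> g"] False g by blast
    define t where "t = p [^]\<^bsub>P\<^esub> N \<ominus>\<^bsub>P\<^esub> g \<otimes>\<^bsub>P\<^esub> d"
    have t: "t \<in> carrier P" using p g d by (simp add: t_def)
    have "\<psi> t = f [^] N \<ominus> \<psi> g \<otimes> \<psi> d"
      using p g d by (simp add: t_def a_minus_def psi_add psi_uminus psi_mult psi_pow)
    hence psit: "\<psi> t \<in> annihilator R M" using d by simp
    have "t \<noteq> \<zero>\<^bsub>P\<^esub>"
    proof
      assume "t = \<zero>\<^bsub>P\<^esub>"
      hence "p [^]\<^bsub>P\<^esub> N = g \<otimes>\<^bsub>P\<^esub> d" using p g d by (simp add: t_def P.P.r_right_minus_eq)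
      then obtain u where u: "u \<in> carrier P" "\<one>\<^bsub>P\<^esub> = g \<otimes>\<^bsub>P\<^esub> u"
        using coprime_power[OF p(1) d(1)] by (auto simp: g_def)
      have "g \<noteq> \<zero>\<^bsub>P\<^esub>" "u \<noteq> \<zero>\<^bsub>P\<^esub>" using g u P.UP_one_not_zero by auto
      hence "deg K (g \<otimes>\<^bsub>P\<^esub> u) = deg K g + deg K u" using u(1) g P.deg_mult[of g u] by blast
      hence dg: "deg K g = 0" unfolding u(2)[symmetric] by simp
      \<comment> \<open>A divisor \<open>g\<close> of \<open>1\<close> is constant, whereas
        \<open>X p = g - 1\<close> has positive degree.\<close>
      have "deg K (X \<otimes>\<^bsub>P\<^esub> p) = 1 + deg K p" using P.deg_mult[OF X_nonzero p0] p deg_X by simp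
      moreover have "deg K (X \<otimes>\<^bsub>P\<^esub> p) \<le> max (deg K g) (deg K (\<ominus>\<^bsub>P\<^esub> \<one>\<^bsub>P\<^esub>))"
        unfolding Xp using g by (intro P.deg_add) auto
      ultimately show False using dg by simp
    qed
    thus ?thesis using algebraic_invertible[OF t _ psit X] by blast
  qed
qed

end

section \<open>Exponent vectors\<close>

text \<open>Let \<open>T\<close> settle the first \<open>n\<close> coordinates and let
  \<open>N\<close> bound the last coordinates occurring in \<open>T\<close>. Then \<open>T\<close>
  covers every vector whose last coordinate is at least \<open>N\<close>; each of the finitely many
  slices with a smaller last coordinate is covered by induction.\<close>

lemma dickson:
  fixes E :: "(nat \<Rightarrow> nat) set"
  shows "\<exists>T. finite T \<and> T \<subseteq> E \<and> (\<forall>a \<in> E. \<exists>t \<in> T. \<forall>i<n. t i \<le> a i)"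
proof (induction n arbitrary: E)
  case 0
  show ?case
  proof (cases "E = {}")
    case False
    then obtain a where "a \<in> E" by blast
    thus ?thesis by (intro exI[of _ "{a}"]) auto
  qed auto
next
  case (Suc n)
  obtain T where T: "finite T" "T \<subseteq> E" "\<forall>a \<in> E. \<exists>t \<in> T. \<forall>i<n. t i \<le> a i"
    using Suc.IH[of E] by blast
  \<comment> \<open>The extra \<open>0\<close> takes care of an empty \<open>T\<close>.\<close>
  define N where "N = Max (insert 0 ((\<lambda>t. t n) ` T))"
  have N: "t n \<le> N" if "t \<in> T" for t using that T by (auto simp: N_def)
  have "\<exists>U. finite U \<and> U \<subseteq> {a \<in> E. a n = k} \<and>
      (\<forall>a \<in> {a \<in> E. a n = k}. \<exists>t \<in> U. \<forall>i<n. t i \<le> a i)" for k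
    by (rule Suc.IH)
  then obtain U where "\<And>k. finite (U k) \<and> U k \<subseteq> {a \<in> E. a n = k} \<and>
      (\<forall>a \<in> {a \<in> E. a n = k}. \<exists>t \<in> U k. \<forall>i<n. t i \<le> a i)"
    using choice[of "\<lambda>k U. finite U \<and> U \<subseteq> {a \<in> E. a n = k} \<and>
      (\<forall>a \<in> {a \<in> E. a n = k}. \<exists>t \<in> U. \<forall>i<n. t i \<le> a i)"] by blast
  hence U: "\<And>k. finite (U k)" "\<And>k. U k \<subseteq> {a \<in> E. a n = k}"
    "\<And>k a. a \<in> {a \<in> E. a n = k} \<Longrightarrow> \<exists>t \<in> U k. \<forall>i<n. t i \<le> a i"
    by blast+
  show ?case
  proof (intro exI[of _ "T \<union> (\<Union>k<N. U k)"] conjI ballI)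
    fix a assume a: "a \<in> E"
    show "\<exists>t \<in> T \<union> (\<Union>k<N. U k). \<forall>i<Suc n. t i \<le> a i"
    proof (cases "a n < N")
      case True
      obtain t where t: "t \<in> U (a n)" "\<forall>i<n. t i \<le> a i" using U(3)[of a "a n"] a by blast
      moreover have "t n = a n" using t U(2) by blast
      ultimately show ?thesis using True by (intro bexI[of _ t]) (auto simp: less_Suc_eq)
    next
      case False
      obtain t where t: "t \<in> T" "\<forall>i<n. t i \<le> a i" using T(3) a by blast
      moreover have "t n \<le> a n" using N[OF t(1)] False by simp
      ultimately show ?thesis by (intro bexI[of _ t]) (auto simp: less_Suc_eq)
    qed
  next
    show "finite (T \<union> (\<Union>k<N. U k))" using T(1) U(1) by simp
    show "T \<union> (\<Union>k<N. U k) \<subseteq> E" using T(2) U(2) by blast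
  qed
qed

text \<open>Entries beyond \<open>n\<close> are normalised to zero, so that a vector is determined
  by its first \<open>n\<close> coordinates.\<close>

definition exponents :: "nat \<Rightarrow> (nat \<Rightarrow> nat) set"
  where "exponents n = {a. \<forall>i\<ge>n. a i = 0}"

definition weight :: "(nat \<Rightarrow> nat) \<Rightarrow> nat \<Rightarrow> (nat \<Rightarrow> nat) \<Rightarrow> nat"
  where "weight d n a = (\<Sum>i<n. a i * d i)"

text \<open>The change of exponents when a monomial is multiplied by the generator with index
  \<open>i\<close>.\<close>

definition bump :: "nat \<Rightarrow> (nat \<Rightarrow> nat) \<Rightarrow> nat \<Rightarrow> nat"
  where "bump i a = a(i := Suc (a i))"

text \<open>Putting the weight at the head turns plain lexicographic comparison into weight first,
  then lexicographic.\<close>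

definition exp_key :: "(nat \<Rightarrow> nat) \<Rightarrow> nat \<Rightarrow> (nat \<Rightarrow> nat) \<Rightarrow> nat list"
  where "exp_key d n a = weight d n a # map a [0..<n]"

text \<open>Keys are compared at the one fixed length \<open>Suc n\<close>, where the lexicographic
  order is well-founded.\<close>

definition exp_ord :: "(nat \<Rightarrow> nat) \<Rightarrow> nat \<Rightarrow> ((nat \<Rightarrow> nat) \<times> (nat \<Rightarrow> nat)) set"
  where "exp_ord d n = inv_image (lexn less_than (Suc n)) (exp_key d n)"

lemma length_exp_key [simp]: "length (exp_key d n a) = Suc n"
  by (simp add: exp_key_def)

lemma exp_key_inj: "a \<in> exponents n \<Longrightarrow> b \<in> exponents n \<Longrightarrow> exp_key d n a = exp_key d n b \<Longrightarrow> a = b"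
  by (rule ext) (auto simp: exp_key_def exponents_def not_le[symmetric])

lemma wf_exp_ord: "wf (exp_ord d n)"
  unfolding exp_ord_def by (intro wf_inv_image wf_lexn wf_less_than)

lemma exp_ord_iff: "(a, b) \<in> exp_ord d n \<longleftrightarrow> (exp_key d n a, exp_key d n b) \<in> lex less_than"
  by (simp add: exp_ord_def inv_image_def lexn_conv lex_conv)

lemma trans_exp_ord: "trans (exp_ord d n)"
proof -
  have "trans (lex less_than)" by (intro lex_transI trans_less_than)
  thus ?thesis unfolding trans_def exp_ord_iff by blast
qed

lemma total_exp_ord: "total_on (exponents n) (exp_ord d n)"
proof (rule total_onI)
  fix a b assume ab: "a \<in> exponents n" "b \<in> exponents n" "a \<noteq> b"
  \<comment> \<open>Totality is taken from \<open>lenlex\<close>, which agrees with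
    \<open>lex\<close> on lists of equal length.\<close>
  have "total (lenlex less_than)" by (rule total_lenlex) simp
  moreover have "exp_key d n a \<noteq> exp_key d n b" using ab exp_key_inj by blast
  ultimately have "(exp_key d n a, exp_key d n b) \<in> lenlex less_than \<or>
      (exp_key d n b, exp_key d n a) \<in> lenlex less_than" by (simp add: total_on_def)
  thus "(a, b) \<in> exp_ord d n \<or> (b, a) \<in> exp_ord d n" by (simp add: exp_ord_iff lenlex_conv)
qed

lemma weight_less_exp_ord: "weight d n a < weight d n b \<Longrightarrow> (a, b) \<in> exp_ord d n"
  by (simp add: exp_ord_iff exp_key_def)

lemma weight_bump: 
  assumes "i < n" shows "weight d n (bump i a) = d i + weight d n a"
proof -
  have "weight d n (bump i a) = (\<Sum>j<n. (if j = i then d i else 0) + a j * d j)"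
    unfolding weight_def bump_def by (rule sum.cong) auto
  thus ?thesis using assms by (simp add: sum.distrib weight_def)
qed

lemma bump_exponents: "i < n \<Longrightarrow> a \<in> exponents n \<Longrightarrow> bump i a \<in> exponents n"
  by (auto simp: exponents_def bump_def)

lemma lex_less_than_map:
  "(map f xs, map g xs) \<in> lex less_than \<Longrightarrow> (map (bump i f) xs, map (bump i g) xs) \<in> lex less_than"
  by (induction xs) (auto simp: bump_def)

text \<open>Compatibility with multiplication, the defining property of a monomial order: both
  weights grow by \<open>d i\<close> and the same coordinate grows by one.\<close>

lemma exp_ord_bump: 
  assumes "i < n" "(a, b) \<in> exp_ord d n" shows "(bump i a, bump i b) \<in> exp_ord d n"
  using assms weight_bump[OF assms(1)] lex_less_than_map[of a "[0..<n]" b i]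
  by (auto simp: exp_ord_iff exp_key_def)

text \<open>The monomial \<open>1\<close> is least, so its exponent can serve as the base index
  \<open>a0\<close> of the divisibility argument.\<close>

lemma exp_ord_zero: "a \<in> exponents n \<Longrightarrow> (a, \<lambda>_. 0) \<notin> exp_ord d n"
proof
  assume "(a, \<lambda>_. 0) \<in> exp_ord d n"
  moreover have "(map a xs, map (\<lambda>_. 0) xs) \<notin> lex less_than" for xs :: "nat list"
    by (induction xs) auto
  ultimately show False by (auto simp: exp_ord_iff exp_key_def weight_def)
qed

text \<open>From \<open>t\<close> one reaches \<open>a\<close> by raising one coordinate at a time;
  the induction is on the total excess of \<open>a\<close> over \<open>t\<close>.\<close>

lemma exponents_above:
  assumes "t \<in> exponents n" "a \<in> exponents n" "\<forall>i<n. t i \<le> a i" "Q t"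
    and step: "\<And>i b. i < n \<Longrightarrow> b \<in> exponents n \<Longrightarrow> Q b \<Longrightarrow> Q (bump i b)"
  shows "Q a"
  using assms(2,3)
proof (induction "\<Sum>i<n. a i - t i" arbitrary: a)
  case 0
  have "a i - t i = 0" if "i < n" for i
    using member_le_sum[of i "{..<n}" "\<lambda>i. a i - t i"] 0(1) that by simp
  hence "a i = t i" for i using 0(2,3) assms(1)
    by (cases "i < n") (simp add: le_antisym, simp add: exponents_def)
  hence "a = t" by blast
  thus ?case using assms(4) by simp
next
  case (Suc k)
  have "\<exists>i<n. t i < a i"
  proof (rule ccontr)
    assume "\<not> ?thesis"
    hence "(\<Sum>i<n. a i - t i) = 0" by (intro sum.neutral ballI) (metis diff_is_0_eq lessThan_iff not_less)
    thus False using Suc(2) by simp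
  qed
  then obtain i where i: "i < n" "t i < a i" by blast
  define b where "b = a(i := a i - 1)"
  have a: "a = bump i b" using i by (auto simp: b_def bump_def)
  have "(\<Sum>j<n. a j - t j) = (\<Sum>j<n. (if j = i then 1 else 0) + (b j - t j))"
    using i by (intro sum.cong) (auto simp: b_def)
  hence "(\<Sum>j<n. b j - t j) = k" using Suc(2) i by (simp add: sum.distrib)
  moreover have "b \<in> exponents n" using Suc(3) i by (auto simp: b_def exponents_def)
  moreover have "\<forall>j<n. t j \<le> b j" using Suc(4) i by (auto simp: b_def)
  ultimately have "Q b" using Suc(1) by blast
  thus ?case unfolding a using step i \<open>b \<in> exponents n\<close> by blast
qed

section \<open>Almost commutative filtrations\<close>

lemma (in module) subspace_intro:
  assumes "H \<subseteq> carrier M" "\<zero>\<^bsub>M\<^esub> \<in> H"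
    and "\<And>x y. x \<in> H \<Longrightarrow> y \<in> H \<Longrightarrow> x \<oplus>\<^bsub>M\<^esub> y \<in> H"
    and "\<And>k x. k \<in> carrier R \<Longrightarrow> x \<in> H \<Longrightarrow> k \<odot>\<^bsub>M\<^esub> x \<in> H"
  shows "submodule H R M"
proof (rule submoduleI)
  fix x assume x: "x \<in> H"
  have "(\<ominus> \<one>) \<odot>\<^bsub>M\<^esub> x \<in> H" using x assms(4) by simp
  thus "\<ominus>\<^bsub>M\<^esub> x \<in> H" using smult_l_minus[of \<one> x] x assms(1) by auto
qed (use assms in auto)

section \<open>Algebras, scalars and spans\<close>

locale algebra_over =
  fixes K :: "('k, 'x) ring_scheme" and A :: "('k, 'a, 's) module_scheme" (structure)
  assumes K_algebra: "K_algebra K A"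
begin

sublocale K: cring K using K_algebra by (simp add: K_algebra_def module_def)
sublocale A: ring A using K_algebra by (simp add: K_algebra_def)
sublocale md: module K A using K_algebra by (simp add: K_algebra_def)

lemmas smult_mult_left = K_algebra.smult_mult_left[OF K_algebra]
lemmas smult_mult_right = K_algebra.smult_mult_right[OF K_algebra]

abbreviation scalar :: "'k \<Rightarrow> 'a" where "scalar k \<equiv> k \<odot> \<one>"

lemma scalar_mult: "k \<in> carrier K \<Longrightarrow> y \<in> carrier A \<Longrightarrow> scalar k \<otimes> y = k \<odot> y"
  by (simp add: smult_mult_left)

lemma scalar_centre: "k \<in> carrier K \<Longrightarrow> scalar k \<in> centre A"
  by (simp add: centre_def smult_mult_left smult_mult_right)

lemma scalar_ring_hom: "scalar \<in> ring_hom K (A\<lparr>carrier := centre A\<rparr>)"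
proof (rule ring_hom_memI)
  fix k l assume "k \<in> carrier K" "l \<in> carrier K"
  thus "scalar (k \<otimes>\<^bsub>K\<^esub> l) = scalar k \<otimes>\<^bsub>A\<lparr>carrier := centre A\<rparr>\<^esub> scalar l"
    by (simp add: smult_mult_left md.smult_assoc1)
qed (simp_all add: scalar_centre md.smult_l_distr)

lemma submodule_zero: "submodule H K A \<Longrightarrow> \<zero> \<in> H"
  using subgroup.one_closed[OF submodule.axioms(1)] by fastforce

lemmas submodule_facts = md.submoduleE(1,3,4,5) submodule_zero

text \<open>As an intersection, the span is bounded above by exhibiting any subspace that contains
  \<open>S\<close>, without handling linear combinations.\<close>

definition kspan :: "'a set \<Rightarrow> 'a set" where "kspan S = \<Inter> {W. submodule W K A \<and> S \<subseteq> W}"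

lemma kspan_submodule: 
  assumes "S \<subseteq> carrier A" shows "submodule (kspan S) K A"
proof (rule md.subspace_intro)
  show "kspan S \<subseteq> carrier A" using assms md.carrier_is_submodule by (auto simp: kspan_def)
qed (auto simp: kspan_def submodule_facts)

lemma kspan_base: "y \<in> S \<Longrightarrow> y \<in> kspan S"
  by (auto simp: kspan_def)

lemma kspan_least: "submodule W K A \<Longrightarrow> S \<subseteq> W \<Longrightarrow> kspan S \<subseteq> W"
  by (auto simp: kspan_def)

text \<open>These subspaces are fed to \<open>kspan_least\<close> in order to extend statements
  about products linearly from spanning elements.\<close>

lemma submodule_vimage_mult:
  assumes "submodule W K A" "u \<in> carrier A"
  shows "submodule {v \<in> carrier A. u \<otimes> v \<in> W} K A" "submodule {v \<in> carrier A. v \<otimes> u \<in> W} K A"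
  using assms by (auto intro!: md.subspace_intro simp: submodule_facts A.r_distr A.l_distr smult_mult_right smult_mult_left)

end

section \<open>Filtered algebras and almost commuting generators\<close>

locale filtered_algebra = algebra_over K A
  for K :: "('k, 'x) ring_scheme" and A :: "('k, 'a, 's) module_scheme" (structure) +
  fixes F :: "nat \<Rightarrow> 'a set"
  assumes filtration: "filtration K A F"
begin

abbreviation Fp where "Fp \<equiv> filt_pred A F"

lemma F_submodule: "submodule (F i) K A"
  and F_Suc: "F i \<subseteq> F (Suc i)"
  and F_one: "\<one> \<in> F 0"
  and F_exhausts: "carrier A = (\<Union>i. F i)"
  and F_mult: "y \<in> F i \<Longrightarrow> z \<in> F j \<Longrightarrow> y \<otimes> z \<in> F (i + j)"
  using filtration unfolding filtration_def by blast+

lemma F_mono: "i \<le> j \<Longrightarrow> F i \<subseteq> F j"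
  using F_Suc by (rule lift_Suc_mono_le)

lemma F_closed: "y \<in> F i \<Longrightarrow> y \<in> carrier A"
  using submodule_facts(1)[OF F_submodule] by blast

lemma Fp_0 [simp]: "Fp 0 = {\<zero>}" and Fp_Suc [simp]: "Fp (Suc k) = F k"
  by (simp_all add: filt_pred_def)

lemma Fp_submodule: "submodule (Fp i) K A"
  by (cases i) (auto simp: F_submodule intro: md.subspace_intro)

lemma Fp_closed: "y \<in> Fp i \<Longrightarrow> y \<in> carrier A"
  using submodule_facts(1)[OF Fp_submodule] by blast

lemma Fp_subset_F: "Fp i \<subseteq> F i"
  using submodule_facts(5)[OF F_submodule] F_mono[of "i - 1" i] by (cases i) auto

lemma Fp_mono: "i \<le> j \<Longrightarrow> Fp i \<subseteq> Fp j"
  using submodule_facts(5)[OF Fp_submodule[of j]] F_mono by (cases i; cases j) auto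

text \<open>A drop of one step in a factor is passed on to the product; for \<open>j = 0\<close> the
  dropped factor is zero.\<close>

lemma F_mult_Fp: "y \<in> F i \<Longrightarrow> z \<in> Fp j \<Longrightarrow> y \<otimes> z \<in> Fp (i + j)"
  using submodule_facts(5)[OF Fp_submodule[of i]] F_mult by (cases j) (auto simp: F_closed)

lemma Fp_mult_F: "y \<in> Fp i \<Longrightarrow> z \<in> F j \<Longrightarrow> y \<otimes> z \<in> Fp (i + j)"
  using submodule_facts(5)[OF Fp_submodule[of j]] F_mult by (cases i) (auto simp: F_closed)

end

text \<open>Commutation modulo lower degree is required against all of \<open>F j\<close>, because
  reordering moves \<open>x i\<close> past a whole prefix of a monomial at once.\<close>

locale filtered_generators = filtered_algebra K A F
  for K :: "('k, 'x) ring_scheme" and A :: "('k, 'a, 's) module_scheme" (structure) and F +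
  fixes n :: nat and x :: "nat \<Rightarrow> 'a" and d :: "nat \<Rightarrow> nat"
  assumes x_in: "i < n \<Longrightarrow> x i \<in> F (d i)"
    and x_commutes: "i < n \<Longrightarrow> y \<in> F j \<Longrightarrow> x i \<otimes> y \<ominus> y \<otimes> x i \<in> filt_pred A F (d i + j)"
begin

lemma x_closed: "i < n \<Longrightarrow> x i \<in> carrier A"
  using x_in F_closed by blast

text \<open>The prefix length \<open>m\<close> is kept apart from \<open>n\<close> so that it can
  serve as induction variable.\<close>

primrec mon :: "nat \<Rightarrow> (nat \<Rightarrow> nat) \<Rightarrow> 'a" where
  "mon 0 a = \<one>"
| "mon (Suc m) a = mon m a \<otimes> x m [^] a m"

lemma mon_cong: "(\<And>i. i < m \<Longrightarrow> a i = b i) \<Longrightarrow> mon m a = mon m b"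
  by (induction m) auto

lemma mon_zero: "m \<le> n \<Longrightarrow> mon m (\<lambda>_. 0) = \<one>"
  by (induction m) (auto simp: x_closed)

lemma x_pow_F: "i < n \<Longrightarrow> x i [^] (k::nat) \<in> F (k * d i)"
proof (induction k)
  case (Suc k)
  thus ?case using F_mult[of "x i [^] k" "k * d i" "x i" "d i"] x_in by (simp add: add.commute)
qed (simp add: F_one)

lemma mon_F: "m \<le> n \<Longrightarrow> mon m a \<in> F (weight d m a)"
  by (induction m) (auto simp: F_one weight_def x_pow_F intro: F_mult)

lemma mon_closed: "m \<le> n \<Longrightarrow> mon m a \<in> carrier A"
  using mon_F F_closed by blast

text \<open>Moving \<open>x i\<close> to its place costs a commutator with the powers to its left.
  That commutator has lower degree, and the powers to the right are multiplied on
  afterwards.\<close>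

lemma x_mult_mon:
  "m \<le> n \<Longrightarrow> i < m \<Longrightarrow> x i \<otimes> mon m a \<ominus> mon m (bump i a) \<in> Fp (d i + weight d m a)"
proof (induction m)
  case (Suc m)
  define u p where "u = mon m a" and "p = x m [^] a m"
  have p: "p \<in> F (a m * d m)" using x_pow_F Suc(2) by (simp add: p_def)
  have u: "u \<in> F (weight d m a)" using mon_F Suc(2) by (simp add: u_def)
  have xi: "x i \<in> carrier A" using x_closed Suc by simp
  note cl = F_closed[OF p] F_closed[OF u] xi
  have w: "weight d (Suc m) a = weight d m a + a m * d m" by (simp add: weight_def)
  show ?case
  proof (cases "i = m")
    case True
    have 1: "mon m (bump i a) = u" unfolding u_def True by (rule mon_cong) (simp add: bump_def)
    have 2: "x m [^] bump i a m = x m \<otimes> p"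
      using x_closed[of m] Suc(2) A.nat_pow_Suc2[of "x m" "a m"] by (simp add: p_def bump_def True)
    \<comment> \<open>Here \<open>x i\<close> belongs right after the prefix \<open>u\<close>, so
      the whole discrepancy is one commutator with \<open>u\<close>, times \<open>p\<close>.\<close>
    have "x i \<otimes> mon (Suc m) a \<ominus> mon (Suc m) (bump i a) = (x i \<otimes> u \<ominus> u \<otimes> x i) \<otimes> p"
      using cl by (simp add: 1[unfolded True] 2[unfolded True] u_def[symmetric] p_def[symmetric] True a_minus_def A.l_distr A.l_minus A.m_assoc)
    also have "\<dots> \<in> Fp (d i + weight d m a + a m * d m)"
      using x_commutes[of i u] u p Suc by (intro Fp_mult_F) auto
    finally show ?thesis by (simp add: w add.assoc)
  next
    case False
    have 1: "x m [^] bump i a m = p" using False by (simp add: bump_def p_def)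
    have mc: "mon m (bump i a) \<in> carrier A" using mon_closed Suc(2) by simp
    have "x i \<otimes> mon (Suc m) a \<ominus> mon (Suc m) (bump i a) = (x i \<otimes> u \<ominus> mon m (bump i a)) \<otimes> p"
      using cl mc by (simp add: 1 u_def[symmetric] p_def[symmetric] a_minus_def A.l_distr A.l_minus A.m_assoc)
    also have "\<dots> \<in> Fp (d i + weight d m a + a m * d m)"
      using Suc False p by (intro Fp_mult_F) (auto simp: u_def)
    finally show ?thesis by (simp add: w add.assoc)
  qed
qed simp

lemma x_mult_mon_obtain:
  assumes "i < n"
  obtains r where "r \<in> Fp (d i + weight d n a)" "x i \<otimes> mon n a = mon n (bump i a) \<oplus> r"
proof
  let ?r = "x i \<otimes> mon n a \<ominus> mon n (bump i a)"
  show "?r \<in> Fp (d i + weight d n a)" using x_mult_mon assms by simp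
  show "x i \<otimes> mon n a = mon n (bump i a) \<oplus> ?r"
    using mon_closed[of n a] mon_closed[of n "bump i a"] x_closed[OF assms]
    by (simp add: a_minus_def A.a_lcomm[of "mon n (bump i a)" "x i \<otimes> mon n a"] A.r_neg)
qed

text \<open>The part of \<open>F k\<close> that ordered monomials reach modulo
  \<open>F (k - 1)\<close>. Generation of the graded algebra enters the argument as
  \<open>F k \<subseteq> G k\<close>.\<close>

definition G :: "nat \<Rightarrow> 'a set"
  where "G k = kspan ({mon n a | a. a \<in> exponents n \<and> weight d n a \<le> k} \<union> Fp k)"

lemma G_submodule: "submodule (G k) K A"
  unfolding G_def by (rule kspan_submodule) (auto simp: mon_closed Fp_closed)

lemma G_mon: "a \<in> exponents n \<Longrightarrow> weight d n a \<le> k \<Longrightarrow> mon n a \<in> G k"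
  unfolding G_def by (rule kspan_base) auto

lemma Fp_G: "u \<in> Fp k \<Longrightarrow> u \<in> G k"
  unfolding G_def by (rule kspan_base) auto

lemma G_least:
  assumes "submodule W K A" "Fp k \<subseteq> W"
    and "\<And>a. a \<in> exponents n \<Longrightarrow> weight d n a \<le> k \<Longrightarrow> mon n a \<in> W"
  shows "G k \<subseteq> W"
  unfolding G_def by (rule kspan_least) (use assms in auto)

lemma G_F: "G k \<subseteq> F k"
  using mon_F F_mono by (intro G_least F_submodule Fp_subset_F) blast

lemma G_mono: 
  assumes "j \<le> k" shows "G j \<subseteq> G k"
proof (intro G_least G_submodule)
  show "Fp j \<subseteq> G k" using Fp_mono[OF assms] Fp_G by blast
qed (use assms G_mon in auto)

text \<open>On a monomial, multiplication by \<open>x i\<close> gives the bumped monomial plus a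
  term of lower degree; the part \<open>Fp k\<close> only shifts its degree.\<close>

lemma x_mult_G:
  assumes "i < n" "u \<in> G k" shows "x i \<otimes> u \<in> G (d i + k)"
proof -
  have "G k \<subseteq> {u \<in> carrier A. x i \<otimes> u \<in> G (d i + k)}"
  proof (rule G_least)
    show "submodule {u \<in> carrier A. x i \<otimes> u \<in> G (d i + k)} K A"
      by (rule submodule_vimage_mult(1)[OF G_submodule x_closed[OF assms(1)]])
    show "Fp k \<subseteq> {u \<in> carrier A. x i \<otimes> u \<in> G (d i + k)}"
      using F_mult_Fp[OF x_in[OF assms(1)]] Fp_G Fp_closed by blast
    fix a assume a: "a \<in> exponents n" "weight d n a \<le> k"
    obtain r where r: "r \<in> Fp (d i + weight d n a)" "x i \<otimes> mon n a = mon n (bump i a) \<oplus> r"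
      using x_mult_mon_obtain[OF assms(1)] by blast
    have "r \<in> G (d i + k)" using r(1) Fp_mono[of "d i + weight d n a" "d i + k"] a Fp_G by auto
    moreover have "mon n (bump i a) \<in> G (d i + k)"
      using a assms(1) by (intro G_mon bump_exponents) (simp_all add: weight_bump)
    ultimately show "mon n a \<in> {u \<in> carrier A. x i \<otimes> u \<in> G (d i + k)}"
      using r(2) submodule_facts(4)[OF G_submodule] by (simp add: mon_closed)
  qed
  thus ?thesis using assms by blast
qed

end

text \<open>Assumption \<open>scalar_B\<close> turns \<open>K\<close>-linear combinations of
  monomials, applied to \<open>m\<close>, into \<open>B\<close>-linear combinations of the vectors
  \<open>e a\<close>.\<close>

locale filtered_module =
  filtered_generators K A F n x d + spanned_module A M B e "exponents n" "exp_ord d n"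
  for K :: "('k, 'x) ring_scheme" and A :: "('k, 'a, 's) module_scheme" (structure)
    and F n x d and M :: "('a, 'm, 't) module_scheme" (structure) and B e +
  fixes m :: 'm
  assumes F_G: "F j \<subseteq> G j"
    and scalar_B: "k \<in> carrier K \<Longrightarrow> scalar k \<in> B"
    and m: "m \<in> carrier M" "m \<noteq> \<zero>\<^bsub>M\<^esub>"
    and e: "e a = mon n a \<odot>\<^bsub>M\<^esub> m"
begin

lemma e_carrier: "e a \<in> carrier M"
  using smult_closed mon_closed m by (simp add: e)

lemma vimage_submodule: "submodule {y \<in> carrier A. y \<odot>\<^bsub>M\<^esub> m \<in> lspan J} K A"
proof (rule md.subspace_intro)
  fix k y assume k: "k \<in> carrier K" and y: "y \<in> {y \<in> carrier A. y \<odot>\<^bsub>M\<^esub> m \<in> lspan J}"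
  have "(k \<odot> y) \<odot>\<^bsub>M\<^esub> m = scalar k \<odot>\<^bsub>M\<^esub> (y \<odot>\<^bsub>M\<^esub> m)"
    using k y m smult_assoc[of "scalar k" y m] scalar_mult[of k y] by simp
  thus "k \<odot> y \<in> {y \<in> carrier A. y \<odot>\<^bsub>M\<^esub> m \<in> lspan J}"
    using k y scalar_B lspan_smult by simp
qed (auto simp: m smult_zero_left lspan_zero smult_l_distr lspan_add)

text \<open>Induction on the degree: by \<open>F_G\<close>, monomials of weight at most
  \<open>k\<close> account for \<open>F k\<close> up to \<open>F (k - 1)\<close>, which is already
  spanned.\<close>

lemma F_lspan: "y \<in> F k \<Longrightarrow> y \<odot>\<^bsub>M\<^esub> m \<in> lspan {a. weight d n a \<le> k}"
proof (induction k arbitrary: y)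
  case (0 y)
  let ?W = "{y \<in> carrier A. y \<odot>\<^bsub>M\<^esub> m \<in> lspan {a. weight d n a \<le> 0}}"
  have "G 0 \<subseteq> ?W"
    using lspan_base[of _ _ \<one>] B_ops(2) mon_closed m
    by (intro G_least vimage_submodule) (auto simp: smult_zero_left lspan_zero smult_one smult_closed e)
  thus ?case using F_G 0 by blast
next
  case (Suc k y)
  let ?W = "{y \<in> carrier A. y \<odot>\<^bsub>M\<^esub> m \<in> lspan {a. weight d n a \<le> Suc k}}"
  have "G (Suc k) \<subseteq> ?W"
  proof (intro G_least vimage_submodule)
    show "Fp (Suc k) \<subseteq> ?W" using F_closed by (auto intro!: lspan_mono[OF Suc(1)])
    show "mon n a \<in> ?W" if "a \<in> exponents n" "weight d n a \<le> Suc k" for a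
      using lspan_base[of a "{a. weight d n a \<le> Suc k}" \<one>] that B_ops(2) mon_closed m
      by (simp add: smult_one smult_closed e)
  qed
  thus ?case using F_G Suc by blast
qed

lemma Fp_lspan: 
  assumes "y \<in> Fp k" shows "y \<odot>\<^bsub>M\<^esub> m \<in> lspan {a. weight d n a < k}"
proof (cases k)
  case 0
  thus ?thesis using assms m by (simp add: smult_zero_left lspan_zero)
next
  case (Suc j)
  thus ?thesis using F_lspan[of y j] assms by (simp add: less_Suc_eq_le)
qed

lemma spans: "carrier M \<subseteq> lspan (exponents n)"
proof
  fix v assume "v \<in> carrier M"
  then obtain y where y: "y \<in> carrier A" "v = y \<odot>\<^bsub>M\<^esub> m" using cyclic m by blast
  then obtain k where "y \<in> F k" using F_exhausts by blast
  hence "v \<in> lspan {a. weight d n a \<le> k}" using F_lspan y by blast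
  \<comment> \<open>The weight condition alone does not imply membership in
    \<open>exponents n\<close>; the terms are revisited because each carries that
    membership.\<close>
  thus "v \<in> lspan (exponents n)" by (induction rule: lspan.induct) (auto intro: lspan.intros)
qed

text \<open>This is where the priority of the weight in the order pays off: every remainder of lower
  degree counts as smaller.\<close>

lemma lspan_below: 
  assumes "v \<in> lspan {c. weight d n c < weight d n a}" shows "v \<in> lspan (below a)"
  using assms by (induction rule: lspan.induct)
    (auto intro!: lspan.intros weight_less_exp_ord simp: below_def)

text \<open>The coefficients are central, so \<open>x i\<close> acts on each term through its
  monomial. It bumps the exponent, which preserves the order, and leaves a remainder of smaller
  weight.\<close>

lemma below_bump:
  assumes i: "i < n" and a: "a \<in> exponents n" and "v \<in> lspan (below a)"
  shows "x i \<odot>\<^bsub>M\<^esub> v \<in> lspan (below (bump i a))"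
  using assms(3)
proof (induction rule: lspan.induct)
  case lspan_zero
  thus ?case using x_closed[OF i] by (simp add: smult_zero_right lspan.lspan_zero)
next
  case (lspan_step c b v)
  have xi: "x i \<in> carrier A" using x_closed i by blast
  have b: "b \<in> centre A" "b \<in> carrier A" using B_central lspan_step(3) B_closed by auto
  have v: "v \<in> carrier M" using lspan_closed lspan_step(4) by blast
  have mc: "mon n c \<in> carrier A" "mon n (bump i c) \<in> carrier A" using mon_closed by auto
  obtain r where r: "r \<in> Fp (d i + weight d n c)" "x i \<otimes> mon n c = mon n (bump i c) \<oplus> r"
    using x_mult_mon_obtain[OF i] by blast
  have rc: "r \<in> carrier A" using r Fp_closed by blast
  have lt: "(bump i c, bump i a) \<in> exp_ord d n"
    using exp_ord_bump[OF i] lspan_step(1) by (simp add: below_def)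
  \<comment> \<open>The remainder lies strictly below degree \<open>d i + weight d n c\<close>,
    which is the weight of \<open>bump i c\<close>.\<close>
  have "r \<odot>\<^bsub>M\<^esub> m \<in> lspan (below (bump i c))"
    using Fp_lspan[OF r(1)] i by (intro lspan_below) (simp add: weight_bump)
  hence "b \<odot>\<^bsub>M\<^esub> (r \<odot>\<^bsub>M\<^esub> m) \<in> lspan (below (bump i a))"
    using lspan_mono below_mono[OF lt] lspan_smult lspan_step(3) by blast
  moreover have "b \<odot>\<^bsub>M\<^esub> e (bump i c) \<in> lspan (below (bump i a))"
    using lt lspan_step i bump_exponents by (intro lspan_base) (auto simp: below_def)
  ultimately have "b \<odot>\<^bsub>M\<^esub> e (bump i c) \<oplus>\<^bsub>M\<^esub> b \<odot>\<^bsub>M\<^esub> (r \<odot>\<^bsub>M\<^esub> m)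
      \<oplus>\<^bsub>M\<^esub> x i \<odot>\<^bsub>M\<^esub> v \<in> lspan (below (bump i a))"
    using lspan_add lspan_step(5) by blast
  moreover have "x i \<odot>\<^bsub>M\<^esub> (b \<odot>\<^bsub>M\<^esub> e c \<oplus>\<^bsub>M\<^esub> v)
      = b \<odot>\<^bsub>M\<^esub> ((x i \<otimes> mon n c) \<odot>\<^bsub>M\<^esub> m) \<oplus>\<^bsub>M\<^esub> x i \<odot>\<^bsub>M\<^esub> v"
    using centre_commutes_smult[OF b(1) xi] xi b mc m v by (simp add: smult_r_distr smult_closed smult_assoc e[of c])
  ultimately show ?case
    unfolding r(2) using b mc rc m by (simp add: e[of c] e[of "bump i c"] smult_l_distr smult_r_distr smult_closed)
qed

text \<open>Applying \<open>x i\<close> to the relation at \<open>a\<close> gives one at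
  \<open>bump i a\<close>, up to a remainder of smaller weight. The multiplier \<open>f\<close> is
  unchanged, which is why finitely many multipliers suffice.\<close>

lemma torsion_bump:
  assumes i: "i < n" and a: "a \<in> exponents n" and f: "f \<in> B"
    and fa: "f \<odot>\<^bsub>M\<^esub> e a \<in> lspan (below a)"
  shows "f \<odot>\<^bsub>M\<^esub> e (bump i a) \<in> lspan (below (bump i a))"
proof -
  have xi: "x i \<in> carrier A" using x_closed i by blast
  have fc: "f \<in> centre A" "f \<in> carrier A" using B_central f B_closed by auto
  have mc: "mon n a \<in> carrier A" "mon n (bump i a) \<in> carrier A" using mon_closed by auto
  obtain r where r: "r \<in> Fp (d i + weight d n a)" "x i \<otimes> mon n a = mon n (bump i a) \<oplus> r"
    using x_mult_mon_obtain[OF i] by blast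
  have rc: "r \<in> carrier A" using r Fp_closed by blast
  have "r \<odot>\<^bsub>M\<^esub> m \<in> lspan (below (bump i a))"
    using Fp_lspan[OF r(1)] i by (intro lspan_below) (simp add: weight_bump)
  hence "f \<odot>\<^bsub>M\<^esub> (r \<odot>\<^bsub>M\<^esub> m) \<in> lspan (below (bump i a))" using lspan_smult f by blast
  moreover have "x i \<odot>\<^bsub>M\<^esub> (f \<odot>\<^bsub>M\<^esub> e a) \<in> lspan (below (bump i a))"
    using below_bump[OF i a fa] .
  ultimately have *: "x i \<odot>\<^bsub>M\<^esub> (f \<odot>\<^bsub>M\<^esub> e a) \<ominus>\<^bsub>M\<^esub> f \<odot>\<^bsub>M\<^esub> (r \<odot>\<^bsub>M\<^esub> m)
      \<in> lspan (below (bump i a))" by (intro lspan_minus)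
  have "x i \<odot>\<^bsub>M\<^esub> (f \<odot>\<^bsub>M\<^esub> e a) = f \<odot>\<^bsub>M\<^esub> ((x i \<otimes> mon n a) \<odot>\<^bsub>M\<^esub> m)"
    using centre_commutes_smult[OF fc(1) xi] xi fc mc m by (simp add: e[of a] e[of "bump i a"] smult_closed smult_assoc)
  also have "\<dots> = f \<odot>\<^bsub>M\<^esub> e (bump i a) \<oplus>\<^bsub>M\<^esub> f \<odot>\<^bsub>M\<^esub> (r \<odot>\<^bsub>M\<^esub> m)"
    unfolding r(2) using fc mc rc m by (simp add: e[of a] e[of "bump i a"] smult_l_distr smult_r_distr smult_closed)
  finally show ?thesis using * fc mc rc m
    by (simp add: e[of a] e[of "bump i a"] a_minus_def M.a_assoc M.r_neg smult_closed)
qed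

text \<open>Every torsion exponent dominates one from a finite set \<open>T\<close>, and relations
  propagate upwards with the same multiplier. So only a multiplier common to \<open>T\<close> has to
  be found.\<close>

lemma common_denominator:
  "\<exists>f \<in> B - annihilator A M. \<forall>a \<in> exponents n. torsion a \<longrightarrow>
     f \<odot>\<^bsub>M\<^esub> e a \<in> lspan (below a)"
proof -
  obtain T where T: "finite T" "T \<subseteq> {a \<in> exponents n. torsion a}"
    "\<forall>a \<in> {a \<in> exponents n. torsion a}. \<exists>t \<in> T. \<forall>i<n. t i \<le> a i"
    using dickson[of "{a \<in> exponents n. torsion a}" n] by blast
  \<comment> \<open>The common multiplier is the product of individual ones: it works for each
    \<open>t\<close> because \<open>B\<close> is central, and primality keeps it outside the
    annihilator.\<close>
  have "\<exists>f \<in> B - annihilator A M. \<forall>t \<in> T. f \<odot>\<^bsub>M\<^esub> e t \<in> lspan (below t)"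
    using T(1,2)
  proof (induction T)
    case empty
    show ?case using B_ops(2) one_notin_annihilator by blast
  next
    case (insert t T)
    obtain f where f: "f \<in> B - annihilator A M"
      "\<forall>t \<in> T. f \<odot>\<^bsub>M\<^esub> e t \<in> lspan (below t)" using insert by blast
    obtain b where b: "b \<in> B - annihilator A M" "b \<odot>\<^bsub>M\<^esub> e t \<in> lspan (below t)"
      using insert(4) by (auto simp: torsion_def)
    have fb: "f \<in> carrier A" "b \<in> carrier A" "f \<in> centre A" "b \<in> centre A"
      using f b B_central B_closed by auto
    have "f \<otimes> b \<in> B - annihilator A M"
      using f b fb B_ops(4) centre_mult_notin_annihilator by blast
    moreover have "(f \<otimes> b) \<odot>\<^bsub>M\<^esub> e t \<in> lspan (below t)"
      using lspan_smult[OF b(2)] f fb m by (simp add: smult_assoc smult_closed e[of t] mon_closed)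
    moreover have "(f \<otimes> b) \<odot>\<^bsub>M\<^esub> e s \<in> lspan (below s)" if "s \<in> T" for s
    proof -
      have "(b \<otimes> f) \<odot>\<^bsub>M\<^esub> e s \<in> lspan (below s)"
        using lspan_smult[OF bspec[OF f(2) that], of b] b fb smult_assoc[of b f "e s"] e_carrier by simp
      moreover have "f \<otimes> b = b \<otimes> f" using centreD(2)[OF fb(3,2)] .
      ultimately show ?thesis by simp
    qed
    ultimately show ?case by blast
  qed
  then obtain f where f: "f \<in> B - annihilator A M"
    "\<forall>t \<in> T. f \<odot>\<^bsub>M\<^esub> e t \<in> lspan (below t)" by blast
  have "f \<odot>\<^bsub>M\<^esub> e a \<in> lspan (below a)" if a: "a \<in> exponents n" "torsion a" for a
  proof -
    obtain t where t: "t \<in> T" "\<forall>i<n. t i \<le> a i" using T(3) a by blast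
    show ?thesis
    proof (rule exponents_above[of t n a "\<lambda>a. f \<odot>\<^bsub>M\<^esub> e a \<in> lspan (below a)"])
      show "t \<in> exponents n" using t T(2) by blast
      fix i b assume "i < n" "b \<in> exponents n" "f \<odot>\<^bsub>M\<^esub> e b \<in> lspan (below b)"
      thus "f \<odot>\<^bsub>M\<^esub> e (bump i b) \<in> lspan (below (bump i b))"
        using torsion_bump f(1) by blast
    qed (use a t f in auto)
  qed
  thus ?thesis using f(1) by blast
qed

lemma goldman:
  "\<exists>f \<in> B - annihilator A M. \<forall>g \<in> B - annihilator A M.
     \<exists>N. \<exists>c \<in> B. f [^] (N::nat) \<ominus> g \<otimes> c \<in> annihilator A M"
proof -
  obtain f where f: "f \<in> B - annihilator A M"
    "\<forall>a \<in> exponents n. torsion a \<longrightarrow> f \<odot>\<^bsub>M\<^esub> e a \<in> lspan (below a)"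
    using common_denominator by blast
  have "\<exists>N. \<exists>c \<in> B. f [^] (N::nat) \<ominus> g \<otimes> c \<in> annihilator A M" if g: "g \<in> B - annihilator A M" for g
  \<comment> \<open>The base index is the zero exponent: its monomial is \<open>1\<close>, so its
    vector is \<open>m\<close> itself.\<close>
  proof (rule divides_power[of f "\<lambda>_. 0"])
    show "below (\<lambda>_. 0) = {}" using exp_ord_zero by (auto simp: below_def)
    show "e (\<lambda>_. 0) \<noteq> \<zero>\<^bsub>M\<^esub>" using m by (simp add: e[of "\<lambda>_. 0"] mon_zero smult_one)
    show "(\<lambda>_. 0) \<in> exponents n" by (simp add: exponents_def)
  qed (use f g spans in auto)
  thus ?thesis using f(1) by blast
qed

end

section \<open>Evaluation at a central element and the theorem for filtered algebras\<close>

context algebra_over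
begin

lemma eval_ring_hom:
  assumes "z \<in> centre A"
  shows "eval K (A\<lparr>carrier := centre A\<rparr>) scalar z \<in> ring_hom (UP K) (A\<lparr>carrier := centre A\<rparr>)"
    and "eval K (A\<lparr>carrier := centre A\<rparr>) scalar z (monom (UP K) \<one>\<^bsub>K\<^esub> 1) = z"
    and "k \<in> carrier K \<Longrightarrow>
      eval K (A\<lparr>carrier := centre A\<rparr>) scalar z (monom (UP K) k 0) = scalar k"
proof -
  interpret E: UP_pre_univ_prop K "A\<lparr>carrier := centre A\<rparr>" scalar "UP K"
    using K.cring_axioms A.centre_cring scalar_ring_hom by (rule UP_pre_univ_propI)
  show "eval K (A\<lparr>carrier := centre A\<rparr>) scalar z \<in> ring_hom (UP K) (A\<lparr>carrier := centre A\<rparr>)"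
    using E.eval_ring_hom assms by simp
  show "eval K (A\<lparr>carrier := centre A\<rparr>) scalar z (monom (UP K) \<one>\<^bsub>K\<^esub> 1) = z"
    using E.eval_monom1 assms by simp
  show "eval K (A\<lparr>carrier := centre A\<rparr>) scalar z (monom (UP K) k 0) = scalar k" if "k \<in> carrier K"
    using E.eval_const assms that by simp
qed

lemma PLM_algebraI:
  fixes T :: "'m itself"
  assumes "\<And>(M :: ('a, 'm) module) z. simple_left_module A M \<Longrightarrow> z \<in> centre A \<Longrightarrow>
    z \<notin> annihilator A M \<Longrightarrow> \<exists>w \<in> centre A. \<forall>y \<in> carrier M. z \<odot>\<^bsub>M\<^esub> (w \<odot>\<^bsub>M\<^esub> y) = y"
  shows "PLM_algebra T K A"
  unfolding PLM_algebra_def PLM_ring_def simple_module_iff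
  using K_algebra A.ring_axioms simple_left_module.annihilator_maximal assms by blast

end

text \<open>Common end of both filtered classes: each of them only has to supply generators with
  \<open>F k \<subseteq> G k\<close>.\<close>

theorem (in filtered_generators) PLM_algebra:
  fixes T :: "'m itself"
  assumes "field K" and F_G: "\<And>k. F k \<subseteq> G k"
  shows "PLM_algebra T K A"
proof (rule PLM_algebraI)
  fix M :: "('a, 'm) module" and z
  assume M: "simple_left_module A M" and z: "z \<in> centre A" "z \<notin> annihilator A M"
  interpret M: simple_left_module A M by (rule M)
  define \<psi> where "\<psi> = eval K (A\<lparr>carrier := centre A\<rparr>) scalar z"
  note ev = eval_ring_hom[OF z(1), folded \<psi>_def]
  interpret C: central_polynomials A M K \<psi>
    using ev(1) \<open>field K\<close> M by (simp add: central_polynomials_def central_polynomials_axioms_def)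
  have X: "\<psi> C.X = z" using ev(2) by (simp add: C.X_def)
  \<comment> \<open>\<open>B\<close> is the subalgebra generated by \<open>z\<close> over
    \<open>K\<close>.\<close>
  define B where "B = \<psi> ` carrier (UP K)"
  have "subring B A"
  proof (rule A.subringI)
    show "B \<subseteq> carrier A" by (auto simp: B_def)
    show "\<one> \<in> B" unfolding B_def using C.psi_one by (metis C.P.P.one_closed image_eqI)
    show "\<ominus> b \<in> B" if "b \<in> B" for b
      using that by (auto simp: B_def C.psi_uminus[symmetric])
    show "b \<otimes> c \<in> B" "b \<oplus> c \<in> B" if "b \<in> B" "c \<in> B" for b c
      using that by (auto simp: B_def C.psi_mult[symmetric] C.psi_add[symmetric])
  qed
  moreover have "B \<subseteq> centre A" using C.psi_centre by (auto simp: B_def)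
  moreover have "scalar k \<in> B" if "k \<in> carrier K" for k
    using ev(3)[OF that] that C.P.monom_closed unfolding B_def by (metis image_eqI)
  moreover obtain m where "m \<in> carrier M" "m \<noteq> \<zero>\<^bsub>M\<^esub>" using M.obtain_nonzero by blast
  ultimately have "filtered_module K A F n x d M B (\<lambda>a. mon n a \<odot>\<^bsub>M\<^esub> m) m"
    using F_G filtered_generators_axioms M
    by (intro filtered_module.intro filtered_module_axioms.intro spanned_module.intro
        spanned_module_axioms.intro wf_exp_ord trans_exp_ord total_exp_ord M.smult_closed mon_closed) auto
  from filtered_module.goldman[OF this]
  obtain f where "f \<in> B - annihilator A M" "\<forall>g \<in> B - annihilator A M.
     \<exists>N. \<exists>c \<in> B. f [^] (N::nat) \<ominus> g \<otimes> c \<in> annihilator A M" by blast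
  hence "\<exists>w \<in> centre A. \<forall>y \<in> carrier M. \<psi> C.X \<odot>\<^bsub>M\<^esub> (w \<odot>\<^bsub>M\<^esub> y) = y"
    unfolding B_def using z(2) by (intro C.goldman_invertible[of f]) (auto simp: X)
  thus "\<exists>w \<in> centre A. \<forall>y \<in> carrier M. z \<odot>\<^bsub>M\<^esub> (w \<odot>\<^bsub>M\<^esub> y) = y" by (simp add: X)
qed

section \<open>Algebraic endomorphism algebras\<close>

text \<open>Evaluation sums in the restricted record of the centre, whereas the action sums in
  \<open>M\<close>; this is distributivity across the two.\<close>

lemma (in left_module) finsum_centre_smult:
  assumes "finite I" "g \<in> I \<rightarrow> centre R" "y \<in> carrier M"
  shows "(\<Oplus>\<^bsub>R\<lparr>carrier := centre R\<rparr>\<^esub>i \<in> I. g i) \<odot>\<^bsub>M\<^esub> y = (\<Oplus>\<^bsub>M\<^esub>i \<in> I. g i \<odot>\<^bsub>M\<^esub> y)"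
  using assms(1,2)
proof (induction I)
  interpret Z: cring "R\<lparr>carrier := centre R\<rparr>" by (rule R.centre_cring)
  case empty
  show ?case using Z.finsum_empty assms(3) by (simp add: smult_zero_left)
next
  interpret Z: cring "R\<lparr>carrier := centre R\<rparr>" by (rule R.centre_cring)
  case (insert i I)
  have g: "g i \<in> centre R" "g \<in> I \<rightarrow> centre R" using insert(4) by auto
  have s: "finsum (R\<lparr>carrier := centre R\<rparr>) g I \<in> centre R" using Z.finsum_closed[of g I] g by simp
  have "finsum (R\<lparr>carrier := centre R\<rparr>) g (insert i I) = g i \<oplus> finsum (R\<lparr>carrier := centre R\<rparr>) g I"
    using Z.finsum_insert[OF insert(1,2), of g] g by simp
  moreover have "(\<Oplus>\<^bsub>M\<^esub>j \<in> insert i I. g j \<odot>\<^bsub>M\<^esub> y) = g i \<odot>\<^bsub>M\<^esub> y \<oplus>\<^bsub>M\<^esub> (\<Oplus>\<^bsub>M\<^esub>j \<in> I. g j \<odot>\<^bsub>M\<^esub> y)"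
    using insert(1,2) g assms(3) centreD(1) smult_closed by (intro M.finsum_insert) (auto simp: Pi_def)
  ultimately show ?case
    using insert(3) g s assms(3) centreD(1) by (simp add: smult_l_distr)
qed

locale endomorphisms = left_module A M
  for A :: "('k, 'a, 's) module_scheme" (structure) and M :: "('a, 'm, 't) module_scheme" (structure)
begin

abbreviation E :: "('k, 'm \<Rightarrow> 'm) module" where "E \<equiv> End_algebra A M"

lemma E_iff: "f \<in> carrier E \<longleftrightarrow> f \<in> carrier M \<rightarrow>\<^sub>E carrier M \<and>
    (\<forall>x \<in> carrier M. \<forall>y \<in> carrier M. f (x \<oplus>\<^bsub>M\<^esub> y) = f x \<oplus>\<^bsub>M\<^esub> f y) \<and>
    (\<forall>a \<in> carrier A. \<forall>x \<in> carrier M. f (a \<odot>\<^bsub>M\<^esub> x) = a \<odot>\<^bsub>M\<^esub> f x)"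
  by (auto simp: End_algebra_def)

lemma E_closed: "f \<in> carrier E \<Longrightarrow> y \<in> carrier M \<Longrightarrow> f y \<in> carrier M"
  by (auto simp: E_iff)

lemma E_eqI: "f \<in> carrier E \<Longrightarrow> g \<in> carrier E \<Longrightarrow> (\<And>y. y \<in> carrier M \<Longrightarrow> f y = g y) \<Longrightarrow> f = g"
  by (rule PiE_ext[of f "carrier M" "\<lambda>_. carrier M"]) (auto simp: E_iff)

lemma E_add: "y \<in> carrier M \<Longrightarrow> (f \<oplus>\<^bsub>E\<^esub> g) y = f y \<oplus>\<^bsub>M\<^esub> g y"
  and E_zero: "y \<in> carrier M \<Longrightarrow> \<zero>\<^bsub>E\<^esub> y = \<zero>\<^bsub>M\<^esub>"
  and E_mult: "y \<in> carrier M \<Longrightarrow> (f \<otimes>\<^bsub>E\<^esub> g) y = f (g y)"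
  and E_one: "y \<in> carrier M \<Longrightarrow> \<one>\<^bsub>E\<^esub> y = y"
  and E_smult: "y \<in> carrier M \<Longrightarrow> (k \<odot>\<^bsub>E\<^esub> f) y = (k \<odot> \<one>) \<odot>\<^bsub>M\<^esub> f y"
  by (simp_all add: End_algebra_def compose_def)

lemma E_add_closed: 
  assumes "f \<in> carrier E" "g \<in> carrier E" shows "f \<oplus>\<^bsub>E\<^esub> g \<in> carrier E"
proof -
  have fg: "f x \<in> carrier M" "g x \<in> carrier M" if "x \<in> carrier M" for x
    using assms E_closed that by auto
  have "f \<oplus>\<^bsub>E\<^esub> g \<in> carrier M \<rightarrow>\<^sub>E carrier M" using fg by (auto simp: End_algebra_def)
  moreover have "(f \<oplus>\<^bsub>E\<^esub> g) (x \<oplus>\<^bsub>M\<^esub> y) = (f \<oplus>\<^bsub>E\<^esub> g) x \<oplus>\<^bsub>M\<^esub> (f \<oplus>\<^bsub>E\<^esub> g) y"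
    if "x \<in> carrier M" "y \<in> carrier M" for x y
    using assms that fg by (simp add: E_add E_iff M.a_ac)
  moreover have "(f \<oplus>\<^bsub>E\<^esub> g) (a \<odot>\<^bsub>M\<^esub> x) = a \<odot>\<^bsub>M\<^esub> (f \<oplus>\<^bsub>E\<^esub> g) x"
    if "x \<in> carrier M" "a \<in> carrier A" for x a
    using assms that fg smult_closed by (simp add: E_add E_iff smult_r_distr)
  ultimately show ?thesis by (simp add: E_iff)
qed

lemma E_zero_closed: "\<zero>\<^bsub>E\<^esub> \<in> carrier E"
proof -
  have "\<zero>\<^bsub>E\<^esub> \<in> carrier M \<rightarrow>\<^sub>E carrier M" by (simp add: End_algebra_def)
  thus ?thesis by (simp add: E_iff E_zero smult_closed smult_zero_right)
qed

lemma E_abelian_monoid: "abelian_monoid E"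
proof (rule abelian_monoidI)
  fix f g h assume fgh: "f \<in> carrier E" "g \<in> carrier E" "h \<in> carrier E"
  show "f \<oplus>\<^bsub>E\<^esub> g \<oplus>\<^bsub>E\<^esub> h = f \<oplus>\<^bsub>E\<^esub> (g \<oplus>\<^bsub>E\<^esub> h)"
    using fgh by (intro E_eqI E_add_closed) (simp_all add: E_add E_closed M.a_assoc)
next
  fix f g assume fg: "f \<in> carrier E" "g \<in> carrier E"
  show "f \<oplus>\<^bsub>E\<^esub> g \<in> carrier E" using fg by (rule E_add_closed)
  show "f \<oplus>\<^bsub>E\<^esub> g = g \<oplus>\<^bsub>E\<^esub> f"
    using fg by (intro E_eqI E_add_closed) (simp_all add: E_add E_closed M.a_comm)
next
  fix f assume f: "f \<in> carrier E"
  show "\<zero>\<^bsub>E\<^esub> \<oplus>\<^bsub>E\<^esub> f = f"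
    using f by (intro E_eqI E_add_closed E_zero_closed) (simp_all add: E_add E_zero E_closed)
qed (rule E_zero_closed)

lemma finsum_E_apply:
  assumes "finite I" "g \<in> I \<rightarrow> carrier E" "y \<in> carrier M"
  shows "(\<Oplus>\<^bsub>E\<^esub>i \<in> I. g i) y = (\<Oplus>\<^bsub>M\<^esub>i \<in> I. g i y)"
  using assms(1,2)
proof (induction I)
  interpret E: abelian_monoid E by (rule E_abelian_monoid)
  case empty
  show ?case using assms(3) by (simp add: E_zero)
next
  interpret E: abelian_monoid E by (rule E_abelian_monoid)
  case (insert i I)
  thus ?case using assms(3)
    by (simp add: E_add E_closed Pi_def)
qed

text \<open>Restricted to the carrier in order to match the normalisation of elements of
  \<open>E\<close>.\<close>

definition mult_by :: "'a \<Rightarrow> 'm \<Rightarrow> 'm" where "mult_by z = (\<lambda>y \<in> carrier M. z \<odot>\<^bsub>M\<^esub> y)"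

text \<open>Centrality of \<open>z\<close> is what makes its action linear over
  \<open>A\<close>.\<close>

lemma mult_by_closed: 
  assumes "z \<in> centre A" shows "mult_by z \<in> carrier E"
  using assms centreD(1) smult_closed centre_commutes_smult
  by (auto simp: E_iff mult_by_def smult_r_distr)

lemma mult_by_pow:
  assumes "z \<in> carrier A" "y \<in> carrier M"
  shows "(mult_by z [^]\<^bsub>E\<^esub> (i::nat)) y = z [^] i \<odot>\<^bsub>M\<^esub> y"
proof -
  have "\<forall>y \<in> carrier M. (mult_by z [^]\<^bsub>E\<^esub> i) y = z [^] i \<odot>\<^bsub>M\<^esub> y"
  proof (induction i)
    case (Suc i)
    have "mult_by z [^]\<^bsub>E\<^esub> Suc i = mult_by z [^]\<^bsub>E\<^esub> i \<otimes>\<^bsub>E\<^esub> mult_by z" by (simp add: nat_pow_def)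
    thus ?case using Suc assms smult_closed
      by (simp add: E_mult smult_assoc) (simp add: mult_by_def smult_closed)
  qed (simp add: nat_pow_def E_one smult_one)
  thus ?thesis using assms by blast
qed

end

context algebra_over
begin

text \<open>Evaluating \<open>p\<close> at the endomorphism given by \<open>z\<close> is the action
  of \<open>p\<close> evaluated at \<open>z\<close>, summand by summand. A polynomial killing that
  endomorphism therefore evaluates at \<open>z\<close> into the annihilator.\<close>

lemma eval_End:
  assumes M: "left_module A M" and z: "z \<in> centre A" and p: "p \<in> carrier (UP K)" and y: "y \<in> carrier M"
  defines "E \<equiv> End_algebra A M"
  shows "eval K E (\<lambda>c. c \<odot>\<^bsub>E\<^esub> \<one>\<^bsub>E\<^esub>) (endomorphisms.mult_by M z) p y
    = eval K (A\<lparr>carrier := centre A\<rparr>) scalar z p \<odot>\<^bsub>M\<^esub> y"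
proof -
  interpret M: endomorphisms A M using M by (simp add: endomorphisms_def)
  interpret P: UP_cring K "UP K" by unfold_locales auto
  let ?c = "coeff (UP K) p"
  let ?g = "\<lambda>i. (?c i \<odot>\<^bsub>E\<^esub> \<one>\<^bsub>E\<^esub>) \<otimes>\<^bsub>E\<^esub> M.mult_by z [^]\<^bsub>E\<^esub> i"
  note sub = subcringE[OF A.centre_subcring]
  have zA: "z \<in> carrier A" using z by (rule M.centreD)
  have c: "?c i \<in> carrier K" for i using P.coeff_closed p by blast
  have pow: "z [^] (i::nat) \<in> centre A" for i
    by (induction i) (use z sub in auto)
  have pow': "z [^]\<^bsub>A\<lparr>carrier := centre A\<rparr>\<^esub> (i::nat) = z [^] i" for i
    by (simp add: nat_pow_def)
  have t: "scalar (?c i) \<otimes> z [^] i \<in> centre A" for i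
    using scalar_centre[OF c] pow sub(6) by blast
  have g: "?g i x = (scalar (?c i) \<otimes> z [^] i) \<odot>\<^bsub>M\<^esub> x" if "x \<in> carrier M" for i x
    using that c zA M.smult_closed
    by (simp add: E_def M.E_mult M.E_smult M.E_one M.mult_by_pow M.smult_assoc)
  \<comment> \<open>Equality as functions includes the points outside \<open>carrier M\<close>,
    where both sides are \<open>undefined\<close>.\<close>
  have g_eq: "?g i = M.mult_by (scalar (?c i) \<otimes> z [^] i)" for i
  proof
    fix x show "?g i x = M.mult_by (scalar (?c i) \<otimes> z [^] i) x"
      using g[of x i] by (cases "x \<in> carrier M") (auto simp: M.mult_by_def E_def End_algebra_def compose_def)
  qed
  have gE: "?g \<in> {..deg K p} \<rightarrow> carrier E"
    unfolding g_eq using M.mult_by_closed[OF t] by (simp add: E_def)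
  have "eval K E (\<lambda>c. c \<odot>\<^bsub>E\<^esub> \<one>\<^bsub>E\<^esub>) (M.mult_by z) p y = (\<Oplus>\<^bsub>E\<^esub>i \<in> {..deg K p}. ?g i) y"
    using p by (simp add: eval_def)
  also have "\<dots> = (\<Oplus>\<^bsub>M\<^esub>i \<in> {..deg K p}. ?g i y)"
    using M.finsum_E_apply[OF _ _ y, of "{..deg K p}" ?g] gE unfolding E_def by blast
  also have "\<dots> = (\<Oplus>\<^bsub>M\<^esub>i \<in> {..deg K p}. (scalar (?c i) \<otimes> z [^] i) \<odot>\<^bsub>M\<^esub> y)"
    using g[OF y] by simp
  also have "\<dots> = (\<Oplus>\<^bsub>A\<lparr>carrier := centre A\<rparr>\<^esub>i \<in> {..deg K p}. scalar (?c i) \<otimes> z [^] i) \<odot>\<^bsub>M\<^esub> y"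
    using M.finsum_centre_smult[of "{..deg K p}" "\<lambda>i. scalar (?c i) \<otimes> z [^] i" y] t y by simp
  also have "\<dots> = eval K (A\<lparr>carrier := centre A\<rparr>) scalar z p \<odot>\<^bsub>M\<^esub> y"
    using p by (simp add: eval_def pow')
  finally show ?thesis .
qed

theorem PLM_algebra_if_End_algebraic:
  fixes T :: "'m itself"
  assumes "field K"
    and alg: "\<And>M :: ('a, 'm) module. simple_module A M \<Longrightarrow>
      algebraic_algebra K (End_algebra A M :: ('k, 'm \<Rightarrow> 'm) module)"
  shows "PLM_algebra T K A"
proof (rule PLM_algebraI)
  fix M :: "('a, 'm) module" and z
  assume M: "simple_left_module A M" and z: "z \<in> centre A" "z \<notin> annihilator A M"
  interpret M: simple_left_module A M by (rule M)
  interpret E: endomorphisms A M by (simp add: endomorphisms_def M.left_module_axioms)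
  define \<psi> where "\<psi> = eval K (A\<lparr>carrier := centre A\<rparr>) scalar z"
  note ev = eval_ring_hom[OF z(1), folded \<psi>_def]
  interpret C: central_polynomials A M K \<psi>
    using ev(1) \<open>field K\<close> M by (simp add: central_polynomials_def central_polynomials_axioms_def)
  have X: "\<psi> C.X = z" using ev(2) by (simp add: C.X_def)
  have "algebraic_algebra K (End_algebra A M :: ('k, 'm \<Rightarrow> 'm) module)"
    using alg M by (simp add: simple_module_iff)
  then obtain p where p: "p \<in> carrier (UP K)" "coeff (UP K) p (deg K p) = \<one>\<^bsub>K\<^esub>"
    "eval K E.E (\<lambda>c. c \<odot>\<^bsub>E.E\<^esub> \<one>\<^bsub>E.E\<^esub>) (E.mult_by z) p = \<zero>\<^bsub>E.E\<^esub>"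
    using E.mult_by_closed[OF z(1)] unfolding algebraic_algebra_def by blast
  have "\<psi> p \<odot>\<^bsub>M\<^esub> y = \<zero>\<^bsub>M\<^esub>" if "y \<in> carrier M" for y
    using eval_End[OF M.left_module_axioms z(1) p(1) that] p(3) that by (simp add: \<psi>_def E.E_zero)
  hence "\<psi> p \<in> annihilator A M" using p(1) by (simp add: annihilator_def)
  \<comment> \<open>A monic polynomial has leading coefficient \<open>1\<close>, so it is not
    zero.\<close>
  moreover have "p \<noteq> \<zero>\<^bsub>UP K\<^esub>" using p(2) C.P.coeff_zero by auto
  ultimately have "\<exists>w \<in> centre A. \<forall>y \<in> carrier M. \<psi> C.X \<odot>\<^bsub>M\<^esub> (w \<odot>\<^bsub>M\<^esub> y) = y"
    using z(2) p(1) by (intro C.algebraic_invertible[of p]) (auto simp: X)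
  thus "\<exists>w \<in> centre A. \<forall>y \<in> carrier M. z \<odot>\<^bsub>M\<^esub> (w \<odot>\<^bsub>M\<^esub> y) = y" by (simp add: X)
qed

end

section \<open>Associated graded algebras\<close>

context algebra_over
begin

lemma minus_telescope:
  assumes "a \<in> carrier A" "b \<in> carrier A" "c \<in> carrier A"
  shows "(a \<ominus> b) \<oplus> (b \<ominus> c) = a \<ominus> c"
proof -
  have "\<ominus> b \<oplus> (b \<oplus> \<ominus> c) = \<ominus> c" using assms by (simp add: A.a_assoc[symmetric] A.l_neg)
  thus ?thesis using assms by (simp add: a_minus_def A.a_assoc)
qed

lemma mem_coset:
  assumes N: "submodule N K A" and x: "x \<in> carrier A"
  shows "y \<in> N +> x \<longleftrightarrow> y \<in> carrier A \<and> y \<ominus> x \<in> N"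
proof
  assume "y \<in> N +> x"
  then obtain h where h: "h \<in> N" "y = h \<oplus> x" by (auto simp: a_r_coset_def')
  moreover have "h \<in> carrier A" using h submodule_facts(1)[OF N] by blast
  ultimately show "y \<in> carrier A \<and> y \<ominus> x \<in> N"
    using x by (simp add: a_minus_def A.a_assoc A.r_neg)
next
  assume y: "y \<in> carrier A \<and> y \<ominus> x \<in> N"
  hence "y = (y \<ominus> x) \<oplus> x" using x by (simp add: a_minus_def A.a_assoc A.l_neg)
  thus "y \<in> N +> x" using y by (auto simp: a_r_coset_def')
qed

lemma coset_self: "submodule N K A \<Longrightarrow> x \<in> carrier A \<Longrightarrow> x \<in> N +> x"
  using submodule_facts(5)[of N] by (simp add: mem_coset A.r_neg a_minus_def)

lemma coset_eq_iff:
  assumes "submodule N K A" "x \<in> carrier A" "y \<in> carrier A"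
  shows "N +> x = N +> y \<longleftrightarrow> x \<ominus> y \<in> N"
proof
  assume "N +> x = N +> y"
  thus "x \<ominus> y \<in> N" using coset_self[OF assms(1,2)] mem_coset[OF assms(1,3)] by blast
next
  assume "x \<ominus> y \<in> N"
  hence "x \<in> N +> y" using mem_coset assms by blast
  thus "N +> x = N +> y"
    using A.a_repr_independence assms(3) submodule.axioms(1)[OF assms(1)] by blast
qed

text \<open>The union in the scalar multiplication of graded and quotient algebras runs over equal
  cosets and hence collapses to one.\<close>

lemma coset_smult:
  assumes N: "submodule N K A" and "c \<in> carrier K" "x \<in> carrier A"
  shows "(\<Union>u \<in> N +> x. N +> (c \<odot> u)) = N +> (c \<odot> x)"
proof -
  have eq: "N +> (c \<odot> u) = N +> (c \<odot> x)" if "u \<in> N +> x" for u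
  proof -
    have u: "u \<in> carrier A" "u \<ominus> x \<in> N" using that mem_coset assms by auto
    hence "c \<odot> (u \<ominus> x) \<in> N" using submodule_facts(3)[OF N] assms by blast
    hence "c \<odot> u \<ominus> c \<odot> x \<in> N"
      using u assms by (simp add: a_minus_def md.smult_r_distr md.smult_r_minus)
    thus ?thesis using coset_eq_iff[OF N] u assms by simp
  qed
  have "(\<Union>u \<in> N +> x. N +> (c \<odot> u)) = (\<Union>u \<in> N +> x. N +> (c \<odot> x))"
    by (intro SUP_cong refl eq)
  also have "\<dots> = N +> (c \<odot> x)" using coset_self[OF N assms(3)] by auto
  finally show ?thesis .
qed

end

section \<open>Components and products in the associated graded algebra\<close>

context filtered_algebra
begin

abbreviation Gr :: "('k, nat \<Rightarrow> 'a set) module" where "Gr \<equiv> associated_graded A F"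
abbreviation Q :: "nat \<Rightarrow> 'a set monoid" where "Q \<equiv> gr_component A F"
abbreviation cs :: "nat \<Rightarrow> 'a \<Rightarrow> 'a set" where "cs k y \<equiv> Fp k +> y"

lemma Fp_abelian_subgroup: "abelian_subgroup (Fp k) A"
  using submodule.axioms(1)[OF Fp_submodule]
  by (intro abelian_subgroupI3 A.abelian_group_axioms additive_subgroup.intro)

lemmas mem_cs = mem_coset[OF Fp_submodule]
  and cs_self = coset_self[OF Fp_submodule]
  and cs_eq_iff = coset_eq_iff[OF Fp_submodule]
  and cs_smult = coset_smult[OF Fp_submodule]

lemma cs_zero: "cs k \<zero> = Fp k"
  using Fp_closed by (auto simp: mem_cs a_minus_def)

lemma cs_add: "x \<in> carrier A \<Longrightarrow> y \<in> carrier A \<Longrightarrow> cs k x <+> cs k y = cs k (x \<oplus> y)"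
proof -
  interpret S: abelian_subgroup "Fp k" A by (rule Fp_abelian_subgroup)
  show "x \<in> carrier A \<Longrightarrow> y \<in> carrier A \<Longrightarrow> cs k x <+> cs k y = cs k (x \<oplus> y)"
    by (rule S.a_rcos_sum)
qed

text \<open>Independence of representatives comes from
  \<open>u v - x y = (u - x) v + x (v - y)\<close>, where each summand has one factor of lower
  degree.\<close>

lemma cs_mult:
  assumes x: "x \<in> F i" and y: "y \<in> F j" and "k = i + j"
  shows "[mod Fp k:] (cs i x) \<Otimes> (cs j y) = cs k (x \<otimes> y)"
proof -
  have xc: "x \<in> carrier A" and yc: "y \<in> carrier A" using x y F_closed by auto
  have eq: "cs k (u \<otimes> v) = cs k (x \<otimes> y)" if u: "u \<in> cs i x" and v: "v \<in> cs j y" for u v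
  proof -
    have u': "u \<in> carrier A" "u \<ominus> x \<in> Fp i" and v': "v \<in> carrier A" "v \<ominus> y \<in> Fp j"
      using u v mem_cs xc yc by auto
    have "v \<ominus> y \<in> F j" using v' Fp_subset_F by blast
    hence "(v \<ominus> y) \<oplus> y \<in> F j" using y submodule_facts(4)[OF F_submodule] by blast
    hence vF: "v \<in> F j" using v' yc by (simp add: a_minus_def A.a_assoc A.l_neg)
    have "u \<otimes> v \<ominus> x \<otimes> y = (u \<ominus> x) \<otimes> v \<oplus> x \<otimes> (v \<ominus> y)"
    proof -
      have "(u \<ominus> x) \<otimes> v = u \<otimes> v \<ominus> x \<otimes> v" "x \<otimes> (v \<ominus> y) = x \<otimes> v \<ominus> x \<otimes> y"
        using u' v' xc yc by (simp_all add: a_minus_def A.l_distr A.r_distr A.l_minus A.r_minus)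
      thus ?thesis using u' v' xc yc minus_telescope[of "u \<otimes> v" "x \<otimes> v" "x \<otimes> y"] by simp
    qed
    moreover have "(u \<ominus> x) \<otimes> v \<in> Fp k" using Fp_mult_F u'(2) vF assms(3) by blast
    moreover have "x \<otimes> (v \<ominus> y) \<in> Fp k" using F_mult_Fp x v'(2) assms(3) by blast
    ultimately have "u \<otimes> v \<ominus> x \<otimes> y \<in> Fp k" using submodule_facts(4)[OF Fp_submodule] by simp
    thus ?thesis using cs_eq_iff u' v' xc yc by simp
  qed
  have "[mod Fp k:] (cs i x) \<Otimes> (cs j y) = (\<Union>u \<in> cs i x. \<Union>v \<in> cs j y. cs k (x \<otimes> y))"
    unfolding rcoset_mult_def by (intro SUP_cong refl eq)
  also have "\<dots> = cs k (x \<otimes> y)" using cs_self[OF xc, of i] cs_self[OF yc, of j] by auto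
  finally show ?thesis .
qed

lemma component_carrier: "carrier (Q k) = cs k ` F k"
  by (auto simp: gr_component_def A_FactGroup_def FactGroup_def RCOSETS_def r_coset_def a_r_coset_def)

lemma component_mult: "X \<otimes>\<^bsub>Q k\<^esub> Y = X <+> Y"
  by (simp add: gr_component_def A_FactGroup_def FactGroup_def set_add_def set_mult_def)

lemma component_one: "\<one>\<^bsub>Q k\<^esub> = Fp k"
  by (simp add: gr_component_def A_FactGroup_def FactGroup_def)

lemma component_comm_group: "comm_group (Q k)"
proof -
  have "module K (A\<lparr>carrier := F k\<rparr>)"
    using submodule.submodule_is_module[OF F_submodule] md.module_axioms by blast
  hence "abelian_group (A\<lparr>carrier := F k\<rparr>)" by (simp add: module_def)
  moreover have "subgroup (Fp k) (add_monoid (A\<lparr>carrier := F k\<rparr>))"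
    using A.add.subgroup_incl[OF submodule.axioms(1)[OF Fp_submodule] submodule.axioms(1)[OF F_submodule] Fp_subset_F]
    by simp
  ultimately have "abelian_subgroup (Fp k) (A\<lparr>carrier := F k\<rparr>)"
    by (intro abelian_subgroupI3 additive_subgroup.intro)
  thus ?thesis unfolding gr_component_def by (rule abelian_subgroup.a_factorgroup_is_comm_group)
qed

text \<open>With \<open>W = F\<close> this is all of \<open>Gr\<close>; with \<open>W = G\<close> it
  is the subalgebra to which finite generation is applied.\<close>

definition gr_part :: "(nat \<Rightarrow> 'a set) \<Rightarrow> (nat \<Rightarrow> 'a set) set" where
  "gr_part W = {g. (\<forall>k. g k \<in> cs k ` W k) \<and> finite {k. g k \<noteq> Fp k}}"

lemma Gr_carrier: "carrier Gr = gr_part F"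
  by (simp add: associated_graded_def gr_part_def component_carrier)

lemma Gr_mult: "(g \<otimes>\<^bsub>Gr\<^esub> h) k = finprod (Q k) (\<lambda>i. [mod Fp k:] (g i) \<Otimes> (h (k - i))) {..k}"
  and Gr_one: "\<one>\<^bsub>Gr\<^esub> = (\<lambda>k. if k = 0 then cs 0 \<one> else Fp k)"
  and Gr_zero: "\<zero>\<^bsub>Gr\<^esub> = Fp"
  and Gr_add: "(g \<oplus>\<^bsub>Gr\<^esub> h) k = g k <+> h k"
  and Gr_smult: "(c \<odot>\<^bsub>Gr\<^esub> g) k = (\<Union>x \<in> g k. Fp k +> (c \<odot> x))"
  by (simp_all add: associated_graded_def)

definition homog :: "nat \<Rightarrow> 'a \<Rightarrow> nat \<Rightarrow> 'a set" where
  "homog i y = (\<lambda>k. if k = i then cs k y else Fp k)"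

lemma Fp_in_cs: "submodule (W k) K A \<Longrightarrow> Fp k \<in> cs k ` W k"
  using submodule_facts(5)[of "W k"] cs_zero[of k] by (metis image_eqI)

lemma homog_closed: "y \<in> F i \<Longrightarrow> homog i y \<in> carrier Gr"
proof -
  assume y: "y \<in> F i"
  have "{k. homog i y k \<noteq> Fp k} \<subseteq> {i}" by (auto simp: homog_def)
  hence "finite {k. homog i y k \<noteq> Fp k}" by (rule finite_subset) simp
  moreover have "homog i y k \<in> cs k ` F k" for k
    using y Fp_in_cs[of F k, OF F_submodule] by (simp add: homog_def)
  ultimately show ?thesis by (simp add: Gr_carrier gr_part_def)
qed

text \<open>In the convolution only the index \<open>i\<close> contributes; every other term has a
  zero class as a factor.\<close>

lemma homog_mult:
  assumes x: "x \<in> F i" and y: "y \<in> F j"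
  shows "(homog i x \<otimes>\<^bsub>Gr\<^esub> homog j y) (i + j) = cs (i + j) (x \<otimes> y)"
proof -
  interpret Q: comm_group "Q (i + j)" by (rule component_comm_group)
  have t: "[mod Fp (i + j):] (homog i x l) \<Otimes> (homog j y (i + j - l)) =
      (if i = l then cs (i + j) (x \<otimes> y) else \<one>\<^bsub>Q (i + j)\<^esub>)" if l: "l \<in> {..i + j}" for l
  proof (cases "l = i")
    case True
    thus ?thesis using cs_mult[OF x y] by (simp add: homog_def)
  next
    case False
    obtain v where v: "v \<in> F (i + j - l)" "homog j y (i + j - l) = cs (i + j - l) v"
      using homog_closed[OF y] by (auto simp: Gr_carrier gr_part_def)
    have "[mod Fp (i + j):] (cs l \<zero>) \<Otimes> (cs (i + j - l) v) = cs (i + j) (\<zero> \<otimes> v)"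
      using l submodule_facts(5)[OF F_submodule] by (intro cs_mult v) auto
    thus ?thesis using False v F_closed[OF v(1)] by (simp add: homog_def cs_zero component_one)
  qed
  have xy: "cs (i + j) (x \<otimes> y) \<in> carrier (Q (i + j))" using F_mult[OF x y] by (simp add: component_carrier)
  have "(homog i x \<otimes>\<^bsub>Gr\<^esub> homog j y) (i + j) =
      finprod (Q (i + j)) (\<lambda>l. if i = l then cs (i + j) (x \<otimes> y) else \<one>\<^bsub>Q (i + j)\<^esub>) {..i + j}"
    unfolding Gr_mult using t xy by (intro Q.finprod_cong') auto
  also have "\<dots> = cs (i + j) (x \<otimes> y)"
    using Q.finprod_singleton[of i "{..i + j}" "\<lambda>_. cs (i + j) (x \<otimes> y)"] xy by simp
  finally show ?thesis .
qed

text \<open>Compare the components of degree \<open>i + j\<close> of the two products of homogeneous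
  classes.\<close>

lemma almost_commutative:
  assumes "commutative_algebra Gr" "x \<in> F i" "y \<in> F j"
  shows "x \<otimes> y \<ominus> y \<otimes> x \<in> Fp (i + j)"
proof -
  have "homog i x \<otimes>\<^bsub>Gr\<^esub> homog j y = homog j y \<otimes>\<^bsub>Gr\<^esub> homog i x"
    using assms homog_closed by (simp add: commutative_algebra_def)
  hence "cs (i + j) (x \<otimes> y) = cs (i + j) (y \<otimes> x)"
    using homog_mult[OF assms(2,3)] homog_mult[OF assms(3,2)] by (simp add: add.commute)
  thus ?thesis using cs_eq_iff F_closed assms(2,3) by simp
qed

section \<open>Graded subalgebras given by multiplicative families of subspaces\<close>

context
  fixes W :: "nat \<Rightarrow> 'a set"
  assumes W: "\<And>k. submodule (W k) K A" "\<And>k. W k \<subseteq> F k" "\<one> \<in> W 0"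
    "\<And>i j x y. x \<in> W i \<Longrightarrow> y \<in> W j \<Longrightarrow> x \<otimes> y \<in> W (i + j)"
begin

lemma W_carrier: "x \<in> W k \<Longrightarrow> x \<in> carrier A"
  using W(2) F_closed by blast

lemma gr_partE:
  assumes "g \<in> gr_part W"
  obtains u where "\<And>k. u k \<in> W k" "\<And>k. g k = cs k (u k)"
  using assms unfolding gr_part_def by (simp add: image_iff) metis

lemma gr_partI:
  assumes "\<And>k. g k \<in> cs k ` W k" "{k. g k \<noteq> Fp k} \<subseteq> S" "finite S"
  shows "g \<in> gr_part W"
  using assms finite_subset by (auto simp: gr_part_def)

lemma gr_part_finite: "g \<in> gr_part W \<Longrightarrow> finite {k. g k \<noteq> Fp k}"
  by (simp add: gr_part_def)

lemma gr_part_bounded: "g \<in> gr_part W \<Longrightarrow> \<exists>N. \<forall>k>N. g k = Fp k"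
  using gr_part_finite[of g] unfolding finite_nat_set_iff_bounded_le by (auto simp: not_le[symmetric])

lemma gr_part_sub: "gr_part W \<subseteq> carrier Gr"
  using W(2) by (fastforce simp: Gr_carrier gr_part_def)

lemma gr_part_zero: "\<zero>\<^bsub>Gr\<^esub> \<in> gr_part W"
  using Fp_in_cs W(1) by (intro gr_partI[of _ "{}"]) (auto simp: Gr_zero)

lemma gr_part_one: "\<one>\<^bsub>Gr\<^esub> \<in> gr_part W"
  using Fp_in_cs[OF W(1)] W(3) by (intro gr_partI[of _ "{0}"]) (auto simp: Gr_one)

lemma gr_part_add:
  assumes "g \<in> gr_part W" "h \<in> gr_part W" shows "g \<oplus>\<^bsub>Gr\<^esub> h \<in> gr_part W"
proof -
  obtain u where u: "\<And>k. u k \<in> W k" "\<And>k. g k = cs k (u k)" using assms gr_partE by blast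
  obtain v where v: "\<And>k. v k \<in> W k" "\<And>k. h k = cs k (v k)" using assms gr_partE by blast
  have s: "(g \<oplus>\<^bsub>Gr\<^esub> h) k = cs k (u k \<oplus> v k)" for k
    unfolding Gr_add u(2) v(2) by (intro cs_add W_carrier[OF u(1)] W_carrier[OF v(1)])
  show ?thesis
  proof (rule gr_partI)
    show "(g \<oplus>\<^bsub>Gr\<^esub> h) k \<in> cs k ` W k" for k
      using s u v submodule_facts(4)[OF W(1)] by blast
    show "{k. (g \<oplus>\<^bsub>Gr\<^esub> h) k \<noteq> Fp k} \<subseteq> {k. g k \<noteq> Fp k} \<union> {k. h k \<noteq> Fp k}"
      using cs_add[of \<zero> \<zero>] by (auto simp: Gr_add cs_zero)
  qed (use assms gr_part_finite in auto)
qed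

lemma gr_part_smult:
  assumes "g \<in> gr_part W" "c \<in> carrier K" shows "c \<odot>\<^bsub>Gr\<^esub> g \<in> gr_part W"
proof -
  obtain u where u: "\<And>k. u k \<in> W k" "\<And>k. g k = cs k (u k)" using assms gr_partE by blast
  have s: "(c \<odot>\<^bsub>Gr\<^esub> g) k = cs k (c \<odot> u k)" for k
    unfolding Gr_smult u(2) by (intro cs_smult assms W_carrier[OF u(1)])
  show ?thesis
  proof (rule gr_partI)
    show "(c \<odot>\<^bsub>Gr\<^esub> g) k \<in> cs k ` W k" for k
      using s u assms submodule_facts(3)[OF W(1)] by blast
    show "{k. (c \<odot>\<^bsub>Gr\<^esub> g) k \<noteq> Fp k} \<subseteq> {k. g k \<noteq> Fp k}"
      using cs_smult[OF assms(2) A.zero_closed] assms(2) by (auto simp: Gr_smult cs_zero)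
  qed (use assms gr_part_finite in auto)
qed

text \<open>Choose representatives in \<open>W\<close>; each convolution term is then the class of a
  product, which stays in \<open>W\<close>. Beyond the sum of the two degree bounds every term has a
  zero factor.\<close>

lemma gr_part_mult:
  assumes "g \<in> gr_part W" "h \<in> gr_part W" shows "g \<otimes>\<^bsub>Gr\<^esub> h \<in> gr_part W"
proof -
  obtain u where u: "\<And>k. u k \<in> W k" "\<And>k. g k = cs k (u k)" using assms gr_partE by blast
  obtain v where v: "\<And>k. v k \<in> W k" "\<And>k. h k = cs k (v k)" using assms gr_partE by blast
  have t: "[mod Fp k:] (g i) \<Otimes> (h (k - i)) = cs k (u i \<otimes> v (k - i))" if "i \<le> k" for i k
    unfolding u(2) v(2) using u(1) v(1) W(2) that by (intro cs_mult) auto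
  have tW: "u i \<otimes> v (k - i) \<in> W k" if "i \<le> k" for i k
    using W(4)[OF u(1)[of i] v(1)[of "k - i"]] that by simp
  \<comment> \<open>Stated for every finite index set within \<open>{..k}\<close> so that indices
    can be inserted one by one.\<close>
  have prod: "finprod (Q k) (\<lambda>i. [mod Fp k:] (g i) \<Otimes> (h (k - i))) I \<in> cs k ` W k"
    if "finite I" "I \<subseteq> {..k}" for I k
    using that
  proof (induction I)
    interpret Q: comm_group "Q k" by (rule component_comm_group)
    case empty
    show ?case using Fp_in_cs[OF W(1)] by (simp add: component_one)
  next
    interpret Q: comm_group "Q k" by (rule component_comm_group)
    case (insert i I)
    have ik: "i \<le> k" using insert by simp
    have cl: "[mod Fp k:] (g i) \<Otimes> (h (k - i)) \<in> carrier (Q k)" if "i \<le> k" for i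
      using t[OF that] tW[OF that] W(2) by (auto simp: component_carrier)
    obtain w where w: "w \<in> W k" "finprod (Q k) (\<lambda>i. [mod Fp k:] (g i) \<Otimes> (h (k - i))) I = cs k w"
      using insert by auto
    have "finprod (Q k) (\<lambda>i. [mod Fp k:] (g i) \<Otimes> (h (k - i))) (insert i I) =
        [mod Fp k:] (g i) \<Otimes> (h (k - i)) \<otimes>\<^bsub>Q k\<^esub> finprod (Q k) (\<lambda>i. [mod Fp k:] (g i) \<Otimes> (h (k - i))) I"
      using insert cl by (intro Q.finprod_insert) auto
    also have "\<dots> = cs k (u i \<otimes> v (k - i) \<oplus> w)"
      unfolding component_mult w(2) t[OF ik] using tW[OF ik] w(1) W_carrier by (intro cs_add) auto
    finally show ?case using tW[OF ik] w(1) submodule_facts(4)[OF W(1)] by blast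
  qed
  obtain N1 where N1: "\<And>k. k > N1 \<Longrightarrow> g k = Fp k" using gr_part_bounded[OF assms(1)] by blast
  obtain N2 where N2: "\<And>k. k > N2 \<Longrightarrow> h k = Fp k" using gr_part_bounded[OF assms(2)] by blast
  have zero: "(g \<otimes>\<^bsub>Gr\<^esub> h) k = Fp k" if k: "k > N1 + N2" for k
  proof -
    interpret Q: comm_group "Q k" by (rule component_comm_group)
    have "[mod Fp k:] (g i) \<Otimes> (h (k - i)) = \<one>\<^bsub>Q k\<^esub>" if i: "i \<le> k" for i
    proof (cases "i > N1")
      case True
      have "[mod Fp k:] (cs i \<zero>) \<Otimes> (cs (k - i) (v (k - i))) = cs k (\<zero> \<otimes> v (k - i))"
        using i subsetD[OF W(2) v(1)] submodule_facts(5)[OF F_submodule] by (intro cs_mult) auto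
      thus ?thesis using N1[OF True] v(2) W_carrier[OF v(1)] by (simp add: cs_zero component_one)
    next
      case False
      hence "h (k - i) = Fp (k - i)" using k N2 by simp
      moreover have "[mod Fp k:] (cs i (u i)) \<Otimes> (cs (k - i) \<zero>) = cs k (u i \<otimes> \<zero>)"
        using i subsetD[OF W(2) u(1)] submodule_facts(5)[OF F_submodule] by (intro cs_mult) auto
      ultimately show ?thesis using u(2) W_carrier[OF u(1)] by (simp add: cs_zero component_one)
    qed
    thus ?thesis unfolding Gr_mult component_one[symmetric] by (intro Q.finprod_one_eqI) simp
  qed
  show ?thesis
  proof (rule gr_partI)
    show "(g \<otimes>\<^bsub>Gr\<^esub> h) k \<in> cs k ` W k" for k unfolding Gr_mult by (rule prod) auto
    show "{k. (g \<otimes>\<^bsub>Gr\<^esub> h) k \<noteq> Fp k} \<subseteq> {..N1 + N2}" using zero by (auto simp: not_less[symmetric])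
  qed simp
qed

text \<open>The inverse is a definite description and \<open>Gr\<close> has not been shown to be a
  group, so existence and uniqueness are both checked componentwise.\<close>

lemma gr_part_inv:
  assumes "g \<in> gr_part W" shows "inv\<^bsub>add_monoid Gr\<^esub> g \<in> gr_part W"
proof -
  obtain u where u: "\<And>k. u k \<in> W k" "\<And>k. g k = cs k (u k)" using assms gr_partE by blast
  define h where "h = (\<lambda>k. cs k (\<ominus> u k))"
  have uc: "u k \<in> carrier A" for k using u W_carrier by blast
  have hW: "h \<in> gr_part W"
  proof (rule gr_partI)
    show "h k \<in> cs k ` W k" for k using u submodule_facts(2)[OF W(1)] by (auto simp: h_def)
    show "{k. h k \<noteq> Fp k} \<subseteq> {k. g k \<noteq> Fp k}"
    proof clarify
      fix k assume hk: "h k \<noteq> Fp k" and "g k = Fp k"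
      hence "u k \<in> Fp k" using u(2)[of k] cs_self[OF uc[of k], of k] by simp
      hence "\<ominus> u k \<in> Fp k" using submodule_facts(2)[OF Fp_submodule] by blast
      hence "h k = cs k \<zero>" using cs_eq_iff[of "\<ominus> u k" \<zero> k] uc by (simp add: h_def a_minus_def)
      thus False using hk cs_zero by simp
    qed
  qed (rule gr_part_finite[OF assms])
  have "inv\<^bsub>add_monoid Gr\<^esub> g = h" unfolding m_inv_def
  proof (rule the_equality)
    show "h \<in> carrier (add_monoid Gr) \<and> g \<otimes>\<^bsub>add_monoid Gr\<^esub> h = \<one>\<^bsub>add_monoid Gr\<^esub> \<and>
        h \<otimes>\<^bsub>add_monoid Gr\<^esub> g = \<one>\<^bsub>add_monoid Gr\<^esub>"
      using hW gr_part_sub uc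
      by (auto simp: h_def u(2) Gr_add Gr_zero cs_add A.r_neg A.l_neg cs_zero fun_eq_iff)
    fix y assume y: "y \<in> carrier (add_monoid Gr) \<and> g \<otimes>\<^bsub>add_monoid Gr\<^esub> y = \<one>\<^bsub>add_monoid Gr\<^esub> \<and>
        y \<otimes>\<^bsub>add_monoid Gr\<^esub> g = \<one>\<^bsub>add_monoid Gr\<^esub>"
    show "y = h"
    proof
      fix k
      obtain v where v: "v \<in> F k" "y k = cs k v" using y by (auto simp: Gr_carrier gr_part_def)
      have vc: "v \<in> carrier A" using v F_closed by blast
      have "y \<oplus>\<^bsub>Gr\<^esub> g = Fp" using y by (simp add: Gr_zero)
      hence "cs k (v \<oplus> u k) = Fp k" using Gr_add[of y g k] v vc uc u(2) by (simp add: cs_add)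
      hence "v \<ominus> (\<ominus> u k) \<in> Fp k" using cs_self[of "v \<oplus> u k" k] vc uc by (simp add: a_minus_def)
      thus "y k = h k" using cs_eq_iff vc uc v by (simp add: h_def)
    qed
  qed
  thus ?thesis using hW by simp
qed

lemma gr_part_subgroup: "subgroup (gr_part W) (add_monoid Gr)"
  using gr_part_sub gr_part_zero gr_part_add gr_part_inv by (intro subgroup.intro) auto

lemma gr_part_subring: "subring (gr_part W) Gr"
  using gr_part_subgroup gr_part_sub gr_part_one gr_part_mult
  by (intro subring.intro submonoid.intro) auto

lemma gr_part_submodule: "submodule (gr_part W) K Gr"
  using gr_part_subgroup gr_part_smult by (intro submodule.intro submodule_axioms.intro) auto

end

end

section \<open>From generators of the graded algebra to ordered monomials in their lifts\<close>

context filtered_generators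
begin

lemma mon_mult_G:
  "m \<le> n \<Longrightarrow> u \<in> G j \<Longrightarrow> mon m a \<otimes> u \<in> G (weight d m a + j)"
proof (induction m arbitrary: u j)
  case 0
  thus ?case using submodule_facts(1)[OF G_submodule, of j] by (auto simp: weight_def)
next
  case (Suc m)
  have m: "m < n" using Suc by simp
  have uc: "u \<in> carrier A" using Suc(3) submodule_facts(1)[OF G_submodule] by blast
  have p: "x m [^] (p::nat) \<otimes> u \<in> G (p * d m + j)" for p
  proof (induction p)
    case 0
    thus ?case using Suc(3) uc by simp
  next
    case (Suc p)
    have "x m [^] Suc p \<otimes> u = x m \<otimes> (x m [^] p \<otimes> u)"
      using A.nat_pow_Suc2[OF x_closed[OF m]] uc x_closed[OF m] by (simp add: A.m_assoc del: A.nat_pow_Suc)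
    thus ?case using x_mult_G[OF m Suc] by (simp add: add.assoc)
  qed
  have "mon (Suc m) a \<otimes> u = mon m a \<otimes> (x m [^] a m \<otimes> u)"
    using mon_closed[of m a] m uc x_closed[OF m] by (simp add: A.m_assoc)
  thus ?case using Suc(1)[OF _ p] m by (simp add: weight_def add.assoc)
qed

text \<open>Linearity in \<open>u\<close> reduces to monomials, treated letter by letter, and to
  \<open>Fp i\<close>, where \<open>v \<in> F j\<close> already puts the product in lower
  degree.\<close>

lemma G_mult:
  assumes "u \<in> G i" "v \<in> G j" shows "u \<otimes> v \<in> G (i + j)"
proof -
  have v: "v \<in> carrier A" "v \<in> F j" using assms submodule_facts(1)[OF G_submodule] G_F by auto
  have "G i \<subseteq> {u \<in> carrier A. u \<otimes> v \<in> G (i + j)}"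
  proof (rule G_least)
    show "submodule {u \<in> carrier A. u \<otimes> v \<in> G (i + j)} K A"
      by (rule submodule_vimage_mult(2)[OF G_submodule v(1)])
    show "Fp i \<subseteq> {u \<in> carrier A. u \<otimes> v \<in> G (i + j)}"
      using Fp_mult_F[OF _ v(2)] Fp_G Fp_closed by blast
    fix a assume "a \<in> exponents n" "weight d n a \<le> i"
    thus "mon n a \<in> {u \<in> carrier A. u \<otimes> v \<in> G (i + j)}"
      using mon_mult_G[OF order_refl assms(2), of a] G_mono[of "weight d n a + j" "i + j"] mon_closed by auto
  qed
  thus ?thesis using assms by blast
qed

lemma one_G: "\<one> \<in> G 0"
  using G_mon[of "\<lambda>_. 0" 0] by (simp add: exponents_def weight_def mon_zero)

lemma x_G: 
  assumes "i < n" shows "x i \<in> G (d i)"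
  using x_mult_G[OF assms one_G] x_closed[OF assms] by simp

text \<open>The classes of \<open>G\<close> form a subalgebra containing the generators, hence all
  of \<open>Gr\<close>. In degree \<open>k\<close> this says \<open>F k = G k\<close> modulo
  \<open>F (k - 1)\<close>, and \<open>G k\<close> contains \<open>F (k - 1)\<close>.\<close>

lemma F_subset_G:
  assumes gen: "\<And>B. subring B Gr \<Longrightarrow> submodule B K Gr \<Longrightarrow> S \<subseteq> B \<Longrightarrow> B = carrier Gr"
    and S: "S \<subseteq> carrier Gr"
    and cover: "\<And>s k. s \<in> S \<Longrightarrow> s k \<noteq> Fp k \<Longrightarrow> \<exists>i<n. d i = k \<and> s k = cs k (x i)"
  shows "F k \<subseteq> G k"
proof
  fix y assume y: "y \<in> F k"
  have sk: "s k \<in> cs k ` G k" if s: "s \<in> S" for s k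
  proof (cases "s k = Fp k")
    case True
    thus ?thesis using Fp_in_cs[of G k, OF G_submodule] by simp
  next
    case False
    then obtain i where "i < n" "d i = k" "s k = cs k (x i)" using cover[OF s] by blast
    thus ?thesis using x_G by blast
  qed
  have "S \<subseteq> gr_part G" using sk S by (auto simp: gr_part_def Gr_carrier)
  hence "gr_part G = carrier Gr"
    using gr_part_subring[of G] gr_part_submodule[of G] G_submodule G_F one_G G_mult by (intro gen) auto
  hence "homog k y \<in> gr_part G" using homog_closed[OF y] by simp
  hence "cs k y \<in> cs k ` G k" by (auto simp: gr_part_def homog_def split: if_splits dest: spec[of _ k])
  then obtain u where u: "u \<in> G k" "cs k y = cs k u" by auto
  have "u \<in> carrier A" "y \<in> carrier A" using u(1) y F_closed G_F[of k] by blast+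
  hence "y \<ominus> u \<in> Fp k" using u cs_eq_iff by blast
  hence "(y \<ominus> u) \<oplus> u \<in> G k" using u Fp_G submodule_facts(4)[OF G_submodule] by blast
  thus "y \<in> G k" using \<open>u \<in> carrier A\<close> \<open>y \<in> carrier A\<close> by (simp add: a_minus_def A.a_assoc A.l_neg)
qed

end

theorem (in filtered_algebra) PLM_algebra_if_graded_commutative:
  fixes T :: "'m itself"
  assumes "field K" and comm: "commutative_algebra Gr" and fg: "finitely_generated_algebra K Gr"
  shows "PLM_algebra T K A"
proof -
  obtain S where S: "finite S" "S \<subseteq> carrier Gr"
    "\<And>B. subring B Gr \<Longrightarrow> submodule B K Gr \<Longrightarrow> S \<subseteq> B \<Longrightarrow> B = carrier Gr"
    using fg unfolding finitely_generated_algebra_def by blast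
  define rep where "rep s k = (SOME y. y \<in> F k \<and> s k = cs k y)" for s k
  have rep: "rep s k \<in> F k" "s k = cs k (rep s k)" if "s \<in> S" for s k
  proof -
    have "s k \<in> cs k ` F k" using that S(2) by (auto simp: Gr_carrier gr_part_def)
    hence "\<exists>y. y \<in> F k \<and> s k = cs k y" by blast
    hence "rep s k \<in> F k \<and> s k = cs k (rep s k)" unfolding rep_def by (rule someI_ex)
    thus "rep s k \<in> F k" "s k = cs k (rep s k)" by auto
  qed
  \<comment> \<open>The generators need not be homogeneous, so each is split into its nonzero
    components. A lift is stored with its degree, which the element alone does not
    determine.\<close>
  define P where "P = (\<Union>s \<in> S. (\<lambda>k. (k, rep s k)) ` {k. s k \<noteq> Fp k})"
  have "finite P" unfolding P_def using S(1,2) by (auto simp: Gr_carrier gr_part_def)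
  then obtain ps where ps: "set ps = P" using finite_list by blast
  have P: "y \<in> F k" if "(k, y) \<in> P" for k y using that rep by (auto simp: P_def)
  interpret G: filtered_generators K A F "length ps" "\<lambda>i. snd (ps ! i)" "\<lambda>i. fst (ps ! i)"
  proof (unfold_locales)
    fix i assume "i < length ps"
    hence "(fst (ps ! i), snd (ps ! i)) \<in> P" using ps nth_mem by fastforce
    thus *: "snd (ps ! i) \<in> F (fst (ps ! i))" by (rule P)
    show "snd (ps ! i) \<otimes> y \<ominus> y \<otimes> snd (ps ! i) \<in> Fp (fst (ps ! i) + j)" if "y \<in> F j" for y j
      using almost_commutative[OF comm * that] .
  qed
  have "F k \<subseteq> G.G k" for k
  proof (rule G.F_subset_G[OF S(3) S(2)])
    fix s k assume s: "s \<in> S" "s k \<noteq> Fp k"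
    hence "(k, rep s k) \<in> set ps" unfolding ps P_def by blast
    then obtain i where "i < length ps" "ps ! i = (k, rep s k)" by (meson in_set_conv_nth)
    thus "\<exists>i<length ps. fst (ps ! i) = k \<and> s k = cs k (snd (ps ! i))" using rep[OF s(1)] by auto
  qed
  thus ?thesis by (intro G.PLM_algebra assms)
qed

section \<open>Algebras generated by a Lie algebra\<close>

text \<open>The features of the enveloping algebra used below: \<open>j\<close> is linear, respects
  brackets, and its products span. \<open>j\<close> may have a kernel.\<close>

locale lie_generated = algebra_over K U
  for K :: "('k, 'x) ring_scheme" and U :: "('k, 'u, 's) module_scheme" (structure) +
  fixes L :: "('k, 'g, 't) module_scheme" and br :: "'g \<Rightarrow> 'g \<Rightarrow> 'g" and j :: "'g \<Rightarrow> 'u"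
  assumes L_module: "module K L"
    and br_closed: "y \<in> carrier L \<Longrightarrow> z \<in> carrier L \<Longrightarrow> br y z \<in> carrier L"
    and j_closed: "y \<in> carrier L \<Longrightarrow> j y \<in> carrier U"
    and j_add: "y \<in> carrier L \<Longrightarrow> z \<in> carrier L \<Longrightarrow> j (y \<oplus>\<^bsub>L\<^esub> z) = j y \<oplus> j z"
    and j_smult: "k \<in> carrier K \<Longrightarrow> y \<in> carrier L \<Longrightarrow> j (k \<odot>\<^bsub>L\<^esub> y) = k \<odot> j y"
    and j_br: "y \<in> carrier L \<Longrightarrow> z \<in> carrier L \<Longrightarrow> j (br y z) = j y \<otimes> j z \<ominus> j z \<otimes> j y"
    and spanned: "submodule W K U \<Longrightarrow> (\<And>w. w \<in> lists (carrier L) \<Longrightarrow> foldr (\<lambda>y u. j y \<otimes> u) w \<one> \<in> W) \<Longrightarrow>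
      carrier U \<subseteq> W"
begin

sublocale L: module K L by (rule L_module)

definition wd :: "'g list \<Rightarrow> 'u" where "wd w = foldr (\<lambda>y u. j y \<otimes> u) w \<one>"

lemma wd_Nil [simp]: "wd [] = \<one>" and wd_Cons [simp]: "wd (y # w) = j y \<otimes> wd w"
  by (simp_all add: wd_def)

lemma wd_closed: "w \<in> lists (carrier L) \<Longrightarrow> wd w \<in> carrier U"
  by (induction w) (auto simp: j_closed)

lemma wd_append: "v \<in> lists (carrier L) \<Longrightarrow> w \<in> lists (carrier L) \<Longrightarrow> wd (v @ w) = wd v \<otimes> wd w"
  by (induction v) (auto simp: j_closed wd_closed A.m_assoc)

definition words :: "nat \<Rightarrow> 'u set" where
  "words k = kspan {wd w | w. w \<in> lists (carrier L) \<and> length w \<le> k}"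

lemma words_submodule: "submodule (words k) K U"
  unfolding words_def by (rule kspan_submodule) (use wd_closed in blast)

lemma wd_words: "w \<in> lists (carrier L) \<Longrightarrow> length w \<le> k \<Longrightarrow> wd w \<in> words k"
  unfolding words_def by (rule kspan_base) blast

lemma words_least:
  assumes "submodule W K U" "\<And>w. w \<in> lists (carrier L) \<Longrightarrow> length w \<le> k \<Longrightarrow> wd w \<in> W"
  shows "words k \<subseteq> W"
  unfolding words_def by (rule kspan_least) (use assms in auto)

lemma words_closed: "u \<in> words k \<Longrightarrow> u \<in> carrier U"
  using submodule_facts(1)[OF words_submodule] by blast

lemma words_mono: "i \<le> k \<Longrightarrow> words i \<subseteq> words k"
  by (intro words_least words_submodule wd_words) auto

text \<open>Bilinear extension of concatenation in two stages: a word times the span, then the span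
  times a fixed element.\<close>

lemma words_mult:
  assumes "u \<in> words i" "v \<in> words k" shows "u \<otimes> v \<in> words (i + k)"
proof -
  have 1: "words k \<subseteq> {v \<in> carrier U. wd w \<otimes> v \<in> words (i + k)}"
    if "w \<in> lists (carrier L)" "length w \<le> i" for w
  proof (rule words_least)
    show "submodule {v \<in> carrier U. wd w \<otimes> v \<in> words (i + k)} K U"
      by (rule submodule_vimage_mult(1)[OF words_submodule wd_closed[OF that(1)]])
    show "wd w' \<in> {v \<in> carrier U. wd w \<otimes> v \<in> words (i + k)}"
      if w': "w' \<in> lists (carrier L)" "length w' \<le> k" for w'
      using that w' \<open>w \<in> _\<close> \<open>length w \<le> i\<close> wd_words[of "w @ w'" "i + k"]
      by (simp add: wd_closed wd_append)
  qed
  have "words i \<subseteq> {u \<in> carrier U. u \<otimes> v \<in> words (i + k)}"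
  proof (rule words_least)
    show "submodule {u \<in> carrier U. u \<otimes> v \<in> words (i + k)} K U"
      by (rule submodule_vimage_mult(2)[OF words_submodule words_closed[OF assms(2)]])
    show "wd w \<in> {u \<in> carrier U. u \<otimes> v \<in> words (i + k)}"
      if "w \<in> lists (carrier L)" "length w \<le> i" for w
      using 1[OF that] assms(2) wd_closed[OF that(1)] by auto
  qed
  thus ?thesis using assms(1) by blast
qed

lemma words_exhaust: "carrier U = (\<Union>i. words i)"
proof
  have "submodule (\<Union>i. words i) K U"
  proof (rule md.subspace_intro)
    fix y z assume "y \<in> (\<Union>i. words i)" "z \<in> (\<Union>i. words i)"
    then obtain i k where "y \<in> words i" "z \<in> words k" by blast
    hence "y \<in> words (i + k)" "z \<in> words (i + k)" using words_mono[of i "i + k"] words_mono[of k "i + k"] by auto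
    thus "y \<oplus> z \<in> (\<Union>i. words i)" using submodule_facts(4)[OF words_submodule] by blast
  next
    show "(\<Union>i. words i) \<subseteq> carrier U" using words_closed by blast
    show "\<zero> \<in> (\<Union>i. words i)" using submodule_facts(5)[OF words_submodule] by blast
    show "c \<odot> y \<in> (\<Union>i. words i)" if "c \<in> carrier K" "y \<in> (\<Union>i. words i)" for c y
      using that submodule_facts(3)[OF words_submodule] by blast
  qed
  thus "carrier U \<subseteq> (\<Union>i. words i)"
  proof (rule spanned)
    show "foldr (\<lambda>y u. j y \<otimes> u) w \<one> \<in> (\<Union>i. words i)" if "w \<in> lists (carrier L)" for w
      using wd_words[OF that order_refl] unfolding wd_def by blast
  qed
qed (use words_closed in blast)

lemma words_filtration: "filtration K U words"
proof -
  have "words i \<subseteq> words (Suc i)" for i by (rule words_mono) simp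
  moreover have "\<one> \<in> words 0" using wd_words[of "[]" 0] by simp
  ultimately show ?thesis
    unfolding filtration_def using words_submodule words_exhaust words_mult by blast
qed

text \<open>The commutator with \<open>j y\<close> is a derivation that sends a letter to a single
  letter, its bracket with \<open>y\<close>. So words do not get longer, although a product with
  \<open>j y\<close> does.\<close>

lemma words_commute:
  assumes y: "y \<in> carrier L" and u: "u \<in> words k"
  shows "j y \<otimes> u \<ominus> u \<otimes> j y \<in> words k"
proof -
  note jy = j_closed[OF y]
  have 1: "j y \<otimes> wd w \<ominus> wd w \<otimes> j y \<in> words (length w)" if "w \<in> lists (carrier L)" for w
    using that
  proof (induction w)
    case Nil
    thus ?case using jy submodule_facts(5)[OF words_submodule] by (simp add: a_minus_def A.r_neg)
  next
    case (Cons z w)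
    hence z: "z \<in> carrier L" and w: "w \<in> lists (carrier L)" by auto
    note cl = jy j_closed[OF z] wd_closed[OF w]
    have jz: "j z \<in> words 1" using wd_words[of "[z]" 1] z cl by simp
    have jb: "j (br y z) \<in> words 1" using wd_words[of "[br y z]" 1] br_closed[OF y z] j_closed by simp
    have "j (br y z) \<otimes> wd w = j y \<otimes> (j z \<otimes> wd w) \<ominus> j z \<otimes> (j y \<otimes> wd w)"
      unfolding j_br[OF y z] using cl by (simp add: a_minus_def A.l_distr A.l_minus A.m_assoc)
    moreover have "j z \<otimes> (j y \<otimes> wd w \<ominus> wd w \<otimes> j y) = j z \<otimes> (j y \<otimes> wd w) \<ominus> (j z \<otimes> wd w) \<otimes> j y"
      using cl by (simp add: a_minus_def A.r_distr A.r_minus A.m_assoc)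
    ultimately have "j y \<otimes> wd (z # w) \<ominus> wd (z # w) \<otimes> j y =
        j (br y z) \<otimes> wd w \<oplus> j z \<otimes> (j y \<otimes> wd w \<ominus> wd w \<otimes> j y)"
      using cl minus_telescope[of "j y \<otimes> (j z \<otimes> wd w)" "j z \<otimes> (j y \<otimes> wd w)" "(j z \<otimes> wd w) \<otimes> j y"] by simp
    moreover have "j (br y z) \<otimes> wd w \<in> words (1 + length w)"
      using words_mult[OF jb wd_words[OF w order_refl]] .
    moreover have "j z \<otimes> (j y \<otimes> wd w \<ominus> wd w \<otimes> j y) \<in> words (1 + length w)"
      using words_mult[OF jz Cons.IH] .
    ultimately show ?case using submodule_facts(4)[OF words_submodule] by simp
  qed
  have "words k \<subseteq> {u \<in> carrier U. j y \<otimes> u \<ominus> u \<otimes> j y \<in> words k}"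
  proof (rule words_least)
    show "submodule {u \<in> carrier U. j y \<otimes> u \<ominus> u \<otimes> j y \<in> words k} K U"
    proof (rule md.subspace_intro)
      show "\<zero> \<in> {u \<in> carrier U. j y \<otimes> u \<ominus> u \<otimes> j y \<in> words k}"
        using jy submodule_facts(5)[OF words_submodule] by (simp add: a_minus_def)
      fix u v assume uv: "u \<in> {u \<in> carrier U. j y \<otimes> u \<ominus> u \<otimes> j y \<in> words k}"
        "v \<in> {u \<in> carrier U. j y \<otimes> u \<ominus> u \<otimes> j y \<in> words k}"
      have "j y \<otimes> (u \<oplus> v) \<ominus> (u \<oplus> v) \<otimes> j y = (j y \<otimes> u \<ominus> u \<otimes> j y) \<oplus> (j y \<otimes> v \<ominus> v \<otimes> j y)"
        using uv jy by (simp add: a_minus_def A.l_distr A.r_distr A.minus_add A.a_ac)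
      thus "u \<oplus> v \<in> {u \<in> carrier U. j y \<otimes> u \<ominus> u \<otimes> j y \<in> words k}"
        using uv submodule_facts(4)[OF words_submodule] by simp
    next
      fix c u assume c: "c \<in> carrier K" and u: "u \<in> {u \<in> carrier U. j y \<otimes> u \<ominus> u \<otimes> j y \<in> words k}"
      have "j y \<otimes> (c \<odot> u) \<ominus> (c \<odot> u) \<otimes> j y = c \<odot> (j y \<otimes> u \<ominus> u \<otimes> j y)"
        using c u jy by (simp add: a_minus_def smult_mult_left smult_mult_right md.smult_r_distr md.smult_r_minus)
      thus "c \<odot> u \<in> {u \<in> carrier U. j y \<otimes> u \<ominus> u \<otimes> j y \<in> words k}"
        using c u submodule_facts(3)[OF words_submodule] by simp
    qed auto
    show "wd w \<in> {u \<in> carrier U. j y \<otimes> u \<ominus> u \<otimes> j y \<in> words k}"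
      if "w \<in> lists (carrier L)" "length w \<le> k" for w
      using 1[OF that(1)] words_mono[OF that(2)] wd_closed[OF that(1)] by auto
  qed
  thus ?thesis using u by blast
qed

theorem PLM_algebra_if_finite_dimensional:
  fixes T :: "'m itself"
  assumes "field K" "finite_dimensional K L"
  shows "PLM_algebra T K U"
proof -
  obtain S where S: "finite S" "S \<subseteq> carrier L"
    "\<And>W. submodule W K L \<Longrightarrow> S \<subseteq> W \<Longrightarrow> W = carrier L"
    using assms(2) unfolding finite_dimensional_def by blast
  obtain ss where ss: "set ss = S" using finite_list S(1) by blast
  interpret G: filtered_generators K U words "length ss" "\<lambda>i. j (ss ! i)" "\<lambda>_. 1"
  proof (intro filtered_generators.intro filtered_generators_axioms.intro filtered_algebra.intro
      filtered_algebra_axioms.intro algebra_over_axioms words_filtration)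
    fix i assume "i < length ss"
    hence s: "ss ! i \<in> carrier L" using ss S(2) by (metis nth_mem subsetD)
    thus "j (ss ! i) \<in> words 1" using wd_words[of "[ss ! i]" 1] j_closed by simp
    \<comment> \<open>Generators have degree \<open>1\<close>, so the degree just below
      \<open>1 + k\<close> is \<open>k\<close>, exactly what \<open>words_commute\<close>
      provides.\<close>
    show "j (ss ! i) \<otimes> y \<ominus> y \<otimes> j (ss ! i) \<in> filt_pred U words (1 + k)" if "y \<in> words k" for y k
      using words_commute[OF s that] by (simp add: filt_pred_def)
  qed
  have wd_G: "wd w \<in> G.G (length w)" if "w \<in> lists (carrier L)" for w
    using that
  proof (induction w)
    case Nil
    show ?case using G.one_G by simp
  next
    case (Cons z w)
    hence z: "z \<in> carrier L" and w: "wd w \<in> carrier U" "wd w \<in> G.G (length w)" by (auto simp: wd_closed)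
    \<comment> \<open>The next letter is an arbitrary element of \<open>L\<close>. By linearity of
      \<open>j\<close> the admissible letters form a subspace, so the finite spanning set
      suffices.\<close>
    let ?W = "{y \<in> carrier L. j y \<otimes> wd w \<in> G.G (Suc (length w))}"
    have "submodule ?W K L"
    proof (rule L.subspace_intro)
      have "j \<zero>\<^bsub>L\<^esub> = \<zero>" using j_smult[of "\<zero>\<^bsub>K\<^esub>" "\<zero>\<^bsub>L\<^esub>"] j_closed by simp
      thus "\<zero>\<^bsub>L\<^esub> \<in> ?W" using w submodule_facts(5)[OF G.G_submodule] by simp
    next
      fix y z assume "y \<in> ?W" "z \<in> ?W"
      thus "y \<oplus>\<^bsub>L\<^esub> z \<in> ?W" using w submodule_facts(4)[OF G.G_submodule]
        by (simp add: j_add j_closed A.l_distr)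
    next
      fix c y assume "c \<in> carrier K" "y \<in> ?W"
      thus "c \<odot>\<^bsub>L\<^esub> y \<in> ?W" using w submodule_facts(3)[OF G.G_submodule]
        by (simp add: j_smult j_closed smult_mult_left)
    qed auto
    moreover have "S \<subseteq> ?W"
    proof
      fix s assume s: "s \<in> S"
      then obtain i where "i < length ss" "s = ss ! i" using ss by (metis in_set_conv_nth)
      thus "s \<in> ?W" using G.x_mult_G[of i "wd w" "length w"] w s S(2) by auto
    qed
    ultimately have "?W = carrier L" by (rule S(3))
    thus ?case using z by auto
  qed
  have "words k \<subseteq> G.G k" for k
    using wd_G G.G_mono by (intro words_least G.G_submodule) blast
  thus ?thesis by (intro G.PLM_algebra assms)
qed

end

section \<open>Free algebras and enveloping algebras\<close>

context cring
begin

definition conv :: "('g list \<Rightarrow> 'a) \<Rightarrow> ('g list \<Rightarrow> 'a) \<Rightarrow> 'g list \<Rightarrow> 'a" where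
  "conv p q w = (\<Oplus>i \<in> {..length w}. p (take i w) \<otimes> q (drop i w))"

lemma conv_Nil: 
  assumes "\<And>w. p w \<in> carrier R" "\<And>w. q w \<in> carrier R"
  shows "conv p q [] = p [] \<otimes> q []"
  using assms by (simp add: conv_def)

text \<open>Split off the factorisation with empty left part; the others are a convolution with the
  left derivative of \<open>p\<close> by the letter \<open>x\<close>. Identities for
  \<open>conv\<close> then follow by induction on the word with \<open>p\<close> varying.\<close>

lemma conv_Cons:
  assumes "\<And>w. p w \<in> carrier R" "\<And>w. q w \<in> carrier R"
  shows "conv p q (x # w) = p [] \<otimes> q (x # w) \<oplus> conv (\<lambda>v. p (x # v)) q w"
proof -
  have "conv p q (x # w) = (\<Oplus>i \<in> {..length w}. p (take (Suc i) (x # w)) \<otimes> q (drop (Suc i) (x # w)))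
      \<oplus> p (take 0 (x # w)) \<otimes> q (drop 0 (x # w))"
    unfolding conv_def length_Cons using assms by (intro finsum_Suc2) auto
  also have "(\<Oplus>i \<in> {..length w}. p (take (Suc i) (x # w)) \<otimes> q (drop (Suc i) (x # w)))
      = conv (\<lambda>v. p (x # v)) q w" by (simp add: conv_def)
  finally show ?thesis using assms by (simp add: conv_def a_comm Pi_def)
qed

lemma conv_closed:
  "(\<And>w. p w \<in> carrier R) \<Longrightarrow> (\<And>w. q w \<in> carrier R) \<Longrightarrow> conv p q w \<in> carrier R"
  by (simp add: conv_def Pi_def)

lemma conv_add_left:
  assumes "\<And>w. p w \<in> carrier R" "\<And>w. q w \<in> carrier R" "\<And>w. r w \<in> carrier R"
  shows "conv (\<lambda>v. p v \<oplus> q v) r w = conv p r w \<oplus> conv q r w"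
  using assms
proof (induction w arbitrary: p q)
  case (Cons x w)
  note IH = Cons.IH[of "\<lambda>v. p (x # v)" "\<lambda>v. q (x # v)"]
  have cl: "conv (\<lambda>v. p (x # v)) r w \<in> carrier R" "conv (\<lambda>v. q (x # v)) r w \<in> carrier R"
    using Cons.prems by (auto intro: conv_closed)
  show ?case using Cons.prems IH cl by (simp add: conv_Cons l_distr a_ac)
qed (simp add: conv_Nil l_distr)

lemma conv_add_right:
  assumes "\<And>w. p w \<in> carrier R" "\<And>w. q w \<in> carrier R" "\<And>w. r w \<in> carrier R"
  shows "conv r (\<lambda>v. p v \<oplus> q v) w = conv r p w \<oplus> conv r q w"
  using assms
proof (induction w arbitrary: r)
  case (Cons x w)
  note IH = Cons.IH[of "\<lambda>v. r (x # v)"]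
  have cl: "conv (\<lambda>v. r (x # v)) p w \<in> carrier R" "conv (\<lambda>v. r (x # v)) q w \<in> carrier R"
    using Cons.prems by (auto intro: conv_closed)
  show ?case using Cons.prems IH cl by (simp add: conv_Cons r_distr a_ac)
qed (simp add: conv_Nil r_distr)

lemma conv_smult_left:
  assumes "c \<in> carrier R" "\<And>w. p w \<in> carrier R" "\<And>w. q w \<in> carrier R"
  shows "conv (\<lambda>v. c \<otimes> p v) q w = c \<otimes> conv p q w"
  using assms
proof (induction w arbitrary: p)
  case (Cons x w)
  note IH = Cons.IH[of "\<lambda>v. p (x # v)"]
  have "conv (\<lambda>v. p (x # v)) q w \<in> carrier R" using Cons.prems by (auto intro: conv_closed)
  thus ?case using Cons.prems IH by (simp add: conv_Cons r_distr m_assoc)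
qed (simp add: conv_Nil m_assoc)

lemma conv_smult_right:
  assumes "c \<in> carrier R" "\<And>w. p w \<in> carrier R" "\<And>w. q w \<in> carrier R"
  shows "conv p (\<lambda>v. c \<otimes> q v) w = c \<otimes> conv p q w"
  using assms
proof (induction w arbitrary: p)
  case (Cons x w)
  note IH = Cons.IH[of "\<lambda>v. p (x # v)"]
  have "conv (\<lambda>v. p (x # v)) q w \<in> carrier R" using Cons.prems by (auto intro: conv_closed)
  thus ?case using Cons.prems IH by (simp add: conv_Cons r_distr m_lcomm)
qed (simp add: conv_Nil m_lcomm)

lemma conv_zero_left: "(\<And>w. q w \<in> carrier R) \<Longrightarrow> conv (\<lambda>_. \<zero>) q w = \<zero>"
  by (induction w) (simp_all add: conv_Nil conv_Cons)

text \<open>The derivative of a product by the letter \<open>x\<close> is \<open>p []\<close> times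
  the derivative of \<open>q\<close>, plus the derivative of \<open>p\<close> times
  \<open>q\<close>. Inserting this on the left reduces the claim to shorter words.\<close>

lemma conv_assoc:
  assumes "\<And>w. p w \<in> carrier R" "\<And>w. q w \<in> carrier R" "\<And>w. r w \<in> carrier R"
  shows "conv (conv p q) r w = conv p (conv q r) w"
  using assms
proof (induction w arbitrary: p q)
  case Nil
  thus ?case by (simp add: conv_Nil conv_closed m_assoc)
next
  case (Cons x w)
  let ?p = "\<lambda>v. p (x # v)" and ?q = "\<lambda>v. q (x # v)"
  note prem = Cons.prems
  have "conv (conv p q) r (x # w) = conv p q [] \<otimes> r (x # w) \<oplus> conv (\<lambda>v. conv p q (x # v)) r w"
    using prem by (simp add: conv_Cons[of "conv p q"] conv_closed)
  also have "(\<lambda>v. conv p q (x # v)) = (\<lambda>v. p [] \<otimes> ?q v \<oplus> conv ?p q v)"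
    using prem by (simp add: conv_Cons)
  also have "conv (\<lambda>v. p [] \<otimes> ?q v \<oplus> conv ?p q v) r w = p [] \<otimes> conv ?q r w \<oplus> conv (conv ?p q) r w"
    using prem by (simp add: conv_add_left conv_smult_left conv_closed)
  also have "conv (conv ?p q) r w = conv ?p (conv q r) w"
    using prem by (intro Cons.IH) auto
  also have "conv p q [] \<otimes> r (x # w) \<oplus> (p [] \<otimes> conv ?q r w \<oplus> conv ?p (conv q r) w)
      = p [] \<otimes> conv q r (x # w) \<oplus> conv ?p (conv q r) w"
    using prem by (simp add: conv_Nil conv_Cons[of q] r_distr m_assoc a_assoc conv_closed)
  also have "\<dots> = conv p (conv q r) (x # w)"
    using prem by (simp add: conv_Cons[of p] conv_closed)
  finally show ?case .
qed

text \<open>The basis of the free algebra; the empty word is its unit and one-letter words are its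
  generators.\<close>

definition word :: "'g list \<Rightarrow> 'g list \<Rightarrow> 'a" where "word u = (\<lambda>w. if w = u then \<one> else \<zero>)"

lemma word_closed [simp]: "word u w \<in> carrier R" by (simp add: word_def)

lemma conv_one_left: "(\<And>w. q w \<in> carrier R) \<Longrightarrow> conv (word []) q w = q w"
  by (cases w) (simp_all add: conv_Nil conv_Cons word_def conv_zero_left)

lemma conv_one_right:
  assumes "\<And>w. q w \<in> carrier R" shows "conv q (word []) w = q w"
  using assms
proof (induction w arbitrary: q)
  case (Cons x w)
  show ?case using Cons.prems Cons.IH[of "\<lambda>v. q (x # v)"]
    by (simp add: conv_Cons) (simp add: word_def)
qed (simp add: conv_Nil word_def)

lemma conv_word_word: "conv (word u) (word v) w = word (u @ v) w"
proof (induction u arbitrary: w)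
  case Nil
  show ?case by (simp add: conv_one_left)
next
  case (Cons x u)
  show ?case
  proof (cases w)
    case (Cons y w')
    have "(\<lambda>v. word (x # u) (y # v)) = (if x = y then word u else (\<lambda>_. \<zero>))"
      by (auto simp: word_def)
    moreover have "word (x # u) [] = \<zero>" by (simp add: word_def)
    ultimately show ?thesis using Cons.IH Cons
      by (auto simp: conv_Cons conv_zero_left) (auto simp: word_def)
  qed (simp add: conv_Nil word_def)
qed

text \<open>Puts the support of a product inside the concatenations of the two supports, hence keeps
  it finite.\<close>

lemma conv_support:
  assumes "\<And>w. p w \<in> carrier R" "\<And>w. q w \<in> carrier R" "conv p q w \<noteq> \<zero>"
  shows "\<exists>u v. w = u @ v \<and> p u \<noteq> \<zero> \<and> q v \<noteq> \<zero>"
proof (rule ccontr)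
  assume n: "\<not> ?thesis"
  have "p (take i w) \<otimes> q (drop i w) = \<zero>" for i
  proof -
    have "p (take i w) = \<zero> \<or> q (drop i w) = \<zero>" using n append_take_drop_id[of i w] by metis
    thus ?thesis using assms(1,2) by auto
  qed
  thus False using assms(3) by (simp add: conv_def)
qed

section \<open>The free algebra as an algebra spanned by words\<close>

context
  fixes X :: "'g set" and T :: "('a, 'g list \<Rightarrow> 'a) module"
  defines "T \<equiv> free_algebra R X"
begin

lemma free_algebra_carrier: "p \<in> carrier T \<longleftrightarrow> (\<forall>w. p w \<in> carrier R) \<and> finite {w. p w \<noteq> \<zero>} \<and>
    (\<forall>w. p w \<noteq> \<zero> \<longrightarrow> w \<in> lists X)"
  by (auto simp: T_def free_algebra_def)

lemma free_algebra_ops: "p \<otimes>\<^bsub>T\<^esub> q = conv p q" "\<one>\<^bsub>T\<^esub> = word []" "\<zero>\<^bsub>T\<^esub> = (\<lambda>_. \<zero>)"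
  "p \<oplus>\<^bsub>T\<^esub> q = (\<lambda>w. p w \<oplus> q w)" "k \<odot>\<^bsub>T\<^esub> p = (\<lambda>w. k \<otimes> p w)"
  by (auto simp: T_def free_algebra_def conv_def word_def)

lemma free_algebra_supportI:
  assumes "\<And>w. p w \<in> carrier R" "\<And>w. p w \<noteq> \<zero> \<Longrightarrow> w \<in> S" "finite S" "S \<subseteq> lists X"
  shows "p \<in> carrier T"
proof -
  have "{w. p w \<noteq> \<zero>} \<subseteq> S" using assms(2) by blast
  thus ?thesis unfolding free_algebra_carrier using assms finite_subset by blast
qed

lemma free_algebra_support: 
  "p \<in> carrier T \<Longrightarrow> finite {w. p w \<noteq> \<zero>} \<and> {w. p w \<noteq> \<zero>} \<subseteq> lists X"
  by (auto simp: free_algebra_carrier)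

lemma free_algebra_value: "p \<in> carrier T \<Longrightarrow> p w \<in> carrier R"
  by (simp add: free_algebra_carrier)

lemma free_algebra_add_closed: 
  assumes "p \<in> carrier T" "q \<in> carrier T" shows "p \<oplus>\<^bsub>T\<^esub> q \<in> carrier T"
proof (rule free_algebra_supportI)
  show "w \<in> {w. p w \<noteq> \<zero>} \<union> {w. q w \<noteq> \<zero>}" if "(p \<oplus>\<^bsub>T\<^esub> q) w \<noteq> \<zero>" for w
    using that by (auto simp: free_algebra_ops)
qed (use assms free_algebra_support free_algebra_value in \<open>auto simp: free_algebra_ops\<close>)

lemma free_algebra_smult_closed: 
  assumes "k \<in> carrier R" "p \<in> carrier T" shows "k \<odot>\<^bsub>T\<^esub> p \<in> carrier T"
proof (rule free_algebra_supportI)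
  show "w \<in> {w. p w \<noteq> \<zero>}" if "(k \<odot>\<^bsub>T\<^esub> p) w \<noteq> \<zero>" for w
    using that assms(1) by (auto simp: free_algebra_ops)
qed (use assms free_algebra_support free_algebra_value in \<open>auto simp: free_algebra_ops\<close>)

lemma free_algebra_mult_closed:
  assumes "p \<in> carrier T" "q \<in> carrier T" shows "p \<otimes>\<^bsub>T\<^esub> q \<in> carrier T"
proof (rule free_algebra_supportI)
  let ?S = "(\<lambda>(u, v). u @ v) ` ({w. p w \<noteq> \<zero>} \<times> {w. q w \<noteq> \<zero>})"
  show "(p \<otimes>\<^bsub>T\<^esub> q) w \<in> carrier R" for w
    using assms free_algebra_value by (simp add: free_algebra_ops conv_closed)
  show "w \<in> ?S" if "(p \<otimes>\<^bsub>T\<^esub> q) w \<noteq> \<zero>" for w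
  proof -
    have "\<exists>u v. w = u @ v \<and> p u \<noteq> \<zero> \<and> q v \<noteq> \<zero>"
    proof (rule conv_support)
      show "conv p q w \<noteq> \<zero>" using that by (simp only: free_algebra_ops not_False_eq_True)
    qed (rule free_algebra_value[OF assms(1)], rule free_algebra_value[OF assms(2)])
    then obtain u v where "w = u @ v" "p u \<noteq> \<zero>" "q v \<noteq> \<zero>" by blast
    thus ?thesis by (intro image_eqI[of _ _ "(u, v)"]) auto
  qed
  show "finite ?S" using free_algebra_support[OF assms(1)] free_algebra_support[OF assms(2)] by simp
  show "?S \<subseteq> lists X" using assms unfolding free_algebra_carrier by fastforce
qed

lemma free_algebra_word: "u \<in> lists X \<Longrightarrow> word u \<in> carrier T"
  by (rule free_algebra_supportI[of _ "{u}"]) (auto simp: word_def split: if_splits)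

lemma free_algebra_zero: "\<zero>\<^bsub>T\<^esub> \<in> carrier T"
  by (rule free_algebra_supportI[of _ "{}"]) (auto simp: free_algebra_ops)

lemma free_algebra_abelian_group: "abelian_group T"
proof (rule abelian_groupI)
  fix p q r assume "p \<in> carrier T" "q \<in> carrier T" "r \<in> carrier T"
  thus "p \<oplus>\<^bsub>T\<^esub> q \<oplus>\<^bsub>T\<^esub> r = p \<oplus>\<^bsub>T\<^esub> (q \<oplus>\<^bsub>T\<^esub> r)"
    by (simp add: free_algebra_ops free_algebra_value a_assoc)
next
  fix p q assume "p \<in> carrier T" "q \<in> carrier T"
  thus "p \<oplus>\<^bsub>T\<^esub> q = q \<oplus>\<^bsub>T\<^esub> p" by (simp add: free_algebra_ops free_algebra_value a_comm)
next
  fix p assume p: "p \<in> carrier T"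
  have "(\<ominus> \<one>) \<odot>\<^bsub>T\<^esub> p \<in> carrier T" using p free_algebra_smult_closed by simp
  moreover have "(\<ominus> \<one>) \<odot>\<^bsub>T\<^esub> p \<oplus>\<^bsub>T\<^esub> p = \<zero>\<^bsub>T\<^esub>"
    using p by (simp add: free_algebra_ops free_algebra_value l_minus l_neg)
  ultimately show "\<exists>q \<in> carrier T. q \<oplus>\<^bsub>T\<^esub> p = \<zero>\<^bsub>T\<^esub>" by blast
  show "\<zero>\<^bsub>T\<^esub> \<oplus>\<^bsub>T\<^esub> p = p" using p by (simp add: free_algebra_ops free_algebra_value)
qed (simp_all add: free_algebra_add_closed free_algebra_zero)

lemma free_algebra_ring: "ring T"
proof (intro ringI free_algebra_abelian_group monoidI)
  fix p q r assume "p \<in> carrier T" "q \<in> carrier T" "r \<in> carrier T"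
  thus "p \<otimes>\<^bsub>T\<^esub> q \<otimes>\<^bsub>T\<^esub> r = p \<otimes>\<^bsub>T\<^esub> (q \<otimes>\<^bsub>T\<^esub> r)"
    and "(p \<oplus>\<^bsub>T\<^esub> q) \<otimes>\<^bsub>T\<^esub> r = p \<otimes>\<^bsub>T\<^esub> r \<oplus>\<^bsub>T\<^esub> q \<otimes>\<^bsub>T\<^esub> r"
    and "r \<otimes>\<^bsub>T\<^esub> (p \<oplus>\<^bsub>T\<^esub> q) = r \<otimes>\<^bsub>T\<^esub> p \<oplus>\<^bsub>T\<^esub> r \<otimes>\<^bsub>T\<^esub> q"
    using free_algebra_value by (simp_all add: free_algebra_ops fun_eq_iff conv_assoc conv_add_left conv_add_right)
next
  show "\<one>\<^bsub>T\<^esub> \<in> carrier T" by (simp add: free_algebra_ops(2) free_algebra_word)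
  fix p assume "p \<in> carrier T"
  thus "\<one>\<^bsub>T\<^esub> \<otimes>\<^bsub>T\<^esub> p = p" "p \<otimes>\<^bsub>T\<^esub> \<one>\<^bsub>T\<^esub> = p"
    using free_algebra_value by (simp_all add: free_algebra_ops fun_eq_iff conv_one_left conv_one_right)
qed (rule free_algebra_mult_closed)

lemma free_algebra_module: "module R T"
proof (rule moduleI[OF is_cring free_algebra_abelian_group])
  fix a b p assume "a \<in> carrier R" "b \<in> carrier R" "p \<in> carrier T"
  thus "(a \<oplus> b) \<odot>\<^bsub>T\<^esub> p = a \<odot>\<^bsub>T\<^esub> p \<oplus>\<^bsub>T\<^esub> b \<odot>\<^bsub>T\<^esub> p"
    "(a \<otimes> b) \<odot>\<^bsub>T\<^esub> p = a \<odot>\<^bsub>T\<^esub> (b \<odot>\<^bsub>T\<^esub> p)"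
    by (simp_all add: free_algebra_ops free_algebra_value l_distr m_assoc)
next
  fix a p q assume "a \<in> carrier R" "p \<in> carrier T" "q \<in> carrier T"
  thus "a \<odot>\<^bsub>T\<^esub> (p \<oplus>\<^bsub>T\<^esub> q) = a \<odot>\<^bsub>T\<^esub> p \<oplus>\<^bsub>T\<^esub> a \<odot>\<^bsub>T\<^esub> q"
    by (simp add: free_algebra_ops free_algebra_value r_distr)
qed (simp_all add: free_algebra_smult_closed, simp add: free_algebra_ops free_algebra_value)

lemma free_algebra_K_algebra: "K_algebra R T"
proof (intro K_algebra.intro K_algebra_axioms.intro free_algebra_ring free_algebra_module)
  fix k p q assume "k \<in> carrier R" "p \<in> carrier T" "q \<in> carrier T"
  thus "k \<odot>\<^bsub>T\<^esub> p \<otimes>\<^bsub>T\<^esub> q = k \<odot>\<^bsub>T\<^esub> (p \<otimes>\<^bsub>T\<^esub> q)" "p \<otimes>\<^bsub>T\<^esub> (k \<odot>\<^bsub>T\<^esub> q) = k \<odot>\<^bsub>T\<^esub> (p \<otimes>\<^bsub>T\<^esub> q)"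
    using free_algebra_value by (simp_all add: free_algebra_ops fun_eq_iff conv_smult_left conv_smult_right)
qed

text \<open>Induction on a finite set containing the support: setting the coefficient of one word to
  zero subtracts a multiple of that word.\<close>

lemma free_algebra_spanned:
  assumes W: "submodule W R T" and words: "\<And>w. w \<in> lists X \<Longrightarrow> word w \<in> W"
  shows "carrier T \<subseteq> W"
proof
  interpret T: module R T by (rule free_algebra_module)
  fix p assume "p \<in> carrier T"
  moreover have "p \<in> W" if "finite S" "p \<in> carrier T" "{w. p w \<noteq> \<zero>} \<subseteq> S" "S \<subseteq> lists X" for S p
    using that
  proof (induction S arbitrary: p)
    case empty
    hence "p = \<zero>\<^bsub>T\<^esub>" by (auto simp: free_algebra_ops fun_eq_iff)
    moreover have "\<zero>\<^bsub>T\<^esub> \<in> W" using subgroup.one_closed[OF submodule.axioms(1)[OF W]] by simp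
    ultimately show ?case by simp
  next
    case (insert w S)
    have wX: "w \<in> lists X" using insert by simp
    have pT: "p v \<in> carrier R" for v using insert free_algebra_value by blast
    let ?q = "p(w := \<zero>)"
    have q: "?q \<in> carrier T"
    proof (rule free_algebra_supportI)
      show "?q v \<in> carrier R" for v using pT by simp
      show "v \<in> S" if "?q v \<noteq> \<zero>" for v using that insert by (auto split: if_splits)
    qed (use insert in auto)
    have "?q \<in> W"
    proof (rule insert.IH[OF q])
      show "{v. ?q v \<noteq> \<zero>} \<subseteq> S" using insert.prems(2) by (auto split: if_splits)
      show "S \<subseteq> lists X" using insert.prems(3) by blast
    qed
    moreover have "p w \<odot>\<^bsub>T\<^esub> word w \<in> W" using T.submoduleE(4)[OF W pT words[OF wX]] .
    ultimately have "p w \<odot>\<^bsub>T\<^esub> word w \<oplus>\<^bsub>T\<^esub> ?q \<in> W" using T.submoduleE(5)[OF W] by blast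
    moreover have "p w \<odot>\<^bsub>T\<^esub> word w \<oplus>\<^bsub>T\<^esub> ?q = p" using pT by (auto simp: free_algebra_ops word_def fun_eq_iff)
    ultimately show ?case by simp
  qed
  ultimately show "p \<in> W" using free_algebra_support by blast
qed

end

end

context algebra_over
begin

text \<open>Scalars act as multiplication by the elements \<open>scalar k\<close>, so ideals absorb
  them.\<close>

lemma ideal_submodule: 
  assumes "ideal I A" shows "submodule I K A"
proof -
  interpret I: ideal I A by fact
  have "k \<odot> y \<in> I" if "k \<in> carrier K" "y \<in> I" for k y
    using I.I_l_closed[OF that(2), of "scalar k"] that I.a_subset by (auto simp: scalar_mult)
  thus ?thesis using I.a_subgroup by (simp add: submodule_def submodule_axioms_def)
qed

section \<open>The quotient of an algebra by an ideal\<close>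

context
  fixes I and Q :: "('k, 'a set) module"
  assumes I: "ideal I A"
  defines "Q \<equiv> quotient_algebra A I"
begin

interpretation I: ideal I A by (rule I)

lemma quotient_carrier: "carrier Q = (\<lambda>y. I +> y) ` carrier A"
  by (auto simp: Q_def quotient_algebra_def FactRing_def A_RCOSETS_def' a_r_coset_def[symmetric])

lemma quotient_add: "y \<in> carrier A \<Longrightarrow> z \<in> carrier A \<Longrightarrow> (I +> y) \<oplus>\<^bsub>Q\<^esub> (I +> z) = I +> (y \<oplus> z)"
  using I.a_rcos_sum by (simp add: Q_def quotient_algebra_def FactRing_def)

lemma quotient_mult: "y \<in> carrier A \<Longrightarrow> z \<in> carrier A \<Longrightarrow> (I +> y) \<otimes>\<^bsub>Q\<^esub> (I +> z) = I +> (y \<otimes> z)"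
  using I.rcoset_mult_add by (simp add: Q_def quotient_algebra_def FactRing_def)

lemma quotient_one: "\<one>\<^bsub>Q\<^esub> = I +> \<one>"
  by (simp add: Q_def quotient_algebra_def FactRing_def)

lemma quotient_zero: "\<zero>\<^bsub>Q\<^esub> = I +> \<zero>"
  using I.a_subset by (auto simp: Q_def quotient_algebra_def FactRing_def mem_coset[OF ideal_submodule[OF I]] a_minus_def)

lemma quotient_smult: "k \<in> carrier K \<Longrightarrow> y \<in> carrier A \<Longrightarrow> k \<odot>\<^bsub>Q\<^esub> (I +> y) = I +> (k \<odot> y)"
  using coset_smult[OF ideal_submodule[OF I]] by (simp add: Q_def quotient_algebra_def)

lemmas quotient_ops = quotient_add quotient_mult quotient_one quotient_zero quotient_smult

lemma quotient_abelian_group: "abelian_group Q"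
proof (rule abelian_groupI)
  fix x assume "x \<in> carrier Q"
  then obtain y where y: "y \<in> carrier A" "x = I +> y" by (auto simp: quotient_carrier)
  have "(I +> (\<ominus> y)) \<oplus>\<^bsub>Q\<^esub> x = \<zero>\<^bsub>Q\<^esub>" using y by (simp add: quotient_ops A.l_neg)
  thus "\<exists>z \<in> carrier Q. z \<oplus>\<^bsub>Q\<^esub> x = \<zero>\<^bsub>Q\<^esub>" using y by (auto simp: quotient_carrier)
qed (auto simp: quotient_carrier quotient_ops A.a_ac intro!: imageI)

lemma quotient_ring: "ring Q"
  by (intro ringI quotient_abelian_group monoidI)
    (auto simp: quotient_carrier quotient_ops A.m_assoc A.l_distr A.r_distr intro!: imageI)

lemma quotient_module: "module K Q"
  by (rule moduleI[OF K.is_cring quotient_abelian_group])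
    (auto simp: quotient_carrier quotient_ops md.smult_l_distr md.smult_r_distr md.smult_assoc1 intro!: imageI)

lemma quotient_K_algebra: "K_algebra K Q"
  by (intro K_algebra.intro K_algebra_axioms.intro quotient_ring quotient_module)
    (auto simp: quotient_carrier quotient_ops smult_mult_left smult_mult_right)

text \<open>Transfers the spanning property of words from the free algebra to its quotient.\<close>

lemma quotient_vimage_submodule:
  assumes "submodule W K Q"
  shows "submodule {y \<in> carrier A. I +> y \<in> W} K A"
proof (rule md.subspace_intro)
  interpret Q: module K Q by (rule quotient_module)
  have "\<zero>\<^bsub>Q\<^esub> \<in> W" using subgroup.one_closed[OF submodule.axioms(1)[OF assms]] by simp
  thus "\<zero> \<in> {y \<in> carrier A. I +> y \<in> W}" by (simp add: quotient_zero)
  show "y \<oplus> z \<in> {y \<in> carrier A. I +> y \<in> W}"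
    if "y \<in> {y \<in> carrier A. I +> y \<in> W}" "z \<in> {y \<in> carrier A. I +> y \<in> W}" for y z
    using that Q.submoduleE(5)[OF assms, of "I +> y" "I +> z"] by (simp add: quotient_add)
  show "k \<odot> y \<in> {y \<in> carrier A. I +> y \<in> W}"
    if "k \<in> carrier K" "y \<in> {y \<in> carrier A. I +> y \<in> W}" for k y
    using that Q.submoduleE(4)[OF assms, of k "I +> y"] by (simp add: quotient_smult)
qed auto

end

end

text \<open>Here \<open>j\<close> sends an element of \<open>L\<close> to the class of its
  generator. The three families of relations become additivity, homogeneity and the bracket identity
  of \<open>j\<close>.\<close>

lemma enveloping_lie_generated:
  assumes K: "field K" and L: "lie_algebra K L br"
  shows "\<exists>j. lie_generated K (universal_enveloping_algebra K L br) L br j"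
proof -
  interpret K: field K by (rule K)
  interpret L: lie_algebra K L br by (rule L)
  define T where "T = free_algebra K (carrier L)"
  define E where "E = enveloping_relations K L br"
  define I where "I = genideal T E"
  define Q where "Q = quotient_algebra T I"
  define j where "j y = I +>\<^bsub>T\<^esub> free_gen K y" for y
  interpret T: algebra_over K T by (simp add: algebra_over_def T_def K.free_algebra_K_algebra)
  have \<iota>: "free_gen K y = K.word [y]" for y by (simp add: free_gen_def K.word_def)
  have \<iota>T: "free_gen K y \<in> carrier T" if "y \<in> carrier L" for y
    unfolding \<iota> T_def using that by (intro K.free_algebra_word) simp
  have "E \<subseteq> carrier T"
    unfolding E_def enveloping_relations_def Let_def T_def[symmetric]
    using \<iota>T L.br_closed by auto
  hence I: "ideal I T" "E \<subseteq> I"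
    unfolding I_def by (rule T.A.genideal_ideal, rule T.A.genideal_self)
  note Q_ops = T.quotient_ops[OF I(1), folded Q_def]
  note eq = T.coset_eq_iff[OF T.ideal_submodule[OF I(1)]]
  note E_unfold = E_def enveloping_relations_def Let_def T_def[symmetric]
  have rel_add: "free_gen K (x \<oplus>\<^bsub>L\<^esub> y) \<ominus>\<^bsub>T\<^esub> (free_gen K x \<oplus>\<^bsub>T\<^esub> free_gen K y) \<in> I"
    if "x \<in> carrier L" "y \<in> carrier L" for x y
    by (rule subsetD[OF I(2)], unfold E_unfold, rule UnI1, rule UnI1) (intro CollectI exI conjI, rule refl, (rule that)+)
  have rel_smult: "free_gen K (k \<odot>\<^bsub>L\<^esub> x) \<ominus>\<^bsub>T\<^esub> k \<odot>\<^bsub>T\<^esub> free_gen K x \<in> I"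
    if "k \<in> carrier K" "x \<in> carrier L" for k x
    by (rule subsetD[OF I(2)], unfold E_unfold, rule UnI1, rule UnI2) (intro CollectI exI conjI, rule refl, (rule that)+)
  have rel_br: "((free_gen K x \<otimes>\<^bsub>T\<^esub> free_gen K y) \<ominus>\<^bsub>T\<^esub> (free_gen K y \<otimes>\<^bsub>T\<^esub> free_gen K x))
      \<ominus>\<^bsub>T\<^esub> free_gen K (br x y) \<in> I"
    if "x \<in> carrier L" "y \<in> carrier L" for x y
    by (rule subsetD[OF I(2)], unfold E_unfold, rule UnI2) (intro CollectI exI conjI, rule refl, (rule that)+)
  interpret Q: algebra_over K Q
    using T.quotient_K_algebra[OF I(1)] by (simp add: algebra_over_def Q_def)
  have jQ: "j y \<in> carrier Q" if "y \<in> carrier L" for y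
    using \<iota>T[OF that] T.quotient_carrier[OF I(1)] by (simp add: j_def Q_def)
  have words: "foldr (\<lambda>y u. j y \<otimes>\<^bsub>Q\<^esub> u) w \<one>\<^bsub>Q\<^esub> = I +>\<^bsub>T\<^esub> K.word w" if "w \<in> lists (carrier L)" for w
    using that
  proof (induction w)
    case Nil
    show ?case by (simp add: Q_ops(3)) (simp add: T_def K.free_algebra_ops)
  next
    case (Cons y w)
    have "K.word [y] \<otimes>\<^bsub>T\<^esub> K.word w = K.word (y # w)"
      using K.conv_word_word[of "[y]" w] by (simp add: T_def K.free_algebra_ops fun_eq_iff)
    moreover have "K.word w \<in> carrier T" unfolding T_def using Cons by (intro K.free_algebra_word) simp
    ultimately show ?case using Cons \<iota>T[of y] by (simp add: j_def Q_ops(2) \<iota>)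
  qed
  have "lie_generated K Q L br j"
  proof (intro lie_generated.intro lie_generated_axioms.intro Q.algebra_over_axioms L.module_axioms
      L.br_closed jQ)
    fix y z assume yz: "y \<in> carrier L" "z \<in> carrier L"
    note cl = \<iota>T[OF yz(1)] \<iota>T[OF yz(2)]
    show "j (y \<oplus>\<^bsub>L\<^esub> z) = j y \<oplus>\<^bsub>Q\<^esub> j z"
      using rel_add[OF yz] cl \<iota>T[of "y \<oplus>\<^bsub>L\<^esub> z"] yz by (simp add: j_def Q_ops(1) eq)
    have "j y \<otimes>\<^bsub>Q\<^esub> j z \<ominus>\<^bsub>Q\<^esub> j z \<otimes>\<^bsub>Q\<^esub> j y = j (br y z)"
    proof -
      let ?a = "free_gen K y \<otimes>\<^bsub>T\<^esub> free_gen K z" and ?b = "free_gen K z \<otimes>\<^bsub>T\<^esub> free_gen K y"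
      have "I +>\<^bsub>T\<^esub> (?a \<ominus>\<^bsub>T\<^esub> ?b) = j (br y z)"
        using rel_br[OF yz] cl \<iota>T[OF L.br_closed[OF yz]] by (simp add: j_def eq)
      \<comment> \<open>The bracket relation is carried to the quotient as an identity between sums,
        because the quotient rules cover addition but not subtraction.\<close>
      moreover have "(I +>\<^bsub>T\<^esub> (?a \<ominus>\<^bsub>T\<^esub> ?b)) \<oplus>\<^bsub>Q\<^esub> (I +>\<^bsub>T\<^esub> ?b) = I +>\<^bsub>T\<^esub> ?a"
        using cl by (simp add: Q_ops(1) a_minus_def T.A.a_assoc T.A.l_neg)
      ultimately have "j (br y z) \<oplus>\<^bsub>Q\<^esub> j z \<otimes>\<^bsub>Q\<^esub> j y = j y \<otimes>\<^bsub>Q\<^esub> j z"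
        using cl by (simp add: j_def Q_ops(2))
      thus ?thesis using jQ[OF yz(1)] jQ[OF yz(2)] jQ[OF L.br_closed[OF yz]]
        by (metis Q.A.m_closed Q.A.r_neg Q.A.r_zero Q.A.a_assoc Q.A.a_inv_closed a_minus_def)
    qed
    thus "j (br y z) = j y \<otimes>\<^bsub>Q\<^esub> j z \<ominus>\<^bsub>Q\<^esub> j z \<otimes>\<^bsub>Q\<^esub> j y" by simp
  next
    fix k y assume ky: "k \<in> carrier K" "y \<in> carrier L"
    show "j (k \<odot>\<^bsub>L\<^esub> y) = k \<odot>\<^bsub>Q\<^esub> j y"
      using rel_smult[OF ky] \<iota>T[OF ky(2)] \<iota>T[of "k \<odot>\<^bsub>L\<^esub> y"] ky
      by (simp add: j_def Q_ops(5) eq)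
  next
    fix W assume W: "submodule W K Q"
      and w: "\<And>w. w \<in> lists (carrier L) \<Longrightarrow> foldr (\<lambda>y u. j y \<otimes>\<^bsub>Q\<^esub> u) w \<one>\<^bsub>Q\<^esub> \<in> W"
    have "submodule {y \<in> carrier T. I +>\<^bsub>T\<^esub> y \<in> W} K T"
      using T.quotient_vimage_submodule[OF I(1)] W by (simp add: Q_def)
    moreover have "K.word u \<in> {y \<in> carrier T. I +>\<^bsub>T\<^esub> y \<in> W}" if "u \<in> lists (carrier L)" for u
      using w[OF that] words[OF that] K.free_algebra_word[OF that] by (simp add: T_def)
    ultimately have "carrier T \<subseteq> {y \<in> carrier T. I +>\<^bsub>T\<^esub> y \<in> W}"
      unfolding T_def by (rule K.free_algebra_spanned)
    thus "carrier Q \<subseteq> W" using T.quotient_carrier[OF I(1)] by (auto simp: Q_def)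
  qed
  moreover have "universal_enveloping_algebra K L br = Q"
    by (simp add: universal_enveloping_algebra_def Let_def Q_def I_def E_def T_def)
  ultimately show ?thesis by auto
qed

theorem proposition1p3:
  fixes K :: "('k, 'x) ring_scheme"
  assumes "field K"
  shows
    "(\<forall>A :: ('k, 'a) module.
        K_algebra K A \<and>
        (\<forall>M :: ('a, 'm) module.
           simple_module A M \<longrightarrow> algebraic_algebra K (End_algebra A M :: ('k, 'm \<Rightarrow> 'm) module)) \<longrightarrow>
        PLM_algebra TYPE('m) K A) \<and>
     (\<forall>A :: ('k, 'a) module.
        K_algebra K A \<and>
        (\<exists>F. filtration K A F \<and>
             commutative_algebra (associated_graded A F) \<and>
             finitely_generated_algebra K (associated_graded A F)) \<longrightarrow>
        PLM_algebra TYPE('m) K A) \<and>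
     (\<forall>(L :: ('k, 'g) module) br.
        lie_algebra K L br \<and> finite_dimensional K L \<longrightarrow>
        PLM_algebra TYPE('m) K (universal_enveloping_algebra K L br))"
proof (intro conjI allI impI)
  fix A :: "('k, 'a) module"
  assume A: "K_algebra K A \<and>
    (\<forall>M :: ('a, 'm) module.
      simple_module A M \<longrightarrow> algebraic_algebra K (End_algebra A M :: ('k, 'm \<Rightarrow> 'm) module))"
  then interpret algebra_over K A by (simp add: algebra_over_def)
  show "PLM_algebra TYPE('m) K A"
    using PLM_algebra_if_End_algebraic[OF assms] A by blast
next
  fix A :: "('k, 'a) module"
  assume "K_algebra K A \<and> (\<exists>F. filtration K A F \<and> commutative_algebra (associated_graded A F) \<and>
    finitely_generated_algebra K (associated_graded A F))"
  then obtain F where F: "K_algebra K A" "filtration K A F"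
    "commutative_algebra (associated_graded A F)"
    "finitely_generated_algebra K (associated_graded A F)" by blast
  interpret filtered_algebra K A F
    using F by (simp add: filtered_algebra_def algebra_over_def filtered_algebra_axioms_def)
  show "PLM_algebra TYPE('m) K A"
    by (rule PLM_algebra_if_graded_commutative[OF assms F(3,4)])
next
  fix L :: "('k, 'g) module" and br
  assume L: "lie_algebra K L br \<and> finite_dimensional K L"
  then obtain j where "lie_generated K (universal_enveloping_algebra K L br) L br j"
    using enveloping_lie_generated[OF assms] by blast
  thus "PLM_algebra TYPE('m) K (universal_enveloping_algebra K L br)"
    using lie_generated.PLM_algebra_if_finite_dimensional assms L by blast
qed

end
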